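(* Let $F/\mathbb{F}_{q^r}$ be a function field of genus $g$ containing $s$ rational places, denoted by $P_1,\ldots,P_s$. Let $\mathcal{C}_{\mathrm{par}}$ be the $q$-ary single parity check code of length $r+1$ and dimension $r$, which has minimum distance $2$. For an integer $k_0$ with $g-1<k_0<s-g+1$, let $G$ be a divisor of $F$ of degree $k_0+g-1$ with $\mathrm{Supp}(G)\cap\{P_1,\ldots,P_s\}=\emptyset$, and let $D=P_1+\cdots+P_s$. Then the concatenated code $\mathcal{C}_{\mathrm{conc}}$ defined by the outer code $C(D,G)$ and the inner code $\mathcal{C}_{\mathrm{par}}$ is a linear code over $\mathbb{F}_q$ with locality $r$, of length $n=(r+1)s$ and dimension $k=rk_0$, whose minimum distance $d$ satisfies $$d\ge 2\left(s-\frac{k}{r}-g+1\right).$$ It follows that the rate of this code verifies $$\frac{k}{n}\ge\frac{r}{r+1}-\frac{r}{2}\delta-\frac{r(g-1)}{n},\qquad\text{where }\delta=\frac{d}{n}.$$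
   Context: $F/\mathbb{F}_{q^r}$ is an algebraic function field (of one variable) with full constant field $\mathbb{F}_{q^r}$; $P_1,\ldots,P_s$ are distinct. A rational place is a place of degree 1. $\mathcal{L}(G)$ is the Riemann-Roch space of $G$. AG code: $C(D,G)=\{(f(P_1),\ldots,f(P_s)) : f\in\mathcal{L}(G)\}\subset\mathbb{F}_{q^r}^s$. Single parity check code: $\mathcal{C}_{\mathrm{par}}=\{(c_1,\ldots,c_{r+1})\in\mathbb{F}_q^{r+1} : \sum_i c_i=0\}$. Concatenated code: given an outer linear code $\mathcal{C}_{\mathrm{out}}\subset\mathbb{F}_{q^{r}}^s$ and an inner $q$-ary linear code $\mathcal{C}_{\mathrm{in}}$ of dimension $r$ and length $n'$, with a fixed $\mathbb{F}_q$-linear isomorphism $\phi:\mathbb{F}_{q^r}\to\mathcal{C}_{\mathrm{in}}$ (encoding), the concatenated code is $\{(\phi(c_1)\mid\cdots\mid\phi(c_s)) : (c_1,\ldots,c_s)\in\mathcal{C}_{\mathrm{out}}\}\subset\mathbb{F}_q^{n's}$. Locality: a linear code $\mathcal{C}\subset\mathbb{F}_q^n$ has locality $r$ if for each $1\le i\le n$ there is a set $N_i\subset\{1,\ldots,n\}\smallsetminus\{i\}$ with $|N_i|\le r$ such that, for all $c\in\mathcal{C}$, $c_i$ is determined by $(c_j)_{j\in N_i}$ ($r$ not required to be minimal). Assertions involving the minimum distance concern nonzero codes (i.e. $k_0\ge1$). *)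

theory Defs
  imports
    "HOL-Algebra.Finite_Extensions"
    "HOL-Algebra.Generated_Fields"
    "HOL-Algebra.QuotRing"
    "HOL-Algebra.Free_Abelian_Groups"
    "Jordan_Normal_Form.Missing_VectorSpace"
    Complex_Main
begin

section \<open>Algebraic function fields of one variable\<close>

definition function_field :: "('a, 'm) ring_scheme \<Rightarrow> 'a set \<Rightarrow> bool" where
  "function_field F K \<longleftrightarrow> field F \<and> subfield K F \<and>
     (\<exists>x \<in> carrier F. ring.transcendental F K x \<and>
        ring.finite_dimension F (generate_field F (insert x K)) (carrier F))"

definition full_constant_field :: "('a, 'm) ring_scheme \<Rightarrow> 'a set \<Rightarrow> bool" where
  "full_constant_field F K \<longleftrightarrow> {z \<in> carrier F. \<not> ring.transcendental F K z} = K"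

definition valuation_ring :: "('a, 'm) ring_scheme \<Rightarrow> 'a set \<Rightarrow> 'a set \<Rightarrow> bool" where
  "valuation_ring F K V \<longleftrightarrow> subring V F \<and> K \<subset> V \<and> V \<subset> carrier F \<and>
     (\<forall>z \<in> carrier F - {\<zero>\<^bsub>F\<^esub>}. z \<in> V \<or> inv\<^bsub>F\<^esub> z \<in> V)"

definition places :: "('a, 'm) ring_scheme \<Rightarrow> 'a set \<Rightarrow> 'a set set" where
  "places F K = {P. \<exists>V. valuation_ring F K V \<and> maximalideal P (F\<lparr>carrier := V\<rparr>)}"

text \<open>A place determines the valuation ring of which it is the maximal ideal
  (namely $\{z : z^{-1} \notin P\} \cup \{0\}$), so the description below is unique.\<close>

definition place_ring :: "('a, 'm) ring_scheme \<Rightarrow> 'a set \<Rightarrow> 'a set \<Rightarrow> ('a, 'm) ring_scheme" where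
  "place_ring F K P =
     F\<lparr>carrier := (THE V. valuation_ring F K V \<and> maximalideal P (F\<lparr>carrier := V\<rparr>))\<rparr>"

text \<open>The integer $n$ in $z = t^n u$, where $t$ generates $P$ and $u$ is a unit of the
  valuation ring.  Only meaningful for $z \neq 0$; the value $\infty$ at $0$ is not represented.\<close>

definition place_val :: "('a, 'm) ring_scheme \<Rightarrow> 'a set \<Rightarrow> 'a set \<Rightarrow> 'a \<Rightarrow> int" where
  "place_val F K P z = (THE n::int.
     \<exists>t \<in> carrier (place_ring F K P). \<exists>u \<in> Units (place_ring F K P).
       P = PIdl\<^bsub>place_ring F K P\<^esub> t \<and> z = t [^]\<^bsub>F\<^esub> n \<otimes>\<^bsub>F\<^esub> u)"

definition residue_field :: "('a, 'm) ring_scheme \<Rightarrow> 'a set \<Rightarrow> 'a set \<Rightarrow> 'a set ring" where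
  "residue_field F K P = place_ring F K P Quot P"

definition residue :: "('a, 'm) ring_scheme \<Rightarrow> 'a set \<Rightarrow> 'a set \<Rightarrow> 'a \<Rightarrow> 'a set" where
  "residue F K P f = P +>\<^bsub>place_ring F K P\<^esub> f"

definition place_degree :: "('a, 'm) ring_scheme \<Rightarrow> 'a set \<Rightarrow> 'a set \<Rightarrow> nat" where
  "place_degree F K P =
     ring.dim (residue_field F K P) (residue F K P ` K) (carrier (residue_field F K P))"

definition rational_places :: "('a, 'm) ring_scheme \<Rightarrow> 'a set \<Rightarrow> 'a set set" where
  "rational_places F K = {P \<in> places F K. place_degree F K P = 1}"

text \<open>$f(P)$ at a rational place $P$: the residue class of $f$, viewed in $K$ through the
  isomorphism of $K$ onto the residue field.  Only meaningful if $f$ has no pole at $P$.\<close>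

definition value_at :: "('a, 'm) ring_scheme \<Rightarrow> 'a set \<Rightarrow> 'a \<Rightarrow> 'a set \<Rightarrow> 'a" where
  "value_at F K f P = (THE c. c \<in> K \<and> residue F K P c = residue F K P f)"

section \<open>Divisors, Riemann-Roch spaces and the genus\<close>

abbreviation divisors :: "('a, 'm) ring_scheme \<Rightarrow> 'a set \<Rightarrow> ('a set \<Rightarrow>\<^sub>0 int) set" where
  "divisors F K \<equiv> carrier (free_Abelian_group (places F K))"

definition divisor_degree ::
  "('a, 'm) ring_scheme \<Rightarrow> 'a set \<Rightarrow> ('a set \<Rightarrow>\<^sub>0 int) \<Rightarrow> int" where
  "divisor_degree F K A =
     (\<Sum>P \<in> Poly_Mapping.keys A. Poly_Mapping.lookup A P * int (place_degree F K P))"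

definition riemann_roch_space ::
  "('a, 'm) ring_scheme \<Rightarrow> 'a set \<Rightarrow> ('a set \<Rightarrow>\<^sub>0 int) \<Rightarrow> 'a set" where
  "riemann_roch_space F K A =
     {f \<in> carrier F. f = \<zero>\<^bsub>F\<^esub> \<or>
        (\<forall>P \<in> places F K. place_val F K P f \<ge> - Poly_Mapping.lookup A P)}"

definition genus :: "('a, 'm) ring_scheme \<Rightarrow> 'a set \<Rightarrow> int" where
  "genus F K = (GREATEST \<gamma>. \<exists>A \<in> divisors F K.
     \<gamma> = divisor_degree F K A - int (ring.dim F K (riemann_roch_space F K A)) + 1)"

section \<open>Codes\<close>

definition word_space :: "('a, 'm) ring_scheme \<Rightarrow> nat \<Rightarrow> ('a, 'a list) module" where
  "word_space R n =
     \<lparr>carrier = {w. length w = n \<and> set w \<subseteq> carrier R},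
      monoid.mult = map2 (monoid.mult R),
      one = replicate n \<one>\<^bsub>R\<^esub>,
      ring.zero = replicate n \<zero>\<^bsub>R\<^esub>,
      ring.add = map2 (ring.add R),
      smult = (\<lambda>a. map (monoid.mult R a))\<rparr>"

definition linear_code :: "('a, 'm) ring_scheme \<Rightarrow> nat \<Rightarrow> 'a list set \<Rightarrow> bool" where
  "linear_code R n C \<longleftrightarrow> subspace R C (word_space R n)"

definition code_dim :: "('a, 'm) ring_scheme \<Rightarrow> nat \<Rightarrow> 'a list set \<Rightarrow> nat" where
  "code_dim R n C = vectorspace.dim R (word_space R n\<lparr>carrier := C\<rparr>)"

definition hamming_dist :: "'a list \<Rightarrow> 'a list \<Rightarrow> nat" where
  "hamming_dist v w = card {i. i < length v \<and> v ! i \<noteq> w ! i}"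

definition min_dist :: "'a list set \<Rightarrow> nat" where
  "min_dist C = Min {hamming_dist v w | v w. v \<in> C \<and> w \<in> C \<and> v \<noteq> w}"

definition has_locality :: "nat \<Rightarrow> nat \<Rightarrow> 'a list set \<Rightarrow> bool" where
  "has_locality n r C \<longleftrightarrow>
     (\<forall>i < n. \<exists>N \<subseteq> {..<n} - {i}. card N \<le> r \<and>
        (\<forall>v \<in> C. \<forall>w \<in> C. (\<forall>j \<in> N. v ! j = w ! j) \<longrightarrow> v ! i = w ! i))"

definition parity_code :: "('a, 'm) ring_scheme \<Rightarrow> nat \<Rightarrow> 'a list set" where
  "parity_code R n =
     {c \<in> carrier (word_space R n). (\<Oplus>\<^bsub>R\<^esub>i \<in> {..<n}. c ! i) = \<zero>\<^bsub>R\<^esub>}"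

text \<open>$C(D,G)$ with $D = P_1 + \dots + P_s$.  The list of the $P_i$ takes the place of $D$,
  since it also fixes the order of the coordinates.\<close>

definition ag_code ::
  "('a, 'm) ring_scheme \<Rightarrow> 'a set \<Rightarrow> 'a set list \<Rightarrow> ('a set \<Rightarrow>\<^sub>0 int) \<Rightarrow> 'a list set" where
  "ag_code F K Ps G = (\<lambda>f. map (value_at F K f) Ps) ` riemann_roch_space F K G"

text \<open>The extension $K$ of a subfield $k$ of $F$, as a vector space over $k$.\<close>

definition extension_space :: "('a, 'm) ring_scheme \<Rightarrow> 'a set \<Rightarrow> ('a, 'a) module" where
  "extension_space F K =
     \<lparr>carrier = K,
      monoid.mult = monoid.mult F,
      one = \<one>\<^bsub>F\<^esub>,
      ring.zero = \<zero>\<^bsub>F\<^esub>,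
      ring.add = ring.add F,
      smult = monoid.mult F\<rparr>"

definition encoding ::
  "('a, 'm) ring_scheme \<Rightarrow> 'a set \<Rightarrow> 'a set \<Rightarrow> nat \<Rightarrow> 'a list set \<Rightarrow> ('a \<Rightarrow> 'a list) \<Rightarrow> bool" where
  "encoding F k K m C \<phi> \<longleftrightarrow>
     linear_map (F\<lparr>carrier := k\<rparr>) (extension_space F K)
       (word_space (F\<lparr>carrier := k\<rparr>) m\<lparr>carrier := C\<rparr>) \<phi> \<and>
     bij_betw \<phi> K C"

definition concatenated_code :: "('a \<Rightarrow> 'b list) \<Rightarrow> 'a list set \<Rightarrow> 'b list set" where
  "concatenated_code \<phi> C = (\<lambda>c. concat (map \<phi> c)) ` C"

end

theory Submission
  imports Defs
begin

text \<open>Since the constant field \<open>K\<close> has a finite number \<open>Q\<close> of elements, dimensions are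
  replaced by cardinalities and indices of subgroups.  Let \<open>F\<close> have degree \<open>n\<close> over \<open>K(x)\<close>.  The
  functions with a common denominator and coefficients of degree at most \<open>d\<close> in \<open>K[x]\<close> number
  \<open>Q ^ (n * (d + 1))\<close>; counting expansions in base \<open>y\<close> among them bounds the index of \<open>y O\<close> in any
  subring \<open>O\<close> containing \<open>y\<close>.  This makes valuation rings discrete with finite residue fields and,
  with weak approximation, bounds the degree of the zero divisor of \<open>y\<close>.  Riemann's theorem follows,
  and because linear equivalence preserves dimension, so does the vanishing of the degree of a
  principal divisor.

  The equality \<open>l(G) = deg G + 1 - g\<close> for \<open>deg G \<ge> 2 g - 1\<close> is obtained without
  differentials: if it fails, the adeles modulo \<open>A(G) + F\<close> form a nontrivial finite group, onto which
  every nonzero element of \<open>L(B)\<close> maps the adeles modulo \<open>A(G - B) + F\<close>, so the latter group has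
  at least as many elements as \<open>L(B)\<close>; for \<open>B\<close> of large degree this contradicts Riemann's theorem.

  A nonzero function in \<open>L(G)\<close> has at most \<open>deg G\<close> zeros among the \<open>P\<^sub>i\<close>, and each nonzero symbol
  of the outer code becomes a parity check word of weight at least two.\<close>

section \<open>Indices of subgroups\<close>

text \<open>All counts take place in additive groups, where indices multiply along chains;
  dimensions over \<open>K\<close> return at the end, since \<open>Q ^ d\<close> determines d. Exact
  values come from squeezing estimates with constant error: the index bound gives the pole divisor
  of \<open>x\<close> degree at most \<open>n\<close>, while the elements of \<open>M d\<close> give
  its d-fold multiple at least n (d + 1) - c dimensions, which forces equality as d grows. From this
  a polynomial in \<open>x\<close> has degree at most 0 as a divisor, which is all that Riemann's
  theorem needs. If a principal divisor had nonzero degree, the powers of the function or of its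
  inverse would give divisors equivalent to 0, so of dimension 1, with unbounded degree. One
  obstacle is the supply of places: the index bound holds for arbitrary subrings and produces none,
  so Zorn's lemma is needed to see that a nonconstant function has a pole. The range 2 g - 1 arises
  as follows. A failing \<open>G\<close> gives l(B) \<le> deg B + (g - 1) - deg G as soon as deg (G
  - B) < 0, whereas Riemann's theorem gives l(B) \<ge> deg B - (g - 1); hence deg G \<le> 2 (g -
  1).\<close>

lemma card_image_transfer:
  assumes eq: "\<And>x y. x \<in> A \<Longrightarrow> y \<in> A \<Longrightarrow> h x = h y \<longleftrightarrow> k (f x) = k (f y)"
    and into: "\<And>x. x \<in> A \<Longrightarrow> f x \<in> A'"
    and onto: "\<And>z. z \<in> A' \<Longrightarrow> \<exists>x\<in>A. k (f x) = k z"
  shows "card (h ` A) = card (k ` A')"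
proof -
  have "k ` A' = (k \<circ> f) ` A"
    using into onto by (force simp: image_iff)
  \<comment> \<open>The map induced on classes; \<open>inv_into\<close> picks a representative of
    each class, and by \<open>eq\<close> the choice does not matter. Later isomorphisms of quotients
    are read off from this lemma, infinite quotients included.\<close>
  moreover have "bij_betw (\<lambda>c. k (f (inv_into A h c))) (h ` A) ((k \<circ> f) ` A)"
    unfolding bij_betw_def
  proof
    show "inj_on (\<lambda>c. k (f (inv_into A h c))) (h ` A)"
      by (rule inj_onI) (metis eq f_inv_into_f inv_into_into)
    have "k (f (inv_into A h (h x))) = k (f x)" if "x \<in> A" for x
      using that eq[of "inv_into A h (h x)" x] by (simp add: f_inv_into_f inv_into_into)
    then show "(\<lambda>c. k (f (inv_into A h c))) ` h ` A = (k \<circ> f) ` A"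
      by (force simp: image_iff)
  qed
  ultimately show ?thesis
    by (metis bij_betw_same_card)
qed

text \<open>An infinite index is \<open>0\<close>, so that positivity expresses finiteness.\<close>

definition index_in :: "('g, 'm) monoid_scheme \<Rightarrow> 'g set \<Rightarrow> 'g set \<Rightarrow> nat" where
  "index_in G A B = card ((\<lambda>x. B #>\<^bsub>G\<^esub> x) ` A)"

lemma (in comm_group) r_coset_eq_iff:
  assumes "subgroup B G" "x \<in> carrier G" "y \<in> carrier G"
  shows "B #> x = B #> y \<longleftrightarrow> x \<otimes> inv y \<in> B"
  by (metis assms inv_closed inv_solve_right' coset_mult_inv1 coset_mult_inv2 coset_join1 coset_join2
      coset_mult_assoc m_closed r_inv subgroup.subset coset_mult_one rcos_self)

lemma (in comm_group) subgroup_set_mult: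
  assumes "subgroup A G" "subgroup B G"
  shows "subgroup (A <#> B) G"
  using assms by (simp add: mult_subgroups)

lemma (in comm_group) index_in_self:
  assumes "subgroup A G"
  shows "index_in G A A = 1"
proof -
  have "(\<lambda>x. A #> x) ` A = {A}"
    using assms by (auto simp: image_iff coset_join2 subgroup.mem_carrier intro: subgroup.one_closed)
  then show ?thesis by (simp add: index_in_def)
qed

lemma (in comm_group) index_in_eq_1D:
  assumes "subgroup A G" "subgroup B G" "index_in G A B = 1"
  shows "A \<subseteq> B"
proof
  fix x assume x: "x \<in> A"
  from assms(3) obtain c where c: "(\<lambda>x. B #> x) ` A = {c}"
    by (auto simp: index_in_def card_1_singleton_iff)
  have "B #> x = B #> \<one>"
    using c x subgroup.one_closed[OF assms(1)] by (metis image_eqI singletonD)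
  then show "x \<in> B"
    using assms(2) x subgroup.mem_carrier[OF assms(1)] r_coset_eq_iff[of B x \<one>] by simp
qed

text \<open>Through the trivial subgroup, cardinalities become indices, so that the tower law also
  compares the sizes of two spaces.\<close>

lemma (in comm_group) index_in_one:
  assumes "subgroup A G"
  shows "index_in G A {\<one>} = card A"
proof -
  have "inj_on (\<lambda>x. {\<one>} #> x) A"
    using subgroup.mem_carrier[OF assms] by (auto simp: inj_on_def r_coset_def)
  then show ?thesis by (simp add: index_in_def card_image)
qed

lemma (in comm_group) index_in_transversal:
  shows "\<exists>T. T \<subseteq> A \<and> card T = index_in G A B \<and> inj_on (\<lambda>x. B #> x) T \<and> (\<forall>x\<in>A. \<exists>t\<in>T. B #> x = B #> t)"
proof -
  obtain T where T: "T \<subseteq> A" "inj_on (\<lambda>x. B #> x) T" "(\<lambda>x. B #> x) ` A = (\<lambda>x. B #> x) ` T"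
    by (metis subset_image_inj subset_refl)
  have "card T = index_in G A B"
    unfolding index_in_def T(3) using card_image[OF T(2)] by simp
  moreover have "\<exists>t\<in>T. B #> x = B #> t" if "x \<in> A" for x
    using imageI[OF that, of "\<lambda>x. B #> x"] unfolding T(3) by (auto simp: image_iff)
  ultimately show ?thesis using T(1,2) by (intro exI[of _ T]) simp
qed

text \<open>Products of representatives represent the cosets of \<open>C\<close>. Since
  \<open>card\<close> is multiplicative on cartesian products without exception, the law covers
  infinite indices, counted as 0; a positive product therefore shows that both factors are
  finite.\<close>

lemma (in comm_group) index_in_tower:
  assumes A: "subgroup A G" and B: "subgroup B G" and C: "subgroup C G" and sub: "C \<subseteq> B" "B \<subseteq> A"
  shows "index_in G A C = index_in G A B * index_in G B C"
proof -
  obtain T where T: "T \<subseteq> A" "card T = index_in G A B" "inj_on (\<lambda>x. B #> x) T"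
    "\<forall>x\<in>A. \<exists>t\<in>T. B #> x = B #> t" using index_in_transversal[of A B] by blast
  obtain S where S: "S \<subseteq> B" "card S = index_in G B C" "inj_on (\<lambda>x. C #> x) S"
    "\<forall>x\<in>B. \<exists>t\<in>S. C #> x = C #> t" using index_in_transversal[of B C] by blast
  have car: "x \<in> carrier G" if "x \<in> A" for x using subgroup.mem_carrier[OF A that] .
  have Tc: "x \<in> carrier G" if "x \<in> T" for x using that T car by blast
  have Sc: "x \<in> carrier G" if "x \<in> S" for x using that S sub car by blast
  have "card ((\<lambda>p. p) ` (T \<times> S)) = card ((\<lambda>x. C #> x) ` A)"
  proof (rule card_image_transfer[where f = "\<lambda>(t, s). s \<otimes> t"])
    fix p p' assume "p \<in> T \<times> S" "p' \<in> T \<times> S"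
    then obtain t s t' s' where p: "p = (t, s)" "p' = (t', s')" "t \<in> T" "s \<in> S" "t' \<in> T" "s' \<in> S" by auto
    note c = Tc[OF p(3)] Tc[OF p(5)] Sc[OF p(4)] Sc[OF p(6)]
    have "p = p'" if eq: "C #> (s \<otimes> t) = C #> (s' \<otimes> t')"
    proof -
      have "(s \<otimes> t) \<otimes> inv (s' \<otimes> t') \<in> B"
        using eq r_coset_eq_iff[OF C] c sub by blast
      then have "B #> (s \<otimes> t) = B #> (s' \<otimes> t')"
        using r_coset_eq_iff[OF B] c by blast
      moreover have "B #> (s \<otimes> t) = B #> t" "B #> (s' \<otimes> t') = B #> t'"
        using coset_mult_assoc[OF subgroup.subset[OF B]] coset_join2[OF _ B] c p S(1) by (metis subsetD)+
      ultimately have t: "t = t'" using T(3) p by (metis inj_onD)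
      have "(C #> s) #> t #> inv t = (C #> s') #> t #> inv t"
        using eq t coset_mult_assoc[OF subgroup.subset[OF C]] c by metis
      then have "C #> s = C #> s'"
        using c coset_mult_assoc[OF r_coset_subset_G[OF subgroup.subset[OF C]]]
          coset_mult_one[OF r_coset_subset_G[OF subgroup.subset[OF C]]] by simp
      then show ?thesis using t S(3) p by (metis inj_onD)
    qed
    then show "p = p' \<longleftrightarrow> C #> (case p of (t, s) \<Rightarrow> s \<otimes> t) = C #> (case p' of (t, s) \<Rightarrow> s \<otimes> t)"
      using p by auto
  next
    fix p assume "p \<in> T \<times> S"
    then show "(case p of (t, s) \<Rightarrow> s \<otimes> t) \<in> A"
      using T S sub by (auto intro!: subgroup.m_closed[OF A])
  next
    fix z assume z: "z \<in> A"
    then obtain t where t: "t \<in> T" "B #> z = B #> t" using T by blast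
    then have "z \<otimes> inv t \<in> B" using r_coset_eq_iff[OF B] z car Tc by simp
    then obtain s where s: "s \<in> S" "C #> (z \<otimes> inv t) = C #> s" using S by blast
    then have "z \<otimes> inv t \<otimes> inv s \<in> C" using r_coset_eq_iff[OF C] z t car Tc Sc by simp
    moreover have "z \<otimes> inv (s \<otimes> t) = z \<otimes> inv t \<otimes> inv s"
      using z t s car Tc Sc by (simp add: inv_mult_group m_assoc)
    ultimately have "C #> z = C #> (s \<otimes> t)" using r_coset_eq_iff[OF C] z t s car Tc Sc by simp
    then show "\<exists>p\<in>T \<times> S. C #> (case p of (t, s) \<Rightarrow> s \<otimes> t) = C #> z" using t s by force
  qed
  then have "index_in G A C = card (T \<times> S)" by (simp add: index_in_def)
  then show ?thesis using T(2) S(2) by (simp add: card_cartesian_product)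
qed

text \<open>A product of a in \<open>A\<close> and b in \<open>B\<close> has the same coset as a, so
  \<open>A\<close> already represents all cosets: the second isomorphism theorem in terms of
  indices.\<close>

lemma (in comm_group) index_in_set_mult:
  assumes A: "subgroup A G" and B: "subgroup B G"
  shows "index_in G (A <#> B) B = index_in G A (A \<inter> B)"
proof -
  have AB: "subgroup (A \<inter> B) G" using subgroups_Inter_pair A B by blast
  have Ac: "x \<in> carrier G" if "x \<in> A" for x using subgroup.mem_carrier[OF A that] .
  have Bc: "x \<in> carrier G" if "x \<in> B" for x using subgroup.mem_carrier[OF B that] .
  have "card ((\<lambda>x. (A \<inter> B) #> x) ` A) = card ((\<lambda>x. B #> x) ` (A <#> B))"
  proof (rule card_image_transfer[where f = "\<lambda>x. x"])
    fix x y assume "x \<in> A" "y \<in> A"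
    moreover from this have "x \<otimes> inv y \<in> A"
      using A by (meson subgroup.m_closed subgroup.m_inv_closed)
    ultimately show "(A \<inter> B) #> x = (A \<inter> B) #> y \<longleftrightarrow> B #> x = B #> y"
      using Ac by (simp add: r_coset_eq_iff[OF AB] r_coset_eq_iff[OF B])
  next
    fix x assume "x \<in> A"
    then have "x = x \<otimes> \<one>" "\<one> \<in> B" using Ac B subgroup.one_closed by auto
    then show "x \<in> A <#> B" using \<open>x \<in> A\<close> unfolding set_mult_def by blast
  next
    fix z assume "z \<in> A <#> B"
    then obtain a b where ab: "a \<in> A" "b \<in> B" "z = a \<otimes> b" unfolding set_mult_def by blast
    then have "z \<otimes> inv a = b" using Ac Bc by (simp add: m_comm[of a b] m_assoc)
    then have "B #> z = B #> a" using ab r_coset_eq_iff[OF B] Ac Bc by simp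
    then show "\<exists>x\<in>A. B #> x = B #> z" using ab by force
  qed
  then show ?thesis by (simp add: index_in_def)
qed

text \<open>Insert the product of \<open>A \<inter> N\<close> and \<open>B\<close> between
  \<open>A\<close> and \<open>B\<close>, and apply the second isomorphism theorem to both steps.
  With \<open>N\<close> the diagonal copy of F this plays the role of the exact sequence behind
  Riemann-Roch.\<close>

lemma (in comm_group) index_in_modular:
  assumes A: "subgroup A G" and B: "subgroup B G" and N: "subgroup N G" and "B \<subseteq> A"
  shows "index_in G A B = index_in G (A <#> N) (B <#> N) * index_in G (A \<inter> N) (B \<inter> N)"
proof -
  have Ac: "x \<in> carrier G" if "x \<in> A" for x using subgroup.mem_carrier[OF A that] .
  have Bc: "x \<in> carrier G" if "x \<in> B" for x using subgroup.mem_carrier[OF B that] .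
  have Nc: "x \<in> carrier G" if "x \<in> N" for x using subgroup.mem_carrier[OF N that] .
  have AN: "subgroup (A \<inter> N) G" using subgroups_Inter_pair A N by blast
  have BN: "subgroup (B <#> N) G" using subgroup_set_mult B N by blast
  \<comment> \<open>Dedekind's modular law, which rests on \<open>B \<subseteq> A\<close>.\<close>
  have mod: "A \<inter> (B <#> N) = (A \<inter> N) <#> B"
  proof
    show "(A \<inter> N) <#> B \<subseteq> A \<inter> (B <#> N)"
    proof
      fix z assume "z \<in> (A \<inter> N) <#> B"
      then obtain n b where *: "n \<in> A" "n \<in> N" "b \<in> B" "z = n \<otimes> b" unfolding set_mult_def by blast
      then have "z \<in> A" using assms(4) A by (meson subgroup.m_closed subsetD)
      moreover have "z = b \<otimes> n" using * Bc Nc by (simp add: m_comm)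
      ultimately show "z \<in> A \<inter> (B <#> N)" using * unfolding set_mult_def by blast
    qed
    show "A \<inter> (B <#> N) \<subseteq> (A \<inter> N) <#> B"
    proof
      fix z assume "z \<in> A \<inter> (B <#> N)"
      then obtain n b where *: "z \<in> A" "n \<in> N" "b \<in> B" "z = b \<otimes> n" unfolding set_mult_def by blast
      have "inv b \<otimes> z \<in> A" using * assms(4) A by (meson subgroup.m_closed subgroup.m_inv_closed subsetD)
      moreover have "inv b \<otimes> z = n" using * Bc Nc by (simp add: m_assoc[symmetric])
      moreover have "z = n \<otimes> b" using * Bc Nc by (simp add: m_comm)
      ultimately show "z \<in> (A \<inter> N) <#> B" using * unfolding set_mult_def by blast
    qed
  qed
  have sub: "B \<subseteq> (A \<inter> N) <#> B"
  proof
    fix b assume "b \<in> B"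
    moreover have "b = \<one> \<otimes> b" "\<one> \<in> A \<inter> N" using calculation Bc AN subgroup.one_closed by auto
    ultimately show "b \<in> (A \<inter> N) <#> B" unfolding set_mult_def by blast
  qed
  have "index_in G A B = index_in G A ((A \<inter> N) <#> B) * index_in G ((A \<inter> N) <#> B) B"
    using index_in_tower[OF A subgroup_set_mult[OF AN B] B sub] mod by blast
  also have "index_in G ((A \<inter> N) <#> B) B = index_in G (A \<inter> N) (B \<inter> N)"
  proof -
    have "A \<inter> N \<inter> B = B \<inter> N" using assms(4) by blast
    then show ?thesis using index_in_set_mult[OF AN B] by simp
  qed
  also have "index_in G A ((A \<inter> N) <#> B) = index_in G (A <#> (B <#> N)) (B <#> N)"
    using index_in_set_mult[OF A BN] mod by simp
  also have "A <#> (B <#> N) = A <#> N"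
  proof -
    have "A <#> (B <#> N) = (A <#> B) <#> N"
      using set_mult_assoc A B N by (simp add: subgroup.subset)
    also have "A <#> B = A"
    proof
      show "A <#> B \<subseteq> A"
        using assms(4) subgroup.m_closed[OF A] by (force simp: set_mult_def)
      have "x = x \<otimes> \<one>" if "x \<in> A" for x using that Ac by simp
      then show "A \<subseteq> A <#> B"
        using subgroup.one_closed[OF B] unfolding set_mult_def by blast
    qed
    finally show ?thesis .
  qed
  finally show ?thesis .
qed

section \<open>Growth over the rational function field\<close>

text \<open>Passing to large powers removes the constant: if a > b, the powers of a / b would exceed
  \<open>C\<close>.\<close>

lemma power_le_imp_le_base_asymptotic:
  fixes a b C :: nat
  assumes "\<And>l. a ^ l \<le> C * b ^ l" "b > 0"
  shows "a \<le> b"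
proof (rule ccontr)
  assume "\<not> a \<le> b"
  then have *: "1 < real a / real b" using assms(2) by simp
  then obtain l where "real C < (real a / real b) ^ l"
    using real_arch_pow by blast
  then have "real (C * b ^ l) < real (a ^ l)"
    using assms(2) by (simp add: power_divide pos_less_divide_eq)
  then show False using assms(1)[of l] by linarith
qed

locale finite_constants = field F for F (structure) +
  fixes K :: "'a set"
  assumes subfield_K: "subfield K F" and finite_K: "finite K"
begin

lemma K_closed [simp]: "a \<in> K \<Longrightarrow> a \<in> carrier F"
  using subfieldE(3)[OF subfield_K] by blast

lemma K_subset [simp]: "K \<subseteq> carrier F"
  using subfieldE(3)[OF subfield_K] .

lemma K_zero [simp]: "\<zero> \<in> K" and K_one [simp]: "\<one> \<in> K"
  and K_add [simp]: "a \<in> K \<Longrightarrow> b \<in> K \<Longrightarrow> a \<oplus> b \<in> K"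
  and K_mult [simp]: "a \<in> K \<Longrightarrow> b \<in> K \<Longrightarrow> a \<otimes> b \<in> K"
  and K_uminus [simp]: "a \<in> K \<Longrightarrow> \<ominus> a \<in> K"
  using subringE[OF subfieldE(1)[OF subfield_K]] by auto

lemma K_inv [simp]: "a \<in> K \<Longrightarrow> a \<noteq> \<zero> \<Longrightarrow> inv a \<in> K"
  using subfield_m_inv[OF subfield_K] by blast

abbreviation Q :: nat where "Q \<equiv> card K"

lemma Q_ge_2: "Q \<ge> 2"
proof -
  have "card {\<zero>, \<one>} \<le> Q" using finite_K by (intro card_mono) auto
  then show ?thesis by (simp add: card_insert_if)
qed

lemma inv_in_carrier [simp]: "a \<in> carrier F \<Longrightarrow> a \<noteq> \<zero> \<Longrightarrow> inv a \<in> carrier F"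
  using field_Units by auto

lemma field_r_inv [simp]: "a \<in> carrier F \<Longrightarrow> a \<noteq> \<zero> \<Longrightarrow> a \<otimes> inv a = \<one>"
  and field_l_inv [simp]: "a \<in> carrier F \<Longrightarrow> a \<noteq> \<zero> \<Longrightarrow> inv a \<otimes> a = \<one>"
  using field_Units by auto

lemma inv_nonzero [simp]:
  assumes "a \<in> carrier F" "a \<noteq> \<zero>"
  shows "inv a \<noteq> \<zero>"
proof
  assume "inv a = \<zero>"
  then show False using field_r_inv[OF assms] assms by simp
qed

end

text \<open>\<open>x\<close> and \<open>Us\<close> are auxiliary choices: the places, the divisors
  and the genus of F do not refer to them. The length of \<open>Us\<close> is the degree of F over
  K(x).\<close>

locale finite_function_field = finite_constants F K for F (structure) and K +
  fixes x :: 'a and Us :: "'a list"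
  assumes x_closed [simp]: "x \<in> carrier F"
    and x_transcendental: "transcendental K x"
    and Us_independent: "independent (generate_field F (insert x K)) Us"
    and Us_span: "Span (generate_field F (insert x K)) Us = carrier F"
begin

abbreviation Kx :: "'a set" where "Kx \<equiv> generate_field F (insert x K)"

text \<open>Polynomials in Horner form, taken directly as elements of F: evaluation is built in, and
  membership only records that some polynomial of degree at most \<open>d\<close> has this value at
  \<open>x\<close>.\<close>

primrec polys :: "nat \<Rightarrow> 'a set" where
  "polys 0 = K"
| "polys (Suc d) = (\<lambda>(a, b). a \<oplus> x \<otimes> b) ` (K \<times> polys d)"

text \<open>One degree bound serves all coefficients, so that for independent vectors the size is a
  power of \<open>Q\<close> whose exponent grows linearly in \<open>d\<close>.\<close>

primrec mods :: "nat \<Rightarrow> 'a list \<Rightarrow> 'a set" where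
  "mods d [] = {\<zero>}"
| "mods d (u # us) = (\<lambda>(a, m). a \<otimes> u \<oplus> m) ` (polys d \<times> mods d us)"

declare polys.simps(2) [simp del] and mods.simps(2) [simp del]

lemma polys_SucI: "a \<in> K \<Longrightarrow> b \<in> polys d \<Longrightarrow> a \<oplus> x \<otimes> b \<in> polys (Suc d)"
  by (force simp: polys.simps(2))

lemma polys_SucE:
  assumes "p \<in> polys (Suc d)"
  obtains a b where "a \<in> K" "b \<in> polys d" "p = a \<oplus> x \<otimes> b"
  using assms by (force simp: polys.simps(2))

lemma polys_closed: "p \<in> polys d \<Longrightarrow> p \<in> carrier F"
  by (induction d arbitrary: p) (auto elim!: polys_SucE)

lemma polys_zero: "\<zero> \<in> polys d"
proof (induction d)
  case (Suc d)
  then have "\<zero> \<oplus> x \<otimes> \<zero> \<in> polys (Suc d)" by (intro polys_SucI) auto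
  then show ?case by simp
qed simp

lemma polys_Suc: "p \<in> polys d \<Longrightarrow> p \<in> polys (Suc d)"
proof (induction d arbitrary: p)
  case 0
  then have "p \<oplus> x \<otimes> \<zero> \<in> polys (Suc 0)" by (intro polys_SucI) auto
  then show ?case using 0 by simp
next
  case (Suc d)
  then obtain a b where "a \<in> K" "b \<in> polys d" "p = a \<oplus> x \<otimes> b" by (elim polys_SucE)
  then show ?case using Suc.IH polys_SucI by blast
qed

lemma polys_mono: "p \<in> polys d \<Longrightarrow> d \<le> e \<Longrightarrow> p \<in> polys e"
  by (induction e) (auto simp: le_Suc_eq intro: polys_Suc)

lemma polys_const: "a \<in> K \<Longrightarrow> a \<in> polys d"
  using polys_mono[of a 0 d] by simp

lemma polys_x: "x \<in> polys (Suc d)"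
proof -
  have "\<zero> \<oplus> x \<otimes> \<one> \<in> polys (Suc d)" by (intro polys_SucI) (auto intro: polys_const)
  then show ?thesis by simp
qed

lemma polys_add: "p \<in> polys d \<Longrightarrow> p' \<in> polys d \<Longrightarrow> p \<oplus> p' \<in> polys d"
proof (induction d arbitrary: p p')
  case (Suc d)
  obtain a b where p: "a \<in> K" "b \<in> polys d" "p = a \<oplus> x \<otimes> b" using Suc.prems(1) by (rule polys_SucE)
  obtain a' b' where p': "a' \<in> K" "b' \<in> polys d" "p' = a' \<oplus> x \<otimes> b'" using Suc.prems(2) by (rule polys_SucE)
  have "p \<oplus> p' = (a \<oplus> a') \<oplus> x \<otimes> (b \<oplus> b')"
    using p p' polys_closed[OF p(2)] polys_closed[OF p'(2)] K_closed[OF p(1)] K_closed[OF p'(1)]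
      x_closed by algebra
  moreover have "(a \<oplus> a') \<oplus> x \<otimes> (b \<oplus> b') \<in> polys (Suc d)"
    using p p' Suc.IH by (intro polys_SucI) auto
  ultimately show ?case by simp
qed simp

lemma polys_smult: "c \<in> K \<Longrightarrow> p \<in> polys d \<Longrightarrow> c \<otimes> p \<in> polys d"
proof (induction d arbitrary: p)
  case (Suc d)
  obtain a b where p: "a \<in> K" "b \<in> polys d" "p = a \<oplus> x \<otimes> b" using Suc.prems(2) by (rule polys_SucE)
  have "c \<otimes> p = (c \<otimes> a) \<oplus> x \<otimes> (c \<otimes> b)"
    using p polys_closed[OF p(2)] K_closed[OF p(1)] K_closed[OF Suc.prems(1)] x_closed by algebra
  moreover have "(c \<otimes> a) \<oplus> x \<otimes> (c \<otimes> b) \<in> polys (Suc d)"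
    using p Suc by (intro polys_SucI) auto
  ultimately show ?case by simp
qed simp

lemma polys_uminus: "p \<in> polys d \<Longrightarrow> \<ominus> p \<in> polys d"
  using polys_smult[of "\<ominus> \<one>" p d] by (simp add: polys_closed l_minus)

lemma polys_mult_x: "p \<in> polys d \<Longrightarrow> x \<otimes> p \<in> polys (Suc d)"
  using polys_SucI[of \<zero> p d] by (simp add: polys_closed)

lemma polys_mult: "p \<in> polys d \<Longrightarrow> p' \<in> polys e \<Longrightarrow> p \<otimes> p' \<in> polys (d + e)"
proof (induction d arbitrary: p)
  case 0
  then show ?case by (simp add: polys_smult)
next
  case (Suc d)
  obtain a b where p: "a \<in> K" "b \<in> polys d" "p = a \<oplus> x \<otimes> b" using Suc.prems(1) by (rule polys_SucE)
  have "p \<otimes> p' = a \<otimes> p' \<oplus> x \<otimes> (b \<otimes> p')"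
    using p polys_closed[OF p(2)] K_closed[OF p(1)] polys_closed[OF Suc.prems(2)] x_closed by algebra
  moreover have "a \<otimes> p' \<in> polys (Suc d + e)"
    using p Suc.prems(2) polys_smult polys_mono[of "a \<otimes> p'" e "Suc d + e"] by simp
  moreover have "x \<otimes> (b \<otimes> p') \<in> polys (Suc d + e)"
    using p Suc polys_mult_x[of "b \<otimes> p'" "d + e"] by simp
  ultimately show ?case using polys_add[of _ "Suc d + e"] by simp
qed

lemma polys_eval:
  assumes "p \<in> polys d"
  obtains l where "l \<in> carrier (K[X])" "eval l x = p"
  using assms
proof (induction d arbitrary: p thesis)
  case 0
  show ?case
  proof (rule 0(1))
    show "(if p = \<zero> then [] else [p]) \<in> carrier (K[X])"
      using 0(2) by (auto simp: univ_poly_def polynomial_def)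
    show "eval (if p = \<zero> then [] else [p]) x = p" using 0(2) by simp
  qed
next
  case (Suc d)
  from Suc.prems(2) obtain a b where p: "a \<in> K" "b \<in> polys d" "p = a \<oplus> x \<otimes> b" by (rule polys_SucE)
  obtain l where l: "l \<in> carrier (K[X])" "eval l x = b" using Suc.IH p by blast
  have lK: "set l \<subseteq> K" using l by (auto simp: univ_poly_def polynomial_def)
  have lc: "set l \<subseteq> carrier F" using lK by auto
  show ?case
  proof (cases "l = []")
    case True
    then have "b = \<zero>" using l by simp
    then have "p = a" using p by simp
    show ?thesis
    proof (rule Suc.prems(1))
      show "(if p = \<zero> then [] else [p]) \<in> carrier (K[X])"
        using p \<open>p = a\<close> by (auto simp: univ_poly_def polynomial_def)
      show "eval (if p = \<zero> then [] else [p]) x = p" using p \<open>p = a\<close> by simp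
    qed
  next
    case False
    show ?thesis
    proof (rule Suc.prems(1))
      show "l @ [a] \<in> carrier (K[X])"
        using p lK l False by (auto simp: univ_poly_def polynomial_def)
      show "eval (l @ [a]) x = p"
        using p lc l eval_append_aux[of l a x] polys_closed[OF p(2)] by (simp add: m_comm a_comm)
    qed
  qed
qed

text \<open>Transcendence of \<open>x\<close> as uniqueness of the Horner form; it makes the count
  in \<open>card_polys\<close> exact.\<close>

lemma polys_Suc_eq_zeroD:
  assumes "a \<in> K" "b \<in> polys d" "a \<oplus> x \<otimes> b = \<zero>"
  shows "a = \<zero>" "b = \<zero>"
proof -
  obtain l where l: "l \<in> carrier (K[X])" "eval l x = b" using assms(2) by (rule polys_eval)
  have lK: "set l \<subseteq> K" using l by (auto simp: univ_poly_def polynomial_def)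
  have lc: "set l \<subseteq> carrier F" using lK by auto
  show "b = \<zero>"
  proof (cases "l = []")
    case True
    then show ?thesis using l by simp
  next
    case False
    \<comment> \<open>Coefficient lists start with the leading coefficient, so appending
      \<open>a\<close> multiplies by the variable and adds a constant term; as \<open>l\<close> is
      nonempty, the list stays normalized.\<close>
    have "l @ [a] \<in> carrier (K[X])"
      using assms lK l False by (auto simp: univ_poly_def polynomial_def)
    moreover have "eval (l @ [a]) x = \<zero>"
      using assms lc l eval_append_aux[of l a x] polys_closed[OF assms(2)] by (simp add: m_comm a_comm)
    ultimately have "l @ [a] = []" using eval_transcendental x_transcendental by (auto simp: over_def)
    then show ?thesis by simp
  qed
  then show "a = \<zero>" using assms by simp
qed

lemma finite_polys: "finite (polys d)"
  using finite_K by (induction d) (auto simp: polys.simps(2))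

lemma card_polys: "card (polys d) = Q ^ Suc d"
proof (induction d)
  case (Suc d)
  have "inj_on (\<lambda>(a, b). a \<oplus> x \<otimes> b) (K \<times> polys d)"
  proof (rule inj_onI, clarify)
    fix a b a' b' assume *: "a \<in> K" "b \<in> polys d" "a' \<in> K" "b' \<in> polys d" "a \<oplus> x \<otimes> b = a' \<oplus> x \<otimes> b'"
    note c = K_closed[OF *(1)] polys_closed[OF *(2)] K_closed[OF *(3)] polys_closed[OF *(4)] x_closed
    have "(a \<ominus> a') \<oplus> x \<otimes> (b \<ominus> b') = (a \<oplus> x \<otimes> b) \<ominus> (a' \<oplus> x \<otimes> b')"
      using c by algebra
    also have "\<dots> = \<zero>" using *(5) c by simp
    finally have z: "(a \<ominus> a') \<oplus> x \<otimes> (b \<ominus> b') = \<zero>" .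
    have "a \<ominus> a' \<in> K" "b \<ominus> b' \<in> polys d" using * polys_add polys_uminus by (simp_all add: a_minus_def)
    from polys_Suc_eq_zeroD[OF this z] show "a = a' \<and> b = b'" using c by simp
  qed
  then show ?case using Suc by (simp add: card_image card_cartesian_product polys.simps(2))
qed simp

lemma Kx_closed: "z \<in> Kx \<Longrightarrow> z \<in> carrier F"
  using generate_field_in_carrier[of "insert x K" z] by simp

lemma polys_in_Kx: "p \<in> polys d \<Longrightarrow> p \<in> Kx"
proof (induction d arbitrary: p)
  case (Suc d)
  then obtain a b where p: "a \<in> K" "b \<in> polys d" "p = a \<oplus> x \<otimes> b" by (elim polys_SucE)
  moreover have "a \<in> Kx" "x \<in> Kx" using p by (auto intro: generate_field.incl)
  ultimately show ?case using Suc.IH by (auto intro!: generate_field.eng_add generate_field.eng_mult)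
qed (auto intro: generate_field.incl)

text \<open>The quotient is kept as an equation \<open>z \<otimes> b = a\<close>, so that in the
  induction over the generation of K(x) inverses occur only where the generated element is
  one.\<close>

lemma Kx_fraction:
  assumes "z \<in> Kx"
  obtains a b d where "a \<in> polys d" "b \<in> polys d" "b \<noteq> \<zero>" "z \<otimes> b = a"
  using assms
proof (induction z arbitrary: thesis rule: generate_field.induct)
  case one
  show ?case by (rule one[of \<one> 0 \<one>]) auto
next
  case (incl h)
  show ?case
  proof (cases "h = x")
    case True
    then show ?thesis using polys_x[of 0] polys_const[of \<one> 1] by (intro incl(2)[of h 1 \<one>]) auto
  next
    case False
    then show ?thesis using incl by (intro incl(2)[of h 1 \<one>]) (auto intro: polys_const)
  qed
next
  case (a_inv h)
  have h: "h \<in> carrier F" using a_inv(1) Kx_closed by blast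
  obtain a b d where *: "a \<in> polys d" "b \<in> polys d" "b \<noteq> \<zero>" "h \<otimes> b = a" using a_inv.IH by blast
  then show ?case using h polys_closed by (intro a_inv(3)[of "\<ominus> a" d b]) (auto intro: polys_uminus simp: l_minus)
next
  case (m_inv h)
  have h: "h \<in> carrier F" using m_inv(1) Kx_closed by blast
  obtain a b d where *: "a \<in> polys d" "b \<in> polys d" "b \<noteq> \<zero>" "h \<otimes> b = a" using m_inv.IH by blast
  have bc: "b \<in> carrier F" using * polys_closed by blast
  have "inv h \<otimes> a = b" using * h m_inv(2) bc by (metis inv_in_carrier field_l_inv l_one m_assoc)
  moreover have "a \<noteq> \<zero>" using * h bc m_inv(2) integral by blast
  ultimately show ?case using * by (intro m_inv(4)[of b d a])
next
  case (eng_add h1 h2)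
  have h: "h1 \<in> carrier F" "h2 \<in> carrier F"
    using eng_add(1,2) Kx_closed by blast+
  obtain a b d where 1: "a \<in> polys d" "b \<in> polys d" "b \<noteq> \<zero>" "h1 \<otimes> b = a" using eng_add.IH by blast
  obtain a' b' d' where 2: "a' \<in> polys d'" "b' \<in> polys d'" "b' \<noteq> \<zero>" "h2 \<otimes> b' = a'" using eng_add.IH by blast
  have c: "b \<in> carrier F" "b' \<in> carrier F" using 1 2 polys_closed by auto
  have "(h1 \<oplus> h2) \<otimes> (b \<otimes> b') = (h1 \<otimes> b) \<otimes> b' \<oplus> (h2 \<otimes> b') \<otimes> b"
    using c h by algebra
  moreover have "(h1 \<otimes> b) \<otimes> b' \<oplus> (h2 \<otimes> b') \<otimes> b \<in> polys (d + d')"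
    using 1 2 polys_mult[of a d b' d'] polys_mult[of a' d' b d] by (simp add: polys_add add.commute)
  moreover have "b \<otimes> b' \<noteq> \<zero>" using c 1 2 integral by blast
  moreover have "b \<otimes> b' \<in> polys (d + d')" using 1 2 polys_mult by simp
  ultimately show ?case using eng_add(5) by metis
next
  case (eng_mult h1 h2)
  have h: "h1 \<in> carrier F" "h2 \<in> carrier F"
    using eng_mult(1,2) Kx_closed by blast+
  obtain a b d where 1: "a \<in> polys d" "b \<in> polys d" "b \<noteq> \<zero>" "h1 \<otimes> b = a" using eng_mult.IH by blast
  obtain a' b' d' where 2: "a' \<in> polys d'" "b' \<in> polys d'" "b' \<noteq> \<zero>" "h2 \<otimes> b' = a'" using eng_mult.IH by blast
  have c: "b \<in> carrier F" "b' \<in> carrier F" using 1 2 polys_closed by auto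
  have "(h1 \<otimes> h2) \<otimes> (b \<otimes> b') = (h1 \<otimes> b) \<otimes> (h2 \<otimes> b')"
    using c h by algebra
  moreover have "(h1 \<otimes> b) \<otimes> (h2 \<otimes> b') \<in> polys (d + d')"
    using 1 2 polys_mult by simp
  moreover have "b \<otimes> b' \<noteq> \<zero>" using c 1 2 integral by blast
  moreover have "b \<otimes> b' \<in> polys (d + d')" using 1 2 polys_mult by simp
  ultimately show ?case using eng_mult(5) by metis
qed

lemma Us_closed: "set Us \<subseteq> carrier F"
  using Us_independent independent_in_carrier by blast

lemma mods_ConsI: "a \<in> polys d \<Longrightarrow> m \<in> mods d us \<Longrightarrow> a \<otimes> u \<oplus> m \<in> mods d (u # us)"
  by (force simp: mods.simps(2))

lemma mods_ConsE:
  assumes "m \<in> mods d (u # us)"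
  obtains a m' where "a \<in> polys d" "m' \<in> mods d us" "m = a \<otimes> u \<oplus> m'"
  using assms by (force simp: mods.simps(2))

lemma mods_closed: "set us \<subseteq> carrier F \<Longrightarrow> m \<in> mods d us \<Longrightarrow> m \<in> carrier F"
  by (induction us arbitrary: m) (auto simp: polys_closed elim!: mods_ConsE)

lemma mods_zero: "set us \<subseteq> carrier F \<Longrightarrow> \<zero> \<in> mods d us"
proof (induction us)
  case (Cons u us)
  then have "\<zero> \<otimes> u \<oplus> \<zero> \<in> mods d (u # us)" by (intro mods_ConsI) (auto intro: polys_zero)
  then show ?case using Cons by simp
qed simp

lemma mods_mono: "m \<in> mods d us \<Longrightarrow> d \<le> e \<Longrightarrow> m \<in> mods e us"
proof (induction us arbitrary: m)
  case (Cons u us)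
  then obtain a m' where "a \<in> polys d" "m' \<in> mods d us" "m = a \<otimes> u \<oplus> m'" by (elim mods_ConsE)
  then show ?case using Cons polys_mono mods_ConsI by blast
qed simp

lemma mods_add:
  "set us \<subseteq> carrier F \<Longrightarrow> m \<in> mods d us \<Longrightarrow> m' \<in> mods d us \<Longrightarrow> m \<oplus> m' \<in> mods d us"
proof (induction us arbitrary: m m')
  case (Cons u us)
  obtain a n where m: "a \<in> polys d" "n \<in> mods d us" "m = a \<otimes> u \<oplus> n" using Cons.prems(2) by (rule mods_ConsE)
  obtain a' n' where m': "a' \<in> polys d" "n' \<in> mods d us" "m' = a' \<otimes> u \<oplus> n'" using Cons.prems(3) by (rule mods_ConsE)
  have "m \<oplus> m' = (a \<oplus> a') \<otimes> u \<oplus> (n \<oplus> n')"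
    using m m' polys_closed[OF m(1)] polys_closed[OF m'(1)] mods_closed[OF _ m(2)] mods_closed[OF _ m'(2)] Cons.prems(1)
    by (simp add: l_distr a_ac)
  moreover have "(a \<oplus> a') \<otimes> u \<oplus> (n \<oplus> n') \<in> mods d (u # us)"
    using m m' Cons polys_add by (intro mods_ConsI) auto
  ultimately show ?case by simp
qed simp

lemma mods_smult:
  "set us \<subseteq> carrier F \<Longrightarrow> c \<in> polys e \<Longrightarrow> m \<in> mods d us \<Longrightarrow> c \<otimes> m \<in> mods (e + d) us"
proof (induction us arbitrary: m)
  case (Cons u us)
  obtain a n where m: "a \<in> polys d" "n \<in> mods d us" "m = a \<otimes> u \<oplus> n" using Cons.prems(3) by (rule mods_ConsE)
  have "c \<otimes> m = (c \<otimes> a) \<otimes> u \<oplus> c \<otimes> n"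
    using m polys_closed[OF m(1)] polys_closed[OF Cons.prems(2)] mods_closed[OF _ m(2)] Cons.prems(1)
    by (simp add: r_distr m_assoc)
  moreover have "(c \<otimes> a) \<otimes> u \<oplus> c \<otimes> n \<in> mods (e + d) (u # us)"
    using m Cons polys_mult by (intro mods_ConsI) auto
  ultimately show ?case by simp
qed (simp add: polys_closed)

lemma finite_mods: "finite (mods d us)"
  by (induction us) (auto simp: finite_polys mods.simps(2))

lemma mods_in_Span:
  assumes "set us \<subseteq> carrier F" "m \<in> mods d us"
  shows "m \<in> Span Kx us"
  using assms
proof (induction us arbitrary: m)
  case (Cons u us)
  obtain a n where m: "a \<in> polys d" "n \<in> mods d us" "m = a \<otimes> u \<oplus> n" using Cons.prems(2) by (rule mods_ConsE)
  then show ?case using Cons line_extension_mem_iff[of m Kx u "Span Kx us"] polys_in_Kx by auto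
qed simp

lemma subfield_Kx: "subfield Kx F"
  by (rule generate_field_is_subfield) auto

lemma card_mods:
  assumes "independent Kx us"
  shows "card (mods d us) = (Q ^ Suc d) ^ length us"
  using assms
proof (induction us rule: list.induct)
  case (Cons u us)
  have ind: "u \<in> carrier F" "u \<notin> Span Kx us" "independent Kx us"
    using independent_backwards[OF Cons.prems] by auto
  have us: "set us \<subseteq> carrier F" using ind(3) independent_in_carrier by blast
  have sg: "subgroup (Span Kx us) (add_monoid F)" using Span_is_add_subgroup[OF subfield_Kx us] .
  have "inj_on (\<lambda>(a, m). a \<otimes> u \<oplus> m) (polys d \<times> mods d us)"
  proof (rule inj_onI, clarify)
    fix a m a' m' assume *: "a \<in> polys d" "m \<in> mods d us" "a' \<in> polys d" "m' \<in> mods d us"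
      "a \<otimes> u \<oplus> m = a' \<otimes> u \<oplus> m'"
    note c = polys_closed[OF *(1)] mods_closed[OF us *(2)] polys_closed[OF *(3)] mods_closed[OF us *(4)] ind(1)
    have "(a \<ominus> a') \<otimes> u = (a \<otimes> u \<oplus> m) \<ominus> (a' \<otimes> u \<oplus> m') \<oplus> (m' \<ominus> m)" using c by algebra
    also have "\<dots> = m' \<ominus> m" using *(5) c by simp
    finally have eq: "(a \<ominus> a') \<otimes> u = m' \<ominus> m" .
    have "m' \<ominus> m \<in> Span Kx us"
      using mods_in_Span[OF us *(2)] mods_in_Span[OF us *(4)] add.subgroupE(3,4)[OF sg]
      by (simp add: a_minus_def)
    moreover have "a \<ominus> a' \<in> Kx"
      using * polys_in_Kx by (auto simp: a_minus_def intro: generate_field.intros)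
    \<comment> \<open>Otherwise \<open>a \<ominus> a'\<close> is invertible in K(x), and
      \<open>u\<close> would lie in the span of the remaining vectors.\<close>
    ultimately have "a \<ominus> a' = \<zero>"
      using Span_m_inv_simprule[OF subfield_Kx us, of "a \<ominus> a'" u] eq ind by auto
    then have "a = a'" using c by simp
    then show "a = a' \<and> m = m'" using *(5) c by simp
  qed
  then show ?case using Cons ind by (simp add: card_image card_cartesian_product mods.simps(2) card_polys)
qed simp

lemma Span_denominator:
  assumes "set us \<subseteq> carrier F" "f \<in> Span Kx us"
  obtains b d where "b \<in> polys d" "b \<noteq> \<zero>" "b \<otimes> f \<in> mods d us"
  using assms
proof (induction us arbitrary: f thesis)
  case Nil
  show ?case by (rule Nil(1)[of \<one> 0]) (use Nil in auto)
next
  case (Cons u us)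
  obtain k g where f: "k \<in> Kx" "g \<in> Span Kx us" "f = k \<otimes> u \<oplus> g"
    using Cons.prems(3) line_extension_mem_iff by auto
  obtain b d where b: "b \<in> polys d" "b \<noteq> \<zero>" "b \<otimes> g \<in> mods d us"
    using Cons.IH f Cons.prems by auto
  obtain a c e where a: "a \<in> polys e" "c \<in> polys e" "c \<noteq> \<zero>" "k \<otimes> c = a" using Kx_fraction[OF f(1)] .
  have cl: "b \<in> carrier F" "c \<in> carrier F" "k \<in> carrier F" "u \<in> carrier F" "g \<in> carrier F"
    using polys_closed a b f(1) subfieldE(3)[OF subfield_Kx] Cons.prems
      Span_subgroup_props(1)[OF subfield_Kx, of us] f(2) by auto
  have "c \<otimes> b \<otimes> f = (b \<otimes> (k \<otimes> c)) \<otimes> u \<oplus> c \<otimes> (b \<otimes> g)"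
    unfolding f(3) using cl by algebra
  moreover have "(b \<otimes> (k \<otimes> c)) \<otimes> u \<oplus> c \<otimes> (b \<otimes> g) \<in> mods (e + d) (u # us)"
    using a b polys_mult[of b d a e] mods_smult[of us c e "b \<otimes> g" d] Cons.prems
    by (intro mods_ConsI) (auto simp: add.commute)
  ultimately show ?case
    using Cons.prems(1)[of "c \<otimes> b" "e + d"] a b polys_mult integral cl by metis
qed

abbreviation M :: "nat \<Rightarrow> 'a set" where "M d \<equiv> mods d Us"
abbreviation n :: nat where "n \<equiv> length Us"

text \<open>Denominators are multiplied up over the finite set; the single \<open>d\<close> bounds
  the degree of the denominator and of all numerators.\<close>

lemma common_denominator:
  assumes "finite W" "W \<subseteq> carrier F"
  obtains b d where "b \<in> polys d" "b \<noteq> \<zero>" "\<And>w. w \<in> W \<Longrightarrow> b \<otimes> w \<in> M d"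
  using assms
proof (induction W arbitrary: thesis rule: finite_induct)
  case empty
  show ?case by (rule empty(1)[of \<one> 0]) auto
next
  case (insert w W)
  obtain b d where b: "b \<in> polys d" "b \<noteq> \<zero>" "\<And>w. w \<in> W \<Longrightarrow> b \<otimes> w \<in> M d"
    using insert.IH insert.prems by auto
  obtain c e where c: "c \<in> polys e" "c \<noteq> \<zero>" "c \<otimes> w \<in> M e"
    using Span_denominator[OF Us_closed, of w] Us_span insert.prems by auto
  have cl: "b \<in> carrier F" "c \<in> carrier F" "w \<in> carrier F" using b c insert.prems polys_closed by auto
  show ?case
  proof (rule insert.prems(1)[of "c \<otimes> b" "e + d"])
    show "c \<otimes> b \<in> polys (e + d)" using b c polys_mult by simp
    show "c \<otimes> b \<noteq> \<zero>" using b c cl integral by blast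
    fix v assume v: "v \<in> insert w W"
    then have vc: "v \<in> carrier F" using insert.prems by auto
    show "c \<otimes> b \<otimes> v \<in> M (e + d)"
    proof (cases "v = w")
      case True
      have "c \<otimes> b \<otimes> w = b \<otimes> (c \<otimes> w)" using cl by algebra
      then show ?thesis using True mods_smult[OF Us_closed b(1) c(3)] by (simp add: add.commute)
    next
      case False
      then have "b \<otimes> v \<in> M d" using v b by auto
      then show ?thesis using mods_smult[OF Us_closed c(1)] cl vc by (simp add: m_assoc)
    qed
  qed
qed

text \<open>Multiplication by \<open>y\<close> has, in the basis \<open>Us\<close>, a matrix over
  K(x) with denominator \<open>h\<close> and numerators of degree at most \<open>d\<close>. The
  degree of \<open>h\<close> is bounded as well, because the digits of an expansion get multiplied
  by powers of \<open>h\<close>.\<close>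

definition growth :: "'a \<Rightarrow> nat \<Rightarrow> 'a \<Rightarrow> bool" where
  "growth y d h \<longleftrightarrow> h \<in> polys d \<and> h \<noteq> \<zero> \<and> (\<forall>c. \<forall>m\<in>M c. h \<otimes> (y \<otimes> m) \<in> M (c + d))"

lemma growth_poly: "p \<in> polys d \<Longrightarrow> growth p d \<one>"
  using mods_smult[OF Us_closed] polys_closed mods_closed[OF Us_closed]
  by (force simp: growth_def add.commute[of _ d] intro: polys_const)

text \<open>The product of \<open>x\<close> with its inverse causes no growth; the value 1 is forced
  by \<open>h = x\<close> itself. It is this 1 that bounds the degree of the poles of
  \<open>x\<close> by \<open>n\<close>.\<close>

lemma growth_inv_x: "x \<noteq> \<zero> \<Longrightarrow> growth (inv x) 1 x"
  unfolding growth_def using polys_x[of 0] mods_mono[of _ _ Us] mods_closed[OF Us_closed]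
  by (auto simp: m_assoc[symmetric])

text \<open>A common denominator of the finitely many products \<open>y \<otimes> u\<close> with
  \<open>u\<close> in the basis works for every \<open>M c\<close> by linearity.\<close>

lemma growth_exists:
  assumes "y \<in> carrier F"
  obtains d h where "growth y d h"
proof -
  have "(\<lambda>u. y \<otimes> u) ` set Us \<subseteq> carrier F" using assms Us_closed by auto
  then obtain h d where h: "h \<in> polys d" "h \<noteq> \<zero>" "\<And>w. w \<in> (\<lambda>u. y \<otimes> u) ` set Us \<Longrightarrow> h \<otimes> w \<in> M d"
    using common_denominator[of "(\<lambda>u. y \<otimes> u) ` set Us"] by (metis List.finite_set finite_imageI)
  have hc: "h \<in> carrier F" using h polys_closed by blast
  have "h \<otimes> (y \<otimes> m) \<in> M (c + d)" if "set us \<subseteq> set Us" "m \<in> mods c us" for c m us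
    using that
  proof (induction us arbitrary: m)
    case Nil
    then show ?case using assms hc mods_zero[OF Us_closed] by simp
  next
    case (Cons u us)
    obtain a m' where m: "a \<in> polys c" "m' \<in> mods c us" "m = a \<otimes> u \<oplus> m'" using Cons.prems(2) by (rule mods_ConsE)
    have cl: "a \<in> carrier F" "u \<in> carrier F" "m' \<in> carrier F"
      using m polys_closed Cons.prems Us_closed mods_closed[of us m' c] by auto
    have "h \<otimes> (y \<otimes> m) = a \<otimes> (h \<otimes> (y \<otimes> u)) \<oplus> h \<otimes> (y \<otimes> m')"
      unfolding m(3) using cl hc assms by algebra
    moreover have "a \<otimes> (h \<otimes> (y \<otimes> u)) \<in> M (c + d)"
      using mods_smult[OF Us_closed m(1), of _ d] h(3)[of "y \<otimes> u"] Cons.prems by auto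
    moreover have "h \<otimes> (y \<otimes> m') \<in> M (c + d)" using Cons m by auto
    ultimately show ?case using mods_add[OF Us_closed] by simp
  qed
  then have "growth y d h" using h by (auto simp: growth_def)
  then show ?thesis by (rule that)
qed

text \<open>Base-\<open>y\<close> expansions with digits in \<open>W\<close> live in a space whose size grows like
  \<open>Q ^ (n * d * l)\<close>, which bounds the number of digits when the expansions are distinct.\<close>

primrec expansions :: "'a set \<Rightarrow> 'a \<Rightarrow> nat \<Rightarrow> 'a set" where
  "expansions W y 0 = {\<zero>}"
| "expansions W y (Suc l) = (\<lambda>(w, s). w \<oplus> y \<otimes> s) ` (W \<times> expansions W y l)"

lemma expansions_subset:
  assumes "subring R F" "W \<subseteq> R" "y \<in> R"
  shows "expansions W y l \<subseteq> R"
  using assms by (induction l) (auto intro: subringE)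

lemma card_le_of_distinct_expansions:
  assumes g: "growth y d h" and W: "finite W" "W \<subseteq> carrier F" and y: "y \<in> carrier F"
    and inj: "\<And>l. inj_on (\<lambda>(w, s). w \<oplus> y \<otimes> s) (W \<times> expansions W y l)"
  shows "card W \<le> Q ^ (n * d)"
proof -
  obtain b e where b: "b \<in> polys e" "b \<noteq> \<zero>" "\<And>w. w \<in> W \<Longrightarrow> b \<otimes> w \<in> M e"
    using common_denominator[OF W] by blast
  have bc: "b \<in> carrier F" using b polys_closed by blast
  have h: "h \<in> polys d" "h \<noteq> \<zero>" "\<And>c m. m \<in> M c \<Longrightarrow> h \<otimes> (y \<otimes> m) \<in> M (c + d)"
    using g by (auto simp: growth_def)
  have hc: "h \<in> carrier F" using h polys_closed by blast
  have hl: "h [^] l \<in> polys (d * l)" for l :: nat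
    by (induction l) (use h polys_mult[of _ "d * _" h d] in \<open>auto simp: add.commute[of d] intro: polys_const\<close>)
  have sub: "expansions W y l \<subseteq> carrier F" for l
    using expansions_subset[OF carrier_is_subring W(2) y] .
  have fin: "finite (expansions W y l)" for l by (induction l) (use W in auto)
  have "b \<otimes> h [^] l \<otimes> s \<in> M (e + d * l)" if "s \<in> expansions W y l" for l :: nat and s
    using that
  proof (induction l arbitrary: s)
    case 0
    then show ?case using bc mods_zero[OF Us_closed] by simp
  next
    case (Suc l)
    then obtain w t where s: "w \<in> W" "t \<in> expansions W y l" "s = w \<oplus> y \<otimes> t" by auto
    have c: "w \<in> carrier F" "t \<in> carrier F" using s W sub by auto
    \<comment> \<open>Each digit costs one factor \<open>h\<close>: on the tail it absorbs the
      multiplication by \<open>y\<close>, while on the first digit the whole power of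
      \<open>h\<close> only raises the degree.\<close>
    have "b \<otimes> h [^] Suc l \<otimes> s = (h [^] Suc l) \<otimes> (b \<otimes> w) \<oplus> h \<otimes> (y \<otimes> (b \<otimes> h [^] l \<otimes> t))"
    proof -
      have "h [^] l \<in> carrier F" using hc by simp
      then show ?thesis unfolding s(3) nat_pow_Suc using c bc hc y by algebra
    qed
    moreover have "(h [^] Suc l) \<otimes> (b \<otimes> w) \<in> M (e + d * Suc l)"
      using mods_smult[OF Us_closed hl[of "Suc l"] b(3)[OF s(1)]] by (simp add: add.commute)
    moreover have "h \<otimes> (y \<otimes> (b \<otimes> h [^] l \<otimes> t)) \<in> M (e + d * Suc l)"
      using h(3)[OF Suc.IH[OF s(2)]] by (simp add: algebra_simps)
    ultimately show ?case using mods_add[OF Us_closed] by simp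
  qed
  then have "card (expansions W y l) \<le> card (M (e + d * l))" for l
  proof (intro card_inj_on_le[of "\<lambda>s. b \<otimes> h [^] l \<otimes> s"])
    have hn: "h [^] l \<noteq> \<zero>"
    proof (induction l)
      case (Suc l)
      then show ?case using h(2) hc integral[of "h [^] l" h] by auto
    qed simp
    have nz: "b \<otimes> h [^] l \<noteq> \<zero>" using b(2) hn bc hc integral[of b "h [^] l"] by auto
    show "inj_on (\<lambda>s. b \<otimes> h [^] l \<otimes> s) (expansions W y l)"
    proof (rule inj_onI)
      fix s t assume "s \<in> expansions W y l" "t \<in> expansions W y l"
        and eq: "b \<otimes> h [^] l \<otimes> s = b \<otimes> h [^] l \<otimes> t"
      then have "s \<in> carrier F" "t \<in> carrier F" using sub by auto
      then show "s = t" using m_lcancel[OF nz] eq bc hc by simp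
    qed
  qed (auto simp: finite_mods)
  moreover have "card (expansions W y l) = card W ^ l" for l
    by (induction l) (simp_all add: card_image[OF inj] card_cartesian_product)
  ultimately have "card W ^ l \<le> (Q ^ Suc (e + d * l)) ^ n" for l
    by (simp add: card_mods[OF Us_independent])
  \<comment> \<open>Only the factor with exponent \<open>n * d\<close> is repeated for each digit;
    the degree \<open>e\<close> of the denominator of the digits goes into the constant.\<close>
  moreover have "(Q ^ Suc (e + d * l)) ^ n = Q ^ (n * Suc e) * (Q ^ (n * d)) ^ l" for l
    by (simp add: power_mult[symmetric] power_add[symmetric] algebra_simps)
  ultimately show ?thesis
    using power_le_imp_le_base_asymptotic[of "card W" "Q ^ (n * Suc e)" "Q ^ (n * d)"] Q_ge_2 by simp
qed

text \<open>Representatives of distinct cosets of y R are digits with unique expansions: equal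
  values have first digits congruent modulo y R, hence equal, and then \<open>y\<close> can be
  cancelled.\<close>

lemma index_multiple_bound:
  assumes R: "subring R F" and y: "y \<in> R" "y \<noteq> \<zero>" and g: "growth y d h"
  shows "0 < index_in (add_monoid F) R ((\<lambda>r. y \<otimes> r) ` R)"
    and "index_in (add_monoid F) R ((\<lambda>r. y \<otimes> r) ` R) \<le> Q ^ (n * d)"
proof -
  let ?Y = "(\<lambda>r. y \<otimes> r) ` R"
  let ?C = "(\<lambda>w. ?Y #>\<^bsub>add_monoid F\<^esub> w) ` R"
  have Rc: "R \<subseteq> carrier F" using subringE(1)[OF R] .
  have yc: "y \<in> carrier F" using y Rc by auto
  have Y: "subgroup ?Y (add_monoid F)"
  proof (rule add.subgroupI)
    show "?Y \<subseteq> carrier F" using Rc yc by auto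
    show "?Y \<noteq> {}" using subringE(2)[OF R] by auto
    fix a assume "a \<in> ?Y"
    then obtain r where r: "a = y \<otimes> r" "r \<in> R" by auto
    then have "\<ominus> a = y \<otimes> (\<ominus> r)" using yc Rc by (auto simp: r_minus)
    then show "\<ominus> a \<in> ?Y" using r subringE(5)[OF R] by blast
    fix b assume "b \<in> ?Y"
    then obtain s where s: "b = y \<otimes> s" "s \<in> R" by auto
    then have "a \<oplus> b = y \<otimes> (r \<oplus> s)" using r yc Rc by (simp add: r_distr subset_iff)
    then show "a \<oplus> b \<in> ?Y" using r s subringE(7)[OF R] by blast
  qed
  have bound: "card W \<le> Q ^ (n * d)" if W: "finite W" "W \<subseteq> R" "inj_on (\<lambda>w. ?Y #>\<^bsub>add_monoid F\<^esub> w) W" for W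
  proof (rule card_le_of_distinct_expansions[OF g W(1) _ yc])
    show "W \<subseteq> carrier F" using W Rc by auto
    fix l
    show "inj_on (\<lambda>(w, s). w \<oplus> y \<otimes> s) (W \<times> expansions W y l)"
    proof (rule inj_onI, clarify)
      fix w s w' s'
      assume *: "w \<in> W" "w' \<in> W" "s \<in> expansions W y l" "s' \<in> expansions W y l"
        "w \<oplus> y \<otimes> s = w' \<oplus> y \<otimes> s'"
      have sR: "s \<in> R" "s' \<in> R" using * expansions_subset[OF R W(2) y(1)] by auto
      have c: "w \<in> carrier F" "w' \<in> carrier F" "s \<in> carrier F" "s' \<in> carrier F" using * sR W Rc by auto
      have "w \<ominus> w' = (w \<oplus> y \<otimes> s) \<ominus> (w' \<oplus> y \<otimes> s') \<oplus> y \<otimes> (s' \<ominus> s)" using c yc by algebra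
      also have "\<dots> = y \<otimes> (s' \<ominus> s)" using *(5) c yc by simp
      finally have "w \<ominus> w' \<in> ?Y" using sR subringE(5,7)[OF R] by (auto simp: a_minus_def)
      then have "?Y #>\<^bsub>add_monoid F\<^esub> w = ?Y #>\<^bsub>add_monoid F\<^esub> w'"
        using add.r_coset_eq_iff[OF Y] c by (simp add: a_minus_def)
      then have "w = w'" using * W(3) by (auto dest: inj_onD)
      then have "y \<otimes> s = y \<otimes> s'" using *(5) c yc by simp
      then have "s = s'" using m_lcancel[OF y(2) yc] c by blast
      then show "w = w' \<and> s = s'" using \<open>w = w'\<close> by simp
    qed
  qed
  \<comment> \<open>The bound is proved for finite sets of cosets, which shows that there are only
    finitely many; for an infinite set of cosets an inequality on \<open>card\<close> would be
    vacuous.\<close>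
  have fb: "finite S \<Longrightarrow> S \<subseteq> ?C \<Longrightarrow> card S \<le> Q ^ (n * d)" for S
  proof -
    assume S: "finite S" "S \<subseteq> ?C"
    then obtain W where W: "W \<subseteq> R" "inj_on (\<lambda>w. ?Y #>\<^bsub>add_monoid F\<^esub> w) W" "S = (\<lambda>w. ?Y #>\<^bsub>add_monoid F\<^esub> w) ` W"
      by (auto simp: subset_image_inj)
    then have "finite W" using S finite_imageD by blast
    then show "card S \<le> Q ^ (n * d)" using bound W card_image by metis
  qed
  have fin: "finite ?C"
    using fb by (metis finite_if_finite_subsets_card_bdd)
  moreover have "?C \<noteq> {}" using subringE(2)[OF R] by blast
  ultimately show "0 < index_in (add_monoid F) R ?Y" by (simp add: index_in_def card_gt_0_iff)
  show "index_in (add_monoid F) R ?Y \<le> Q ^ (n * d)"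
    unfolding index_in_def using fb[OF fin] by simp
qed

end

section \<open>Valuation rings\<close>

text \<open>Carries the laws of integer powers over from the multiplicative group to the field, for
  a nonzero base.\<close>

lemma (in field) int_pow_mult_of:
  assumes "t \<in> carrier R" "t \<noteq> \<zero>"
  shows "t [^]\<^bsub>Multiplicative_Group.mult_of R\<^esub> (k::int) = t [^] k"
proof -
  have nz: "t [^] (m::nat) \<noteq> \<zero>" for m
  proof (induction m)
    case (Suc m)
    then show ?case using assms integral[of "t [^] m" t] by auto
  qed simp
  have inv_eq: "inv\<^bsub>Multiplicative_Group.mult_of R\<^esub> (t [^] m) = inv (t [^] m)" for m :: nat
    using assms nz by (intro m_inv_mult_of) simp
  then show ?thesis
    unfolding int_pow_def2 Multiplicative_Group.nat_pow_mult_of by (simp only: inv_eq)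
qed

context finite_constants begin

interpretation mult: group "Multiplicative_Group.mult_of F"
  by (rule field_mult_group)

lemma field_int_pow_closed [simp]: "t \<in> carrier F \<Longrightarrow> t \<noteq> \<zero> \<Longrightarrow> t [^] (k::int) \<in> carrier F"
  and int_pow_nonzero [simp]: "t \<in> carrier F \<Longrightarrow> t \<noteq> \<zero> \<Longrightarrow> t [^] (k::int) \<noteq> \<zero>"
  using mult.int_pow_closed[of t k] int_pow_mult_of[of t k] by auto

lemma int_pow_add: "t \<in> carrier F \<Longrightarrow> t \<noteq> \<zero> \<Longrightarrow> t [^] (k + l :: int) = t [^] k \<otimes> t [^] l"
  using mult.int_pow_mult[of t k l] int_pow_mult_of[of t] by simp

lemma int_pow_uminus: "t \<in> carrier F \<Longrightarrow> t \<noteq> \<zero> \<Longrightarrow> t [^] (- k :: int) = inv (t [^] k)"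
  using mult.int_pow_neg[of t k] int_pow_mult_of[of t] m_inv_mult_of[of "t [^] k"] by simp

lemma int_pow_one_exp: "t \<in> carrier F \<Longrightarrow> t [^] (1::int) = t"
  using int_pow_int[of F t 1] by simp

lemma inv_eqI: "a \<in> carrier F \<Longrightarrow> b \<in> carrier F \<Longrightarrow> a \<otimes> b = \<one> \<Longrightarrow> inv a = b"
  using comm_inv_char by blast

lemma field_inv_mult: "a \<in> carrier F \<Longrightarrow> b \<in> carrier F \<Longrightarrow> a \<noteq> \<zero> \<Longrightarrow> b \<noteq> \<zero> \<Longrightarrow> inv (a \<otimes> b) = inv a \<otimes> inv b"
  by (rule inv_eqI) (simp_all add: m_ac field_r_inv[of b] m_assoc[symmetric])

lemma mult_nonzero [simp]: "a \<in> carrier F \<Longrightarrow> b \<in> carrier F \<Longrightarrow> a \<noteq> \<zero> \<Longrightarrow> b \<noteq> \<zero> \<Longrightarrow> a \<otimes> b \<noteq> \<zero>"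
  using integral by blast

lemma field_inv_inv [simp]: "a \<in> carrier F \<Longrightarrow> a \<noteq> \<zero> \<Longrightarrow> inv (inv a) = a"
  by (rule inv_eqI) simp_all

lemma field_int_pow_mult:
  assumes "a \<in> carrier F" "b \<in> carrier F" "a \<noteq> \<zero>" "b \<noteq> \<zero>"
  shows "(a \<otimes> b) [^] (k::int) = a [^] k \<otimes> b [^] k"
  using mult.int_pow_mult_distrib[of a b k] assms int_pow_mult_of[of _ k] by (simp add: m_comm)

section \<open>Multiples of additive subgroups and their indices\<close>

definition scale :: "'a \<Rightarrow> 'a set \<Rightarrow> 'a set" where
  "scale c A = (\<lambda>a. c \<otimes> a) ` A"

lemma add_subgroup_closed:
  assumes "subgroup A (add_monoid F)"
  shows "A \<subseteq> carrier F" "\<zero> \<in> A" "a \<in> A \<Longrightarrow> b \<in> A \<Longrightarrow> a \<oplus> b \<in> A" "a \<in> A \<Longrightarrow> \<ominus> a \<in> A"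
    "a \<in> A \<Longrightarrow> b \<in> A \<Longrightarrow> a \<ominus> b \<in> A"
  using subgroup.subset[OF assms] subgroup.one_closed[OF assms] subgroup.m_closed[OF assms]
    add.subgroupE(3)[OF assms] by (auto simp: a_minus_def)

lemma subgroup_scale:
  assumes A: "subgroup A (add_monoid F)" and c: "c \<in> carrier F"
  shows "subgroup (scale c A) (add_monoid F)"
proof (rule add.subgroupI)
  show "scale c A \<subseteq> carrier F" "scale c A \<noteq> {}" using add_subgroup_closed[OF A] c by (auto simp: scale_def)
  fix a assume "a \<in> scale c A"
  then obtain r where r: "a = c \<otimes> r" "r \<in> A" "r \<in> carrier F" using add_subgroup_closed[OF A] by (auto simp: scale_def)
  then have "\<ominus> a = c \<otimes> (\<ominus> r)" using c by (simp add: r_minus)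
  then show "\<ominus> a \<in> scale c A" using r add_subgroup_closed[OF A] by (auto simp: scale_def)
  fix b assume "b \<in> scale c A"
  then obtain s where s: "b = c \<otimes> s" "s \<in> A" "s \<in> carrier F" using add_subgroup_closed[OF A] by (auto simp: scale_def)
  then have "a \<oplus> b = c \<otimes> (r \<oplus> s)" using r c by (simp add: r_distr)
  then show "a \<oplus> b \<in> scale c A" using r s add_subgroup_closed[OF A] by (auto simp: scale_def)
qed

abbreviation idx :: "'a set \<Rightarrow> 'a set \<Rightarrow> nat" where
  "idx \<equiv> index_in (add_monoid F)"

lemma scale_mem_iff:
  assumes "c \<in> carrier F" "c \<noteq> \<zero>" "A \<subseteq> carrier F" "z \<in> carrier F"
  shows "c \<otimes> z \<in> scale c A \<longleftrightarrow> z \<in> A"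
  using assms m_lcancel by (auto simp: scale_def)

lemma index_scale:
  assumes A: "subgroup A (add_monoid F)" and B: "subgroup B (add_monoid F)" and c: "c \<in> carrier F" "c \<noteq> \<zero>"
  shows "idx (scale c A) (scale c B) = idx A B"
  unfolding index_in_def
proof (rule card_image_transfer[symmetric, where f = "\<lambda>a. c \<otimes> a"])
  note cA = add_subgroup_closed[OF A] and cB = add_subgroup_closed[OF B]
  fix a b assume ab: "a \<in> A" "b \<in> A"
  then have cl: "a \<in> carrier F" "b \<in> carrier F" using cA by auto
  have "c \<otimes> a \<ominus> c \<otimes> b = c \<otimes> (a \<ominus> b)" using cl c by algebra
  then show "B #>\<^bsub>add_monoid F\<^esub> a = B #>\<^bsub>add_monoid F\<^esub> b \<longleftrightarrow>
      scale c B #>\<^bsub>add_monoid F\<^esub> (c \<otimes> a) = scale c B #>\<^bsub>add_monoid F\<^esub> (c \<otimes> b)"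
    using add.r_coset_eq_iff[OF B, of a b] add.r_coset_eq_iff[OF subgroup_scale[OF B c(1)], of "c \<otimes> a" "c \<otimes> b"]
      scale_mem_iff[OF c cB(1), of "a \<ominus> b"] cl c by (simp add: a_minus_def)
qed (auto simp: scale_def)

lemma scale_scale: "A \<subseteq> carrier F \<Longrightarrow> a \<in> carrier F \<Longrightarrow> b \<in> carrier F \<Longrightarrow> scale a (scale b A) = scale (a \<otimes> b) A"
  by (force simp: scale_def image_iff m_assoc)

end

context finite_function_field begin

section \<open>The maximal ideal of a valuation ring\<close>

definition nonunits :: "'a set \<Rightarrow> 'a set" where
  "nonunits V = {z \<in> V. z = \<zero> \<or> inv z \<notin> V}"

definition vunits :: "'a set \<Rightarrow> 'a set" where
  "vunits V = {z \<in> V. z \<noteq> \<zero> \<and> inv z \<in> V}"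

context
  fixes V assumes V: "valuation_ring F K V"
begin

lemma V_subring: "subring V F" and V_psub: "V \<subset> carrier F"
  and V_cases: "z \<in> carrier F \<Longrightarrow> z \<noteq> \<zero> \<Longrightarrow> z \<in> V \<or> inv z \<in> V" and V_K: "K \<subseteq> V"
  using V by (auto simp: valuation_ring_def)

lemma V_closed [simp]: "z \<in> V \<Longrightarrow> z \<in> carrier F" using V_psub by blast

lemma V_sub [simp]: "V \<subseteq> carrier F" using V_psub by blast

lemma V_simps [simp]: "\<zero> \<in> V" "\<one> \<in> V" "a \<in> V \<Longrightarrow> b \<in> V \<Longrightarrow> a \<oplus> b \<in> V"
  "a \<in> V \<Longrightarrow> b \<in> V \<Longrightarrow> a \<otimes> b \<in> V" "a \<in> V \<Longrightarrow> \<ominus> a \<in> V"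
  using subringE[OF V_subring] by auto

lemma V_add_subgroup: "subgroup V (add_monoid F)"
  using subring.axioms(1)[OF V_subring] .

lemma V_ring: "ring (F\<lparr>carrier := V\<rparr>)" using subring_is_ring[OF V_subring] .

lemma V_cring: "cring (F\<lparr>carrier := V\<rparr>)"
  using subcring_iff[of V] subcringI'[OF V_subring] V_psub by auto

lemma nonunits_mult: "r \<in> V \<Longrightarrow> a \<in> nonunits V \<Longrightarrow> r \<otimes> a \<in> nonunits V"
proof -
  assume r: "r \<in> V" and a: "a \<in> nonunits V"
  then have aV: "a \<in> V" by (simp add: nonunits_def)
  show ?thesis
  proof (cases "r \<otimes> a = \<zero>")
    case False
    then have nz: "r \<noteq> \<zero>" "a \<noteq> \<zero>" using r aV by auto
    have "inv (r \<otimes> a) \<notin> V"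
    proof
      assume "inv (r \<otimes> a) \<in> V"
      then have "r \<otimes> inv (r \<otimes> a) \<in> V" using r by simp
      moreover have "r \<otimes> inv (r \<otimes> a) = inv a"
        using nz r aV by (simp add: field_inv_mult m_assoc[symmetric])
      ultimately show False using a nz by (simp add: nonunits_def)
    qed
    then show ?thesis using r aV by (simp add: nonunits_def)
  qed (use r aV in \<open>simp add: nonunits_def\<close>)
qed

text \<open>The sum is (a / b + 1) b, a multiple of the non-unit b. As \<open>V\<close> contains a /
  b or b / a, this case suffices for closure under addition.\<close>

lemma nonunits_add_aux:
  assumes a: "a \<in> nonunits V" and b: "b \<in> nonunits V" "b \<noteq> \<zero>" and q: "a \<otimes> inv b \<in> V"
  shows "a \<oplus> b \<in> nonunits V"
proof -
  have c: "a \<in> carrier F" "b \<in> carrier F" using a b by (auto simp: nonunits_def)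
  have "a \<otimes> inv b \<otimes> b = a" using b c by (simp add: m_assoc)
  then have "a \<oplus> b = (a \<otimes> inv b \<oplus> \<one>) \<otimes> b" using c b by (simp add: l_distr)
  moreover have "a \<otimes> inv b \<oplus> \<one> \<in> V" using q by simp
  ultimately show ?thesis using nonunits_mult b by simp
qed

lemma nonunits_add:
  assumes a: "a \<in> nonunits V" and b: "b \<in> nonunits V"
  shows "a \<oplus> b \<in> nonunits V"
proof (cases "a = \<zero> \<or> b = \<zero>")
  case True
  then show ?thesis using a b by (auto simp: nonunits_def)
next
  case False
  have c: "a \<in> carrier F" "b \<in> carrier F" using a b by (auto simp: nonunits_def)
  have "a \<otimes> inv b \<in> V \<or> b \<otimes> inv a \<in> V"
    using V_cases[of "a \<otimes> inv b"] c False by (simp add: field_inv_mult m_comm)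
  then show ?thesis
    using nonunits_add_aux[OF a b] nonunits_add_aux[OF b a] False a_comm[of a b] c by auto
qed

lemma nonunits_ideal: "ideal (nonunits V) (F\<lparr>carrier := V\<rparr>)"
proof (rule idealI[OF V_ring])
  interpret VR: cring "F\<lparr>carrier := V\<rparr>" by (rule V_cring)
  show "subgroup (nonunits V) (add_monoid (F\<lparr>carrier := V\<rparr>))"
  proof (rule VR.add.subgroupI)
    show "nonunits V \<subseteq> carrier (F\<lparr>carrier := V\<rparr>)" "nonunits V \<noteq> {}"
      by (auto simp: nonunits_def intro!: exI[of _ \<zero>])
    fix a assume a: "a \<in> nonunits V"
    then have aV: "a \<in> V" by (simp add: nonunits_def)
    have "\<ominus> \<one> \<otimes> a \<in> nonunits V" using nonunits_mult a by simp
    moreover have "\<ominus> \<one> \<otimes> a = \<ominus> a" using aV by (simp add: l_minus)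
    moreover have "\<ominus>\<^bsub>F\<lparr>carrier := V\<rparr>\<^esub> a = \<ominus> a"
      using aV by (intro VR.minus_equality) (simp_all add: l_neg)
    ultimately show "\<ominus>\<^bsub>F\<lparr>carrier := V\<rparr>\<^esub> a \<in> nonunits V" by simp
  qed (use nonunits_add in auto)
  fix a r assume "a \<in> nonunits V" "r \<in> carrier (F\<lparr>carrier := V\<rparr>)"
  then show "r \<otimes>\<^bsub>F\<lparr>carrier := V\<rparr>\<^esub> a \<in> nonunits V" "a \<otimes>\<^bsub>F\<lparr>carrier := V\<rparr>\<^esub> r \<in> nonunits V"
    using nonunits_mult[of r a] m_comm[of a r] by (auto simp: nonunits_def)
qed

lemma proper_ideal_nonunits:
  assumes I: "ideal I (F\<lparr>carrier := V\<rparr>)" and "I \<noteq> V"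
  shows "I \<subseteq> nonunits V"
proof
  fix a assume a: "a \<in> I"
  have IV: "I \<subseteq> V" using ideal.Icarr[OF I] by auto
  have "inv a \<notin> V" if "a \<noteq> \<zero>"
  proof
    assume i: "inv a \<in> V"
    have "v \<in> I" if v: "v \<in> V" for v
    proof -
      have "(v \<otimes> inv a) \<otimes> a \<in> I" using ideal.I_l_closed[OF I a, of "v \<otimes> inv a"] v i by simp
      moreover have "(v \<otimes> inv a) \<otimes> a = v" using v i a IV \<open>a \<noteq> \<zero>\<close> by (simp add: m_assoc subset_iff)
      ultimately show ?thesis by simp
    qed
    then show False using IV assms(2) by blast
  qed
  then show "a \<in> nonunits V" using a IV by (auto simp: nonunits_def)
qed

lemma one_notin_nonunits: "\<one> \<notin> nonunits V"
  by (simp add: nonunits_def)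

lemma maximalideal_nonunits: "maximalideal (nonunits V) (F\<lparr>carrier := V\<rparr>)"
proof (rule maximalidealI[OF nonunits_ideal])
  show "carrier (F\<lparr>carrier := V\<rparr>) \<noteq> nonunits V" using one_notin_nonunits V_simps(2) by auto
  fix J assume J: "ideal J (F\<lparr>carrier := V\<rparr>)" "nonunits V \<subseteq> J" "J \<subseteq> carrier (F\<lparr>carrier := V\<rparr>)"
  then show "J = nonunits V \<or> J = carrier (F\<lparr>carrier := V\<rparr>)" using proper_ideal_nonunits[of J] by auto
qed

lemma maximalideal_iff: "maximalideal P (F\<lparr>carrier := V\<rparr>) \<longleftrightarrow> P = nonunits V"
proof
  assume P: "maximalideal P (F\<lparr>carrier := V\<rparr>)"
  have "P \<noteq> V" using maximalideal.I_notcarr[OF P] by auto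
  then have "P \<subseteq> nonunits V" using proper_ideal_nonunits P maximalideal.axioms(1) by blast
  moreover have "nonunits V \<subseteq> V" by (auto simp: nonunits_def)
  moreover have "nonunits V \<noteq> V" using one_notin_nonunits V_simps(2) by metis
  ultimately show "P = nonunits V" using maximalideal.I_maximal[OF P nonunits_ideal] by auto
qed (use maximalideal_nonunits in simp)

text \<open>The ring is recovered from its maximal ideal. Hence a place belongs to one valuation
  ring only, and the definite description in \<open>place_ring\<close> is justified.\<close>

lemma ring_of_nonunits: "V = {z \<in> carrier F. z = \<zero> \<or> inv z \<notin> nonunits V}"
proof (intro equalityI subsetI)
  fix z assume z: "z \<in> V"
  show "z \<in> {z \<in> carrier F. z = \<zero> \<or> inv z \<notin> nonunits V}"
    using z by (auto simp: nonunits_def)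
next
  fix z assume z: "z \<in> {z \<in> carrier F. z = \<zero> \<or> inv z \<notin> nonunits V}"
  show "z \<in> V"
  proof (rule ccontr)
    assume *: "z \<notin> V"
    then have "z \<noteq> \<zero>" by auto
    then show False using * z V_cases[of z] by (auto simp: nonunits_def)
  qed
qed

lemma vunits_iff: "u \<in> vunits V \<longleftrightarrow> u \<in> V \<and> u \<notin> nonunits V"
  by (auto simp: vunits_def nonunits_def)

lemma Units_V: "Units (F\<lparr>carrier := V\<rparr>) = vunits V"
proof (intro equalityI subsetI)
  fix u assume "u \<in> Units (F\<lparr>carrier := V\<rparr>)"
  then obtain w where "u \<in> V" "w \<in> V" "u \<otimes> w = \<one>" by (auto simp: Units_def)
  moreover from this have "inv u = w" "u \<noteq> \<zero>" by (auto intro: inv_eqI)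
  ultimately show "u \<in> vunits V" by (simp add: vunits_def)
qed (auto simp: Units_def vunits_def intro!: bexI[of _ "inv _"])

section \<open>Discreteness of the valuation\<close>

lemma idx_principal_pos: "y \<in> V \<Longrightarrow> y \<noteq> \<zero> \<Longrightarrow> 0 < idx V (scale y V)"
  unfolding scale_def by (metis V_closed V_subring growth_exists index_multiple_bound(1))

lemma scale_V_subset: "y \<in> V \<Longrightarrow> scale y V \<subseteq> V"
  by (auto simp: scale_def)

text \<open>In the chain V, a V, a b V the lower step is a scaled copy of V over b V. The index is
  thus a multiplicative measure of size, available before discreteness is known.\<close>

lemma idx_principal_mult:
  assumes "a \<in> V" "a \<noteq> \<zero>" "b \<in> V"
  shows "idx V (scale (a \<otimes> b) V) = idx V (scale a V) * idx V (scale b V)"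
proof -
  have "scale (a \<otimes> b) V = scale a (scale b V)" using assms scale_scale[of V a b] by simp
  moreover have "scale a (scale b V) \<subseteq> scale a V" using assms by (auto simp: scale_def)
  ultimately show ?thesis
    using add.index_in_tower[OF V_add_subgroup subgroup_scale[OF V_add_subgroup, of a]
        subgroup_scale[OF subgroup_scale[OF V_add_subgroup, of b], of a]]
      index_scale[OF V_add_subgroup subgroup_scale[OF V_add_subgroup, of b], of a]
      assms scale_V_subset by simp
qed

lemma idx_principal_nonunit:
  assumes "a \<in> nonunits V" "a \<noteq> \<zero>"
  shows "idx V (scale a V) \<ge> 2"
proof -
  have aV: "a \<in> V" using assms by (simp add: nonunits_def)
  have "idx V (scale a V) \<noteq> 1"
  proof
    assume "idx V (scale a V) = 1"
    then have "V \<subseteq> scale a V"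
      using add.index_in_eq_1D[OF V_add_subgroup subgroup_scale[OF V_add_subgroup, of a]] aV by simp
    then have "\<one> \<in> scale a V" using V_simps(2) by (rule subsetD)
    then obtain r where "r \<in> V" "\<one> = a \<otimes> r" by (auto simp: scale_def)
    then have "\<one> \<in> nonunits V" using nonunits_mult[of r a] assms aV by (simp add: m_comm)
    then show False using one_notin_nonunits by simp
  qed
  moreover have "idx V (scale a V) > 0" using idx_principal_pos assms aV by simp
  ultimately show ?thesis by linarith
qed

text \<open>A nonzero non-unit \<open>t\<close> of least index generates. If \<open>a\<close> is not
  a multiple of \<open>t\<close>, then \<open>t\<close> is a non-unit multiple of \<open>a\<close>,
  and the index of \<open>a\<close> would be at most half the minimum.\<close>

lemma nonunits_principal: "\<exists>t \<in> nonunits V. t \<noteq> \<zero> \<and> nonunits V = scale t V"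
proof -
  obtain z where z: "z \<in> carrier F" "z \<notin> V" using V_psub by blast
  then have "z \<noteq> \<zero>" by auto
  then have "inv z \<in> nonunits V" "inv z \<noteq> \<zero>" using V_cases[of z] z by (auto simp: nonunits_def)
  then obtain t where t: "t \<in> nonunits V" "t \<noteq> \<zero>"
    and min: "\<And>a. a \<in> nonunits V \<Longrightarrow> a \<noteq> \<zero> \<Longrightarrow> idx V (scale t V) \<le> idx V (scale a V)"
    using ex_has_least_nat[of "\<lambda>a. a \<in> nonunits V \<and> a \<noteq> \<zero>" "inv z" "\<lambda>a. idx V (scale a V)"] by blast
  have tV: "t \<in> V" using t by (simp add: nonunits_def)
  have "a \<in> scale t V" if a: "a \<in> nonunits V" for a
  proof (cases "a = \<zero>")
    case True
    then show ?thesis using tV by (auto simp: scale_def intro!: image_eqI[of _ _ \<zero>])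
  next
    case False
    have aV: "a \<in> V" using a by (simp add: nonunits_def)
    show ?thesis
    proof (cases "a \<otimes> inv t \<in> V")
      case True
      moreover have "a = t \<otimes> (a \<otimes> inv t)" using aV tV t by (simp add: m_comm[of a] m_assoc[symmetric])
      ultimately show ?thesis by (auto simp: scale_def)
    next
      case f: False
      then have ta: "t \<otimes> inv a \<in> V"
        using V_cases[of "a \<otimes> inv t"] aV tV t False by (simp add: field_inv_mult m_comm)
      have "t = a \<otimes> (t \<otimes> inv a)" using aV tV False by (simp add: m_comm[of t] m_assoc[symmetric])
      then have m: "idx V (scale t V) = idx V (scale a V) * idx V (scale (t \<otimes> inv a) V)"
        using idx_principal_mult[OF aV False ta] by simp
      have "t \<otimes> inv a \<in> nonunits V"
        using ta f aV tV t False by (auto simp: nonunits_def field_inv_mult m_comm)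
      then have "idx V (scale (t \<otimes> inv a) V) \<ge> 2"
        using idx_principal_nonunit t aV tV False by simp
      then have "idx V (scale a V) * 2 \<le> idx V (scale t V)" unfolding m by (rule mult_le_mono2)
      moreover have "idx V (scale a V) > 0" using idx_principal_pos aV False by simp
      moreover have "idx V (scale t V) \<le> idx V (scale a V)" using min[OF a False] .
      ultimately show ?thesis by linarith
    qed
  qed
  moreover have "scale t V \<subseteq> nonunits V"
    using nonunits_mult[OF _ t(1)] tV by (auto simp: scale_def m_comm)
  ultimately show ?thesis using t by blast
qed

text \<open>Splitting off a factor \<open>t\<close> at least halves the index, which is finite and
  positive; so the process stops at a unit.\<close>

lemma power_decomposition_V:
  assumes t: "t \<in> nonunits V" "t \<noteq> \<zero>" "nonunits V = scale t V" and z: "z \<in> V" "z \<noteq> \<zero>"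
  shows "\<exists>k::int. \<exists>u \<in> vunits V. z = t [^] k \<otimes> u"
  using z
proof (induction "idx V (scale z V)" arbitrary: z rule: less_induct)
  case less
  have tV: "t \<in> V" using t by (simp add: nonunits_def)
  show ?case
  proof (cases "z \<in> nonunits V")
    case False
    then have "z \<in> vunits V" using less vunits_iff by simp
    then show ?thesis using less by (intro exI[of _ 0] bexI[of _ z]) auto
  next
    case True
    then obtain w where w: "w \<in> V" "z = t \<otimes> w" using t(3) by (auto simp: scale_def)
    have wn: "w \<noteq> \<zero>" using w less.prems tV by auto
    have m: "idx V (scale z V) = idx V (scale t V) * idx V (scale w V)"
      using idx_principal_mult[OF tV t(2) w(1)] w by simp
    have "idx V (scale t V) \<ge> 2" using idx_principal_nonunit t(1,2) by blast
    then have "2 * idx V (scale w V) \<le> idx V (scale z V)" unfolding m by (rule mult_le_mono1)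
    moreover have "idx V (scale w V) > 0" using idx_principal_pos[OF w(1) wn] .
    ultimately have "idx V (scale w V) < idx V (scale z V)" by linarith
    then obtain k u where "u \<in> vunits V" "w = t [^] (k::int) \<otimes> u" using less.hyps w wn by blast
    moreover from this have "z = t [^] (1 + k) \<otimes> u"
      using w tV t by (simp add: int_pow_add int_pow_one_exp m_assoc vunits_def)
    ultimately show ?thesis by blast
  qed
qed

lemma vunits_inv: "u \<in> vunits V \<Longrightarrow> inv u \<in> vunits V"
  by (auto simp: vunits_def)

lemma vunits_mult: "u \<in> vunits V \<Longrightarrow> w \<in> vunits V \<Longrightarrow> u \<otimes> w \<in> vunits V"
  by (auto simp: vunits_def field_inv_mult)

lemma vunits_nat_pow: "u \<in> vunits V \<Longrightarrow> u [^] (k::nat) \<in> vunits V"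
proof (induction k)
  case 0
  then show ?case by (simp add: vunits_def)
qed (simp add: vunits_mult)

lemma vunits_int_pow: "u \<in> vunits V \<Longrightarrow> u [^] (k::int) \<in> vunits V"
  using vunits_nat_pow vunits_inv unfolding int_pow_def2 by presburger

lemma power_decomposition:
  assumes t: "t \<in> nonunits V" "t \<noteq> \<zero>" "nonunits V = scale t V" and z: "z \<in> carrier F" "z \<noteq> \<zero>"
  shows "\<exists>k::int. \<exists>u \<in> vunits V. z = t [^] k \<otimes> u"
proof (cases "z \<in> V")
  case True
  then show ?thesis using power_decomposition_V[OF t] z by simp
next
  case False
  then have "inv z \<in> V" using V_cases z by blast
  then obtain k u where ku: "u \<in> vunits V" "inv z = t [^] (k::int) \<otimes> u"
    using power_decomposition_V[OF t] z by (meson inv_nonzero)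
  have c: "t \<in> carrier F" "u \<in> carrier F" "u \<noteq> \<zero>" using t ku by (auto simp: nonunits_def vunits_def)
  have "z = inv (inv z)" using z by simp
  also have "\<dots> = t [^] (-k) \<otimes> inv u" using ku c t by (simp add: field_inv_mult int_pow_uminus)
  finally show ?thesis using vunits_inv ku by blast
qed

lemma int_pow_mem_iff:
  assumes t: "t \<in> nonunits V" "t \<noteq> \<zero>" and u: "u \<in> vunits V"
  shows "t [^] (k::int) \<otimes> u \<in> V \<longleftrightarrow> k \<ge> 0" "t [^] (k::int) \<otimes> u \<in> nonunits V \<longleftrightarrow> k > 0"
proof -
  have tV: "t \<in> V" using t by (simp add: nonunits_def)
  have uV: "u \<in> V" "u \<noteq> \<zero>" "inv u \<in> V" using u by (auto simp: vunits_def)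
  have nat: "t [^] (m::nat) \<in> V" for m by (induction m) (auto simp: tV)
  have pos: "t [^] (l::int) \<otimes> u \<in> nonunits V" if "l > 0" "u \<in> V" for l u
  proof -
    have "t [^] l = t [^] (l - 1) \<otimes> t" using int_pow_add[of t "l - 1" 1] t tV by (simp add: int_pow_one_exp)
    moreover have "t [^] (l - 1) \<in> V" using nat[of "nat (l - 1)"] pow_nat[of "l - 1" F t] that by simp
    ultimately have "t [^] l \<otimes> u = (t [^] (l - 1) \<otimes> u) \<otimes> t" "t [^] (l - 1) \<otimes> u \<in> V"
      using that tV by (simp_all add: m_ac)
    then show ?thesis using nonunits_mult t by simp
  qed
  have zero: "t [^] (0::int) \<otimes> u \<in> vunits V" using u uV by simp
  have neg: "t [^] k \<otimes> u \<notin> V" if "k < 0"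
  proof
    assume *: "t [^] k \<otimes> u \<in> V"
    have "t [^] (-k) \<otimes> inv u \<in> nonunits V" using pos[of "-k" "inv u"] that uV by simp
    then have "(t [^] k \<otimes> u) \<otimes> (t [^] (-k) \<otimes> inv u) \<in> nonunits V" using nonunits_mult[OF *] by simp
    moreover have "t [^] (-k) \<otimes> inv u = inv (t [^] k \<otimes> u)" using uV t tV by (simp add: field_inv_mult int_pow_uminus)
    ultimately show False using one_notin_nonunits uV t tV by simp
  qed
  show "t [^] k \<otimes> u \<in> V \<longleftrightarrow> k \<ge> 0"
    using pos[of k u] zero neg uV by (cases "k > 0"; cases "k = 0") (auto simp: nonunits_def)
  show "t [^] k \<otimes> u \<in> nonunits V \<longleftrightarrow> k > 0"
    using pos[of k u] zero neg uV vunits_iff[of "t [^] k \<otimes> u"] by (cases "k > 0"; cases "k = 0") (auto simp: nonunits_def)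
qed

lemma power_decomposition_unique:
  assumes t: "t \<in> nonunits V" "t \<noteq> \<zero>" "nonunits V = scale t V"
    and s: "s \<in> nonunits V" "s \<noteq> \<zero>" "nonunits V = scale s V"
    and u: "u \<in> vunits V" "w \<in> vunits V" and eq: "t [^] (k::int) \<otimes> u = s [^] (l::int) \<otimes> w"
  shows "k = l"
proof -
  have c: "t \<in> V" "s \<in> V" using t s by (auto simp: nonunits_def)
  obtain e where e: "e \<in> V" "s = t \<otimes> e" using s(1) t(3) by (auto simp: scale_def)
  obtain f where f: "f \<in> V" "t = s \<otimes> f" using t(1) s(3) by (auto simp: scale_def)
  have en: "e \<noteq> \<zero>" using e s c by auto
  have "t \<otimes> (e \<otimes> f) = t \<otimes> \<one>" using e f c by (simp add: m_assoc[symmetric])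
  then have "e \<otimes> f = \<one>" using m_lcancel[OF t(2), of "e \<otimes> f" \<one>] e(1) f(1) c by (metis V_closed m_closed one_closed)
  then have "inv e = f" using e(1) f(1) by (intro inv_eqI) auto
  then have eu: "e \<in> vunits V" using e(1) f(1) en by (simp add: vunits_def)
  have cl: "u \<in> carrier F" "w \<in> carrier F" "w \<noteq> \<zero>" "u \<noteq> \<zero>" using u by (auto simp: vunits_def)
  have "s [^] l = t [^] l \<otimes> e [^] l" using e c en t by (simp add: field_int_pow_mult)
  then have "t [^] k \<otimes> u = t [^] l \<otimes> (e [^] l \<otimes> w)" using eq cl c t(2) en e(1) by (simp add: m_assoc)
  then have "t [^] (-l) \<otimes> (t [^] k \<otimes> u) = t [^] (-l) \<otimes> (t [^] l \<otimes> (e [^] l \<otimes> w))" by simp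
  moreover have "t [^] (-l) \<otimes> (t [^] k \<otimes> u) = t [^] (k - l) \<otimes> u"
    using int_pow_add[of t "-l" k] cl c t(2) by (simp add: m_assoc)
  moreover have "t [^] (-l) \<otimes> (t [^] l \<otimes> (e [^] l \<otimes> w)) = e [^] l \<otimes> w"
    using int_pow_add[of t "-l" l, symmetric] cl c t(2) en e(1) by (simp add: m_assoc[symmetric])
  ultimately have eq': "t [^] (k - l) \<otimes> u = e [^] l \<otimes> w" by simp
  have ew: "e [^] l \<otimes> w \<in> vunits V" using vunits_int_pow[OF eu] vunits_mult u by simp
  show ?thesis
    using int_pow_mem_iff[OF t(1,2) u(1), of "k - l"] ew eq' vunits_iff[of "e [^] l \<otimes> w"] by auto
qed

end
end

section \<open>Places and their residue fields\<close>

lemma (in ring) card_of_dimension: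
  assumes K: "subfield K R" and dim: "dimension d K E" and fin: "finite K"
  shows "finite E" "card E = card K ^ d"
proof -
  obtain Vs where Vs: "independent K Vs" "length Vs = d" "Span K Vs = E" "set Vs \<subseteq> carrier R"
    using exists_base[OF K dim] by blast
  let ?L = "{Ks. set Ks \<subseteq> K \<and> length Ks = length Vs}"
  have bij: "bij_betw (\<lambda>Ks. combine Ks Vs) ?L E"
    unfolding bij_betw_def
  proof
    show "(\<lambda>Ks. combine Ks Vs) ` ?L = E"
      using Span_eq_combine_set_length_version[OF K Vs(4)] Vs(3) by auto
    show "inj_on (\<lambda>Ks. combine Ks Vs) ?L"
    proof (rule inj_onI)
      fix Ks Ls assume *: "Ks \<in> ?L" "Ls \<in> ?L" "combine Ks Vs = combine Ls Vs"
      then have "combine Ks Vs \<in> Span K Vs"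
        using Span_eq_combine_set_length_version[OF K Vs(4)] by auto
      from unique_decomposition[OF K Vs(1) this] * show "Ks = Ls" by auto
    qed
  qed
  have "card ?L = card K ^ d" "finite ?L"
    using card_lists_length_eq[OF fin] finite_lists_length_eq[OF fin] Vs(2) by auto
  then show "finite E" "card E = card K ^ d"
    using bij_betw_finite[OF bij] bij_betw_same_card[OF bij] by simp_all
qed

text \<open>A finite subspace is spanned by the list of its own elements, hence finite-dimensional.
  This is the bridge by which \<open>place_degree\<close> and \<open>ell\<close> are found by
  counting.\<close>

lemma (in ring) card_eq_power_dim:
  assumes K: "subfield K R" and fin: "finite K" and E: "subalgebra K E R" "finite E"
  shows "card E = card K ^ dim K E"
proof -
  obtain Vs where Vs: "set Vs = E" using finite_list[OF E(2)] by blast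
  then have c: "set Vs \<subseteq> carrier R" using subalgebra_in_carrier[OF E(1)] by simp
  have "Span K Vs = E"
    using subalgebra_Span_incl[OF K E(1), of Vs] Span_base_incl[OF K c] Vs by auto
  then have "finite_dimension K E" using Span_finite_dimension[OF K c] by simp
  then have "dimension (dim K E) K E" using finite_dimensionE[OF K] by (simp add: over_def)
  then show ?thesis using card_of_dimension[OF K _ fin] by blast
qed

context finite_function_field begin

abbreviation Pl :: "'a set set" where "Pl \<equiv> places F K"

definition VR :: "'a set \<Rightarrow> 'a set" where
  "VR P = carrier (place_ring F K P)"

lemma place_facts:
  assumes "P \<in> Pl"
  shows "place_ring F K P = F\<lparr>carrier := VR P\<rparr>" "valuation_ring F K (VR P)" "P = nonunits (VR P)"
proof -
  let ?p = "\<lambda>V. valuation_ring F K V \<and> maximalideal P (F\<lparr>carrier := V\<rparr>)"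
  obtain V where V: "?p V" using assms by (auto simp: places_def)
  have uniq: "V' = V" if "?p V'" for V'
    using ring_of_nonunits[of V] ring_of_nonunits[of V'] maximalideal_iff[of V P] maximalideal_iff[of V' P] V that
    by simp
  have "(THE V. ?p V) = V" by (rule the_equality, rule V, rule uniq)
  then have "place_ring F K P = F\<lparr>carrier := V\<rparr>" by (simp add: place_ring_def)
  moreover from this have "VR P = V" by (simp add: VR_def)
  ultimately show "place_ring F K P = F\<lparr>carrier := VR P\<rparr>" "valuation_ring F K (VR P)" "P = nonunits (VR P)"
    using V maximalideal_iff by auto
qed

lemma place_of_valuation_ring:
  assumes "valuation_ring F K V"
  shows "nonunits V \<in> Pl" "VR (nonunits V) = V"
proof -
  show *: "nonunits V \<in> Pl" using maximalideal_nonunits[OF assms] assms by (auto simp: places_def)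
  show "VR (nonunits V) = V"
    using place_facts[OF *] ring_of_nonunits[OF assms] ring_of_nonunits[of "VR (nonunits V)"] by metis
qed

section \<open>The valuation of a place\<close>

abbreviation v :: "'a set \<Rightarrow> 'a \<Rightarrow> int" where "v P z \<equiv> place_val F K P z"

context
  fixes P assumes P: "P \<in> Pl"
begin

lemmas valuation_ring_VR = place_facts(2)[OF P]

lemma VR_subset_carrier: "VR P \<subseteq> carrier F" using V_sub[OF valuation_ring_VR] .

lemma PIdl_eq: "PIdl\<^bsub>F\<lparr>carrier := VR P\<rparr>\<^esub> t = scale t (VR P)" if "t \<in> VR P"
  using that VR_subset_carrier by (auto simp: cgenideal_def scale_def m_comm subset_iff)

lemma nonunits_closed: "z \<in> P \<Longrightarrow> z \<in> VR P" "P \<subseteq> carrier F"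
  using place_facts(3)[OF P] VR_subset_carrier by (auto simp: nonunits_def)

lemma v_eqI:
  assumes t: "t \<in> P" "t \<noteq> \<zero>" "P = scale t (VR P)" and u: "u \<in> vunits (VR P)"
  shows "v P (t [^] k \<otimes> u) = k"
  unfolding place_val_def place_facts(1)[OF P] Units_V[OF valuation_ring_VR]
proof (rule the_equality)
  have tV: "t \<in> VR P" using t nonunits_closed by blast
  show "\<exists>s\<in>carrier (F\<lparr>carrier := VR P\<rparr>). \<exists>w\<in>vunits (VR P).
       P = PIdl\<^bsub>F\<lparr>carrier := VR P\<rparr>\<^esub> s \<and> t [^] k \<otimes> u = s [^] k \<otimes> w"
    using tV t u PIdl_eq[OF tV] by auto
  fix l :: int
  assume "\<exists>s\<in>carrier (F\<lparr>carrier := VR P\<rparr>). \<exists>w\<in>vunits (VR P).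
       P = PIdl\<^bsub>F\<lparr>carrier := VR P\<rparr>\<^esub> s \<and> t [^] k \<otimes> u = s [^] l \<otimes> w"
  then obtain s w where s: "s \<in> VR P" "w \<in> vunits (VR P)" "P = scale s (VR P)"
    and eq: "t [^] k \<otimes> u = s [^] l \<otimes> w" using PIdl_eq by auto
  have "s \<otimes> \<one> \<in> scale s (VR P)" using V_simps(2)[OF valuation_ring_VR] by (auto simp: scale_def)
  then have sP: "s \<in> P" using s VR_subset_carrier by (simp add: subset_iff)
  have "s \<noteq> \<zero>"
  proof
    assume "s = \<zero>"
    then have "t \<in> scale \<zero> (VR P)" using t(1) s(3) by simp
    then show False using t(2) VR_subset_carrier by (auto simp: scale_def)
  qed
  then show "l = k"
    using power_decomposition_unique[OF valuation_ring_VR, of t s u w k l] t s sP u eq place_facts(3)[OF P] by simp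
qed

lemma uniformizer: "\<exists>t \<in> P. t \<noteq> \<zero> \<and> P = scale t (VR P)"
  using nonunits_principal[OF valuation_ring_VR] place_facts(3)[OF P] by simp

lemma v_decomp:
  assumes t: "t \<in> P" "t \<noteq> \<zero>" "P = scale t (VR P)" and z: "z \<in> carrier F" "z \<noteq> \<zero>"
  shows "\<exists>u \<in> vunits (VR P). z = t [^] v P z \<otimes> u"
proof -
  obtain k u where "u \<in> vunits (VR P)" "z = t [^] (k::int) \<otimes> u"
    using power_decomposition[OF valuation_ring_VR _ t(2) _ z] t place_facts(3)[OF P] by auto
  then show ?thesis using v_eqI[OF t, of u k] by auto
qed

lemma v_mult:
  assumes "z \<in> carrier F" "z \<noteq> \<zero>" "w \<in> carrier F" "w \<noteq> \<zero>"
  shows "v P (z \<otimes> w) = v P z + v P w"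
proof -
  obtain t where t: "t \<in> P" "t \<noteq> \<zero>" "P = scale t (VR P)" using uniformizer by blast
  then have tc: "t \<in> carrier F" using nonunits_closed by blast
  obtain u1 where u1: "u1 \<in> vunits (VR P)" "z = t [^] v P z \<otimes> u1" using v_decomp[OF t assms(1,2)] by blast
  obtain u2 where u2: "u2 \<in> vunits (VR P)" "w = t [^] v P w \<otimes> u2" using v_decomp[OF t assms(3,4)] by blast
  have c: "u1 \<in> carrier F" "u2 \<in> carrier F" using u1 u2 VR_subset_carrier by (auto simp: vunits_def)
  have "(t [^] v P z \<otimes> u1) \<otimes> (t [^] v P w \<otimes> u2) = (t [^] v P z \<otimes> t [^] v P w) \<otimes> (u1 \<otimes> u2)"
    using c tc t(2) m_ac field_int_pow_closed by (simp add: m_ac)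
  then have "z \<otimes> w = t [^] (v P z + v P w) \<otimes> (u1 \<otimes> u2)"
    using u1(2) u2(2) tc t(2) by (simp add: int_pow_add)
  then show ?thesis using v_eqI[OF t vunits_mult[OF valuation_ring_VR u1(1) u2(1)]] by metis
qed

lemma v_mem_iff:
  assumes "z \<in> carrier F" "z \<noteq> \<zero>"
  shows "z \<in> VR P \<longleftrightarrow> v P z \<ge> 0" "z \<in> P \<longleftrightarrow> v P z > 0"
proof -
  obtain t where t: "t \<in> P" "t \<noteq> \<zero>" "P = scale t (VR P)" using uniformizer by blast
  obtain u where "u \<in> vunits (VR P)" "z = t [^] v P z \<otimes> u" using v_decomp[OF t assms] by blast
  then show "z \<in> VR P \<longleftrightarrow> v P z \<ge> 0" "z \<in> P \<longleftrightarrow> v P z > 0"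
    using int_pow_mem_iff[OF valuation_ring_VR, of t u "v P z"] t place_facts(3)[OF P] by auto
qed

lemma v_one: "v P \<one> = 0" using v_mult[of \<one> \<one>] by simp

lemma v_inv: "z \<in> carrier F \<Longrightarrow> z \<noteq> \<zero> \<Longrightarrow> v P (inv z) = - v P z"
  using v_mult[of z "inv z"] v_one by simp

lemma v_const: assumes "a \<in> K" "a \<noteq> \<zero>" shows "v P a = 0"
proof -
  have "a \<in> VR P" "inv a \<in> VR P" using assms V_K[OF valuation_ring_VR] by auto
  then show ?thesis using v_mem_iff(1)[of a] v_mem_iff(1)[of "inv a"] v_inv[of a] assms by simp
qed

lemma exists_v_eq: "\<exists>z\<in>carrier F. z \<noteq> \<zero> \<and> v P z = k"
proof -
  obtain t where t: "t \<in> P" "t \<noteq> \<zero>" "P = scale t (VR P)" using uniformizer by blast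
  then have tc: "t \<in> carrier F" using nonunits_closed by blast
  have "\<one> \<in> vunits (VR P)" using V_simps(2)[OF valuation_ring_VR] by (simp add: vunits_def)
  then have "v P (t [^] k) = k" using v_eqI[OF t, of \<one> k] tc t by simp
  then show ?thesis using tc t by (intro bexI[of _ "t [^] k"]) auto
qed

end

text \<open>The power \<open>P\<^sup>k\<close> of a place; \<^const>\<open>place_val\<close> is meaningless at zero, which is added by hand.\<close>

definition pw :: "'a set \<Rightarrow> int \<Rightarrow> 'a set" where
  "pw P k = {z \<in> carrier F. z = \<zero> \<or> v P z \<ge> k}"

lemma pw_closed: "z \<in> pw P k \<Longrightarrow> z \<in> carrier F" and pw_subset: "pw P k \<subseteq> carrier F"
  and pw_zero [simp]: "\<zero> \<in> pw P k" and pw_mono: "z \<in> pw P k \<Longrightarrow> l \<le> k \<Longrightarrow> z \<in> pw P l"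
  by (auto simp: pw_def)

lemma pw_iff: "z \<in> carrier F \<Longrightarrow> z \<noteq> \<zero> \<Longrightarrow> z \<in> pw P k \<longleftrightarrow> v P z \<ge> k"
  by (simp add: pw_def)

context
  fixes P assumes P: "P \<in> Pl"
begin

lemma pw_0: "pw P 0 = VR P"
  using v_mem_iff(1)[OF P] VR_subset_carrier[OF P] V_simps(1)[OF valuation_ring_VR[OF P]] by (auto simp: pw_def)

lemma pw_1: "pw P 1 = P"
proof -
  have "\<zero> \<in> P" using V_simps(1)[OF valuation_ring_VR[OF P]] place_facts(3)[OF P] by (auto simp: nonunits_def)
  moreover have "z \<in> P \<Longrightarrow> z \<in> carrier F" for z using nonunits_closed[OF P] by blast
  ultimately show ?thesis using v_mem_iff(2)[OF P] by (auto simp: pw_def int_one_le_iff_zero_less)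
qed

lemma pw_mult: "z \<in> pw P k \<Longrightarrow> w \<in> pw P l \<Longrightarrow> z \<otimes> w \<in> pw P (k + l)"
  by (cases "z = \<zero>"; cases "w = \<zero>") (auto simp: pw_def v_mult[OF P])

lemma pw_scale:
  assumes c: "c \<in> carrier F" "c \<noteq> \<zero>"
  shows "scale c (pw P k) = pw P (k + v P c)"
proof
  show "scale c (pw P k) \<subseteq> pw P (k + v P c)"
    using pw_mult[of c "v P c" _ k] c by (auto simp: scale_def pw_iff add.commute)
  show "pw P (k + v P c) \<subseteq> scale c (pw P k)"
  proof
    fix z assume z: "z \<in> pw P (k + v P c)"
    have "inv c \<otimes> z \<in> pw P (- v P c + (k + v P c))"
      using z c by (intro pw_mult) (auto simp: pw_iff v_inv[OF P])
    moreover have "z = c \<otimes> (inv c \<otimes> z)" using c z pw_closed[OF z] by (simp add: m_assoc[symmetric])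
    ultimately show "z \<in> scale c (pw P k)" by (auto simp: scale_def)
  qed
qed

lemma pw_subgroup: "subgroup (pw P k) (add_monoid F)"
proof -
  obtain c where c: "c \<in> carrier F" "c \<noteq> \<zero>" "v P c = k" using exists_v_eq[OF P] by blast
  then have "pw P k = scale c (VR P)" using pw_scale[of c 0] pw_0 by simp
  then show ?thesis using subgroup_scale[OF V_add_subgroup[OF valuation_ring_VR[OF P]] c(1)] by simp
qed

lemma pw_add: "z \<in> pw P k \<Longrightarrow> w \<in> pw P k \<Longrightarrow> z \<oplus> w \<in> pw P k"
  and pw_uminus: "z \<in> pw P k \<Longrightarrow> \<ominus> z \<in> pw P k"
  using add_subgroup_closed[OF pw_subgroup] by auto

lemma pw_smult: "a \<in> K \<Longrightarrow> z \<in> pw P k \<Longrightarrow> a \<otimes> z \<in> pw P k"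
  using pw_mult[of a 0 z k] by (cases "a = \<zero>") (auto simp: pw_iff v_const[OF P] dest: pw_closed)

text \<open>If the sum lay one step deeper in the filtration, so would z = (z + w) - w. That the sum
  does not vanish is part of the claim, because \<open>place_val\<close> says nothing at
  zero.\<close>

lemma v_add_distinct:
  assumes z: "z \<in> carrier F" "z \<noteq> \<zero>" "w \<in> carrier F" "w \<noteq> \<zero>" "v P z < v P w"
  shows "z \<oplus> w \<noteq> \<zero>" "v P (z \<oplus> w) = v P z"
proof -
  have eq: "z \<oplus> w \<oplus> (\<ominus> w) = z" using z by algebra
  have no: "\<not> z \<oplus> w \<in> pw P (v P z + 1)"
  proof
    assume "z \<oplus> w \<in> pw P (v P z + 1)"
    moreover have "\<ominus> w \<in> pw P (v P z + 1)" using z by (intro pw_uminus) (simp add: pw_iff)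
    ultimately have "z \<in> pw P (v P z + 1)" using pw_add eq by fastforce
    then show False using z by (simp add: pw_iff)
  qed
  then show nz: "z \<oplus> w \<noteq> \<zero>" by auto
  have "z \<oplus> w \<in> pw P (v P z)" using z by (intro pw_add) (simp_all add: pw_iff)
  then show "v P (z \<oplus> w) = v P z" using no nz z by (simp add: pw_iff)
qed

text \<open>Multiplication by an element of value \<open>k\<close> shifts the filtration by
  \<open>k\<close>, so every graded piece has the size of the residue field.\<close>

lemma idx_pw_Suc: "idx (pw P k) (pw P (k + 1)) = idx (VR P) P"
proof -
  obtain c where c: "c \<in> carrier F" "c \<noteq> \<zero>" "v P c = k" using exists_v_eq[OF P] by blast
  then have "pw P k = scale c (pw P 0)" "pw P (k + 1) = scale c (pw P 1)"
    using pw_scale[of c 0] pw_scale[of c 1] by (simp_all add: add.commute)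
  then show ?thesis using index_scale[OF pw_subgroup[of 0] pw_subgroup[of 1] c(1,2)] pw_0 pw_1 by simp
qed

section \<open>Residue fields and degrees of places\<close>

lemma place_maximalideal: "maximalideal P (F\<lparr>carrier := VR P\<rparr>)"
  using maximalideal_nonunits[OF valuation_ring_VR[OF P]] place_facts(3)[OF P] by simp

lemma place_cring: "cring (F\<lparr>carrier := VR P\<rparr>)" using V_cring[OF valuation_ring_VR[OF P]] .

lemma residue_eq: "residue F K P f = P #>\<^bsub>add_monoid F\<^esub> f"
  by (simp add: residue_def place_facts(1)[OF P] a_r_coset_def r_coset_def)

lemma residue_eq_iff:
  "f \<in> carrier F \<Longrightarrow> g \<in> carrier F \<Longrightarrow> residue F K P f = residue F K P g \<longleftrightarrow> f \<ominus> g \<in> P"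
  unfolding residue_eq using add.r_coset_eq_iff[OF pw_subgroup[of 1], of f g] pw_1 by (simp add: a_minus_def)

lemma inj_residue_K: "inj_on (residue F K P) K"
proof (rule inj_onI)
  fix a b assume ab: "a \<in> K" "b \<in> K" "residue F K P a = residue F K P b"
  then have "a \<ominus> b \<in> pw P 1" "a \<ominus> b \<in> K" using residue_eq_iff pw_1 by (auto simp: a_minus_def)
  then have "a \<ominus> b = \<zero>" using v_const[OF P, of "a \<ominus> b"] unfolding pw_def by fastforce
  then show "a = b" using ab by simp
qed

lemma residue_field_facts:
  shows "field (residue_field F K P)" "ring_hom_ring (F\<lparr>carrier := VR P\<rparr>) (residue_field F K P) (residue F K P)"
    "carrier (residue_field F K P) = residue F K P ` VR P"
proof -
  show "field (residue_field F K P)"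
    unfolding residue_field_def place_facts(1)[OF P]
    using maximalideal.quotient_is_field[OF place_maximalideal place_cring] .
  have "residue F K P = (+>\<^bsub>F\<lparr>carrier := VR P\<rparr>\<^esub>) P"
    by (rule ext) (simp add: residue_def place_facts(1)[OF P])
  then show "ring_hom_ring (F\<lparr>carrier := VR P\<rparr>) (residue_field F K P) (residue F K P)"
    unfolding residue_field_def place_facts(1)[OF P]
    using ideal.rcos_ring_hom_ring[OF maximalideal.axioms(1)[OF place_maximalideal]] by simp
  show "carrier (residue_field F K P) = residue F K P ` VR P"
    by (auto simp: residue_field_def place_facts(1)[OF P] FactRing_def A_RCOSETS_def RCOSETS_def
        residue_eq r_coset_def)
qed

text \<open>The residue field is finite because the place is principal and principal ideals have
  finite index. Finiteness turns the dimension in \<open>place_degree\<close> into a logarithm of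
  the index.\<close>

lemma card_residue_field: "idx (VR P) P = Q ^ place_degree F K P" "idx (VR P) P > 0"
proof -
  let ?k = "residue_field F K P" and ?K = "residue F K P ` K"
  obtain t where t: "t \<in> P" "t \<noteq> \<zero>" "P = scale t (VR P)" using uniformizer[OF P] by blast
  show pos: "idx (VR P) P > 0"
    using idx_principal_pos[OF valuation_ring_VR[OF P], of t] t nonunits_closed[OF P] by metis
  have c: "idx (VR P) P = card (carrier ?k)"
    by (simp add: index_in_def residue_field_facts(3) residue_eq)
  interpret k: field ?k by (rule residue_field_facts(1))
  interpret h: ring_hom_ring "F\<lparr>carrier := VR P\<rparr>" ?k "residue F K P" by (rule residue_field_facts(2))
  have "subfield K (F\<lparr>carrier := VR P\<rparr>)"
  proof (rule ring.subfield_iff(1)[OF V_ring[OF valuation_ring_VR[OF P]]])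
    show "field (F\<lparr>carrier := VR P, carrier := K\<rparr>)" using subfield_iff(2)[OF subfield_K] by simp
  qed (use V_K[OF valuation_ring_VR[OF P]] in simp)
  then have sf: "subfield ?K ?k" using h.img_is_subfield k.one_not_zero by blast
  have "carrier ?k = residue F K P ` VR P" by (rule residue_field_facts(3))
  have "subalgebra ?K (carrier ?k) ?k"
    using k.carrier_is_subalgebra subfieldE(3)[OF sf] by blast
  moreover have "finite (carrier ?k)" using pos c card_gt_0_iff by metis
  ultimately have "card (carrier ?k) = card ?K ^ k.dim ?K (carrier ?k)"
    using k.card_eq_power_dim[OF sf] finite_K by blast
  moreover have "card ?K = Q" using card_image[OF inj_residue_K] .
  ultimately show "idx (VR P) P = Q ^ place_degree F K P" using c by (simp add: place_degree_def)
qed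

text \<open>Degree 0 would leave a single residue class, putting 1 into the place. Positivity makes
  each zero count in a bound on the degree of zeros.\<close>

lemma place_degree_pos: "place_degree F K P > 0"
proof (rule ccontr)
  assume "\<not> ?thesis"
  then have "idx (VR P) P = 1" using card_residue_field by simp
  then have "VR P \<subseteq> P"
    using add.index_in_eq_1D[OF pw_subgroup[of 0] pw_subgroup[of 1]] pw_0 pw_1 by simp
  then show False
    using V_simps(2)[OF valuation_ring_VR[OF P]] one_notin_nonunits[OF valuation_ring_VR[OF P]] place_facts(3)[OF P] by blast
qed

end
end

section \<open>Weak approximation and adeles\<close>

context finite_function_field begin

lemma nat_pow_nonzero [simp]: "z \<in> carrier F \<Longrightarrow> z \<noteq> \<zero> \<Longrightarrow> z [^] (m::nat) \<noteq> \<zero>"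
  by (induction m) auto

lemma v_nat_pow:
  assumes "P \<in> Pl" "z \<in> carrier F" "z \<noteq> \<zero>"
  shows "v P (z [^] (m::nat)) = int m * v P z"
  by (induction m) (simp_all add: v_one v_mult assms algebra_simps)

text \<open>A discrete valuation ring is a maximal proper subring: from an inclusion, an element
  \<open>z\<close> of the larger ring with a pole at \<open>P\<close>, multiplied by a uniformizer
  of \<open>P'\<close>, leads to a contradiction.\<close>

lemma place_rings_incomparable:
  assumes P: "P \<in> Pl" and P': "P' \<in> Pl" and "P \<noteq> P'"
  shows "\<exists>z \<in> carrier F. z \<noteq> \<zero> \<and> v P z \<ge> 0 \<and> v P' z < 0"
proof -
  have "\<not> VR P \<subseteq> VR P'"
  proof
    assume sub: "VR P \<subseteq> VR P'"
    obtain y where y: "y \<in> carrier F" "y \<noteq> \<zero>" "v P' y = 1" using exists_v_eq[OF P'] by blast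
    have "VR P' \<subseteq> VR P"
    proof
      fix z assume z: "z \<in> VR P'"
      show "z \<in> VR P"
      proof (cases "z = \<zero>")
        case True
        then show ?thesis using V_simps(1)[OF place_facts(2)[OF P]] by simp
      next
        case False
        have zc: "z \<in> carrier F" using z VR_subset_carrier[OF P'] by blast
        \<comment> \<open>Chosen so that the pole of \<open>z ^ m\<close> at \<open>P\<close>
          outweighs the value of \<open>y\<close> there, while at \<open>P'\<close> the product
          keeps value at least 1.\<close>
        define m where "m = nat (v P y)"
        have "\<not> v P z < 0"
        proof
          assume neg: "v P z < 0"
          let ?w = "y \<otimes> z [^] m"
          have w: "?w \<in> carrier F" "?w \<noteq> \<zero>" using y zc False by auto
          have "v P ?w = v P y + int m * v P z" using y zc False by (simp add: v_mult[OF P] v_nat_pow[OF P])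
          moreover have "int m * v P z \<le> int m * (-1)" using neg by (intro mult_left_mono) auto
          ultimately have "v P ?w \<le> 0" unfolding m_def by (cases "v P y \<ge> 0") auto
          then have "inv ?w \<in> VR P" using w v_mem_iff(1)[OF P, of "inv ?w"] v_inv[OF P, of ?w] by simp
          then have "v P' (inv ?w) \<ge> 0" using sub w v_mem_iff(1)[OF P', of "inv ?w"] by auto
          then have "v P' ?w \<le> 0" using w by (simp add: v_inv[OF P'])
          moreover have "v P' ?w = 1 + int m * v P' z" using y zc False by (simp add: v_mult[OF P'] v_nat_pow[OF P'])
          moreover have "v P' z \<ge> 0" using z zc False v_mem_iff(1)[OF P'] by blast
          moreover have "int m * v P' z \<ge> 0" using calculation(3) by simp
          ultimately show False by linarith
        qed
        then show ?thesis using v_mem_iff(1)[OF P zc False] by simp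
      qed
    qed
    then have "VR P = VR P'" using sub by blast
    then show False using place_facts(3)[OF P] place_facts(3)[OF P'] \<open>P \<noteq> P'\<close> by simp
  qed
  then obtain z where z: "z \<in> VR P" "z \<notin> VR P'" by blast
  then have "z \<in> carrier F" "z \<noteq> \<zero>"
    using VR_subset_carrier[OF P] V_simps(1)[OF place_facts(2)[OF P']] by auto
  then show ?thesis
    using z v_mem_iff(1)[OF P, of z] v_mem_iff(1)[OF P', of z] by (intro bexI[of _ z]) auto
qed

lemma separating_two:
  assumes P: "P \<in> Pl" and P': "P' \<in> Pl" and "P \<noteq> P'"
  shows "\<exists>u \<in> carrier F. u \<noteq> \<zero> \<and> v P u > 0 \<and> v P' u < 0"
proof -
  obtain z where z: "z \<in> carrier F" "z \<noteq> \<zero>" "v P z \<ge> 0" "v P' z < 0"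
    using place_rings_incomparable[OF assms] by blast
  obtain w where w: "w \<in> carrier F" "w \<noteq> \<zero>" "v P' w \<ge> 0" "v P w < 0"
    using place_rings_incomparable[OF P' P] assms(3) by blast
  then show ?thesis using z P P'
    by (intro bexI[of _ "z \<otimes> inv w"]) (auto simp: v_mult v_inv)
qed

text \<open>To a function with poles on \<open>S\<close>, a power of one with a pole at the new
  place is added. The exponent is chosen so that the two summands have different values at every
  prescribed pole, which excludes cancellation.\<close>

lemma separating:
  assumes "finite S" "S \<subseteq> Pl" "P \<in> Pl" "P \<notin> S"
  shows "\<exists>u \<in> carrier F. u \<noteq> \<zero> \<and> v P u > 0 \<and> (\<forall>Q \<in> S. v Q u < 0)"
  using assms
proof (induction S rule: finite_induct)
  case empty
  then show ?case using exists_v_eq[of P 1] by auto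
next
  case (insert Q S)
  obtain u where u: "u \<in> carrier F" "u \<noteq> \<zero>" "v P u > 0" "\<And>R. R \<in> S \<Longrightarrow> v R u < 0"
    using insert by auto
  obtain y where y: "y \<in> carrier F" "y \<noteq> \<zero>" "v P y > 0" "v Q y < 0"
    using separating_two[of P Q] insert by auto
  \<comment> \<open>Each place excludes at most one exponent: both values cannot vanish, since
    \<open>u\<close> has a pole at each place of \<open>S\<close> and \<open>y\<close> has one at
    \<open>Q\<close>.\<close>
  have fin: "finite {r::nat. v R u = int r * v R y}" if "R \<in> insert Q S" for R
  proof (cases "v R y = 0")
    case True
    then show ?thesis using that u(4)[of R] y(4) by auto
  next
    case False
    then have "inj_on (\<lambda>r::nat. int r * v R y) UNIV" by (auto simp: inj_on_def)
    then show ?thesis using finite_vimageI[of "{v R u}" "\<lambda>r::nat. int r * v R y"] by (simp add: vimage_def eq_commute)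
  qed
  have "finite ({0} \<union> (\<Union>R\<in>insert Q S. {r::nat. v R u = int r * v R y}))"
    using fin insert.hyps(1) by blast
  then obtain r :: nat where r: "r \<notin> {0} \<union> (\<Union>R\<in>insert Q S. {r::nat. v R u = int r * v R y})"
    using ex_new_if_finite[OF infinite_UNIV_nat] by blast
  let ?z = "u \<oplus> y [^] r"
  have yr: "y [^] r \<in> carrier F" "y [^] r \<noteq> \<zero>" using y by auto
  have vR: "?z \<noteq> \<zero> \<and> v R ?z \<le> v R u \<and> v R ?z \<le> v R (y [^] r)" if R: "R \<in> insert Q S" for R
  proof -
    have RP: "R \<in> Pl" using R insert.prems by auto
    have "v R u \<noteq> v R (y [^] r)" using r R v_nat_pow[OF RP y(1,2), of r] by auto
    then consider "v R u < v R (y [^] r)" | "v R (y [^] r) < v R u" by linarith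
    then show ?thesis
    proof cases
      case 1
      then show ?thesis using v_add_distinct[OF RP u(1,2) yr] by simp
    next
      case 2
      then show ?thesis using v_add_distinct[OF RP yr u(1,2)] a_comm[of u "y [^] r"] u yr by simp
    qed
  qed
  have zc: "?z \<in> carrier F" using u yr by simp
  have "v Q (y [^] r) < 0" using v_nat_pow[of Q y r] y r insert.prems by (simp add: mult_pos_neg)
  then have "v Q ?z < 0" "?z \<noteq> \<zero>" using vR[of Q] by auto
  moreover have "v R ?z < 0" if "R \<in> S" for R using vR[of R] u(4)[OF that] that by auto
  moreover have "v P ?z > 0"
  proof -
    have "int r * v P y \<ge> 1 * 1" using y(3) r by (intro mult_mono) auto
    then have "?z \<in> pw P 1"
      using u yr y insert.prems by (intro pw_add) (auto simp: pw_iff v_nat_pow)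
    then show ?thesis using zc \<open>?z \<noteq> \<zero>\<close> by (simp add: pw_iff)
  qed
  ultimately show ?case using zc by (intro bexI[of _ ?z]) auto
qed

text \<open>The function is 1 / (1 + u ^ s): a power of \<open>u\<close> is small at
  \<open>P\<close>, where the quotient is near 1, and large on \<open>S\<close>, where the quotient
  is near 0.\<close>

lemma approximate_one:
  assumes S: "finite S" "S \<subseteq> Pl" "P \<in> Pl" "P \<notin> S"
  shows "\<exists>w \<in> carrier F. w \<ominus> \<one> \<in> pw P N \<and> (\<forall>Q \<in> S. w \<in> pw Q N)"
proof -
  obtain u where u: "u \<in> carrier F" "u \<noteq> \<zero>" "v P u > 0" "\<And>R. R \<in> S \<Longrightarrow> v R u < 0"
    using separating[OF assms] by blast
  \<comment> \<open>The lower bound 1 keeps the value of \<open>u ^ s\<close> different from that of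
    1 even if \<open>N\<close> is not positive.\<close>
  define s where "s = nat (max N 1)"
  have s: "int s \<ge> N" "s \<ge> 1" by (auto simp: s_def)
  let ?a = "\<one> \<oplus> u [^] s"
  have us: "u [^] s \<in> carrier F" "u [^] s \<noteq> \<zero>" using u by auto
  have vP: "v P (u [^] s) \<ge> int s"
    using u mult_left_mono[of 1 "v P u" "int s"] by (simp add: v_nat_pow[OF S(3)])
  then have a: "?a \<noteq> \<zero>" "v P ?a = 0"
    using v_add_distinct[OF S(3), of \<one> "u [^] s"] us s v_one[OF S(3)] by auto
  have ac: "?a \<in> carrier F" using us by simp
  have "inv ?a \<ominus> \<one> \<in> pw P N"
  proof -
    have "inv ?a \<otimes> ?a = \<one>" using a ac by simp
    then have "inv ?a \<ominus> \<one> = inv ?a \<ominus> inv ?a \<otimes> (\<one> \<oplus> u [^] s)" by simp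
    also have "\<dots> = inv ?a \<otimes> (\<ominus> (u [^] s))"
    proof -
      have "inv ?a \<in> carrier F" using a ac by simp
      then show ?thesis using us(1) by algebra
    qed
    finally have eq: "inv ?a \<ominus> \<one> = inv ?a \<otimes> (\<ominus> (u [^] s))" .
    have "u [^] s \<in> pw P N" using vP s us by (simp add: pw_iff)
    moreover have "inv ?a \<in> pw P 0" using a ac by (simp add: pw_iff v_inv[OF S(3)])
    ultimately show ?thesis using pw_mult[OF S(3), of "inv ?a" 0 _ N] pw_uminus[OF S(3)] unfolding eq by simp
  qed
  moreover have "inv ?a \<in> pw Q N" if Q: "Q \<in> S" for Q
  proof -
    have QP: "Q \<in> Pl" using Q S by auto
    have "int s * v Q u \<le> int s * (-1)" using u(4)[OF Q] by (intro mult_left_mono) auto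
    then have vq: "v Q (u [^] s) \<le> - int s" using u by (simp add: v_nat_pow[OF QP])
    then have "v Q ?a = v Q (u [^] s)"
      using v_add_distinct[OF QP us, of \<one>] s v_one[OF QP] us a_comm[of \<one> "u [^] s"] by simp
    then show ?thesis using a ac s vq by (simp add: pw_iff v_inv[OF QP])
  qed
  ultimately show ?thesis using a ac by (intro bexI[of _ "inv ?a"]) auto
qed

theorem weak_approximation:
  assumes "finite S" "S \<subseteq> Pl" "\<And>P. P \<in> S \<Longrightarrow> \<alpha> P \<in> carrier F"
  shows "\<exists>f \<in> carrier F. \<forall>P \<in> S. f \<ominus> \<alpha> P \<in> pw P (E P)"
  using assms
proof (induction S rule: finite_induct)
  case empty
  then show ?case by auto
next
  case (insert Q S)
  obtain f where f: "f \<in> carrier F" "\<And>P. P \<in> S \<Longrightarrow> f \<ominus> \<alpha> P \<in> pw P (E P)"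
    using insert by auto
  have aQ: "\<alpha> Q \<in> carrier F" using insert.prems by simp
  define c where "c = \<alpha> Q \<ominus> f"
  have defect: "c \<in> carrier F" using f aQ by (simp add: c_def)
  show ?case
  proof (cases "c = \<zero>")
    case True
    then have "f \<ominus> \<alpha> Q = \<zero>" using f aQ by (simp add: c_def)
    then show ?thesis using f by (intro bexI[of _ f]) auto
  next
    case False
    \<comment> \<open>The correction \<open>c \<otimes> w\<close> has to be accurate to order
      \<open>E R\<close>, so the accuracy of \<open>w\<close> must make up for the value of
      \<open>c\<close>, which may be a pole.\<close>
    define N where "N = Max ((\<lambda>R. E R - v R c) ` insert Q S)"
    have N: "E R \<le> N + v R c" if "R \<in> insert Q S" for R
    proof -
      have "E R - v R c \<le> N" unfolding N_def using insert.hyps(1) that by (intro Max_ge) blast+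
      then show ?thesis by simp
    qed
    obtain w where w: "w \<in> carrier F" "w \<ominus> \<one> \<in> pw Q N" "\<And>R. R \<in> S \<Longrightarrow> w \<in> pw R N"
      using approximate_one[of S Q N] insert by auto
    have small: "c \<otimes> z \<in> pw R (E R)" if R: "R \<in> insert Q S" and z: "z \<in> pw R N" for R z
    proof -
      have RP: "R \<in> Pl" using R insert.prems by auto
      have "c \<otimes> z \<in> pw R (v R c + N)" using pw_mult[OF RP, of c "v R c" z N] z defect False by (simp add: pw_iff)
      then show ?thesis using pw_mono N[OF R] by (simp add: add.commute)
    qed
    have "f \<oplus> c \<otimes> w \<ominus> \<alpha> Q = c \<otimes> (w \<ominus> \<one>)"
      unfolding c_def using f(1) aQ w(1) by algebra
    then have "f \<oplus> c \<otimes> w \<ominus> \<alpha> Q \<in> pw Q (E Q)" using small[of Q] w by simp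
    moreover have "f \<oplus> c \<otimes> w \<ominus> \<alpha> R \<in> pw R (E R)" if R: "R \<in> S" for R
    proof -
      have aR: "\<alpha> R \<in> carrier F" using R insert.prems by simp
      have "f \<oplus> c \<otimes> w \<ominus> \<alpha> R = (f \<ominus> \<alpha> R) \<oplus> c \<otimes> w" using f(1) aR w(1) defect by algebra
      then show ?thesis using f(2)[OF R] small[of R w] w(3)[OF R] R pw_add[of R] insert.prems by auto
    qed
    ultimately show ?thesis using f defect w by (intro bexI[of _ "f \<oplus> c \<otimes> w"]) auto
  qed
qed

text \<open>Families are indexed by all sets, but only the components at places matter.  Likewise divisors are
  functions \<open>E\<close> of which only the values at places matter.\<close>

definition AA :: "('a set \<Rightarrow> 'a) monoid" where
  "AA = \<lparr>carrier = {\<alpha>. \<forall>P. \<alpha> P \<in> carrier F}, monoid.mult = (\<lambda>\<alpha> \<beta> P. \<alpha> P \<oplus> \<beta> P), one = (\<lambda>P. \<zero>)\<rparr>"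

lemma AA_simps [simp]: "\<alpha> \<in> carrier AA \<longleftrightarrow> (\<forall>P. \<alpha> P \<in> carrier F)"
  "\<alpha> \<otimes>\<^bsub>AA\<^esub> \<beta> = (\<lambda>P. \<alpha> P \<oplus> \<beta> P)" "\<one>\<^bsub>AA\<^esub> = (\<lambda>P. \<zero>)"
  by (simp_all add: AA_def)

lemma AA_comm_group: "comm_group AA"
proof (rule comm_groupI)
  fix \<alpha> assume "\<alpha> \<in> carrier AA"
  then show "\<exists>\<beta>\<in>carrier AA. \<beta> \<otimes>\<^bsub>AA\<^esub> \<alpha> = \<one>\<^bsub>AA\<^esub>"
    by (intro bexI[of _ "\<lambda>P. \<ominus> \<alpha> P"]) (auto simp: l_neg)
qed (auto simp: a_ac)

sublocale AA: comm_group AA by (rule AA_comm_group)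

lemma AA_inv: "\<alpha> \<in> carrier AA \<Longrightarrow> inv\<^bsub>AA\<^esub> \<alpha> = (\<lambda>P. \<ominus> \<alpha> P)"
  by (rule AA.inv_equality) (auto simp: l_neg)

text \<open>\<open>E P\<close> bounds the order of a pole, hence the sign. For \<open>S\<close> the
  set of all places this gives the adeles bounded by a divisor; a finite \<open>S\<close> serves to
  bound the zeros of a function before they are known to be finite in number.\<close>

definition AS :: "'a set set \<Rightarrow> ('a set \<Rightarrow> int) \<Rightarrow> ('a set \<Rightarrow> 'a) set" where
  "AS S E = {\<alpha> \<in> carrier AA. \<forall>P \<in> S. \<alpha> P \<in> pw P (- E P)}"

definition diag :: "'a set \<Rightarrow> ('a set \<Rightarrow> 'a) set" where
  "diag A = (\<lambda>f P. f) ` A"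

definition LS :: "'a set set \<Rightarrow> ('a set \<Rightarrow> int) \<Rightarrow> 'a set" where
  "LS S E = {f \<in> carrier F. \<forall>P \<in> S. f \<in> pw P (- E P)}"

lemma subgroup_AS: "S \<subseteq> Pl \<Longrightarrow> subgroup (AS S E) AA"
proof (rule AA.subgroupI)
  show "AS S E \<noteq> {}" by (auto simp: AS_def intro!: exI[of _ "\<lambda>P. \<zero>"])
qed (auto simp: AS_def AA_inv intro: pw_uminus pw_add)

lemma subgroup_LS: "S \<subseteq> Pl \<Longrightarrow> subgroup (LS S E) (add_monoid F)"
proof (rule add.subgroupI)
  show "LS S E \<noteq> {}" by (auto simp: LS_def intro!: exI[of _ "\<zero>"])
qed (auto simp: LS_def intro: pw_uminus pw_add)

lemma subgroup_diag: "subgroup A (add_monoid F) \<Longrightarrow> subgroup (diag A) AA"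
proof (rule AA.subgroupI)
  assume A: "subgroup A (add_monoid F)"
  note c = add_subgroup_closed[OF A]
  show "diag A \<subseteq> carrier AA" "diag A \<noteq> {}" using c by (auto simp: diag_def)
  fix a assume "a \<in> diag A"
  then obtain x where x: "a = (\<lambda>P. x)" "x \<in> A" by (auto simp: diag_def)
  then have "inv\<^bsub>AA\<^esub> a = (\<lambda>P. \<ominus> x)" using AA_inv[of a] c by auto
  then show "inv\<^bsub>AA\<^esub> a \<in> diag A" using c(4) x by (auto simp: diag_def)
  fix b assume "b \<in> diag A"
  then obtain y where y: "b = (\<lambda>P. y)" "y \<in> A" by (auto simp: diag_def)
  then show "a \<otimes>\<^bsub>AA\<^esub> b \<in> diag A" using c(3) x by (auto simp: diag_def)
qed

lemma AS_Int_diag: "AS S E \<inter> diag (carrier F) = diag (LS S E)"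
  by (auto simp: AS_def diag_def LS_def)

lemma index_diag:
  assumes A: "subgroup A (add_monoid F)" and B: "subgroup B (add_monoid F)"
  shows "index_in AA (diag A) (diag B) = idx A B"
  unfolding index_in_def
proof (rule card_image_transfer[symmetric, where f = "\<lambda>f P. f"])
  note cA = add_subgroup_closed[OF A]
  fix f g assume fg: "f \<in> A" "g \<in> A"
  then have c: "f \<in> carrier F" "g \<in> carrier F" using cA by auto
  have "(\<lambda>P. f) \<otimes>\<^bsub>AA\<^esub> inv\<^bsub>AA\<^esub> (\<lambda>P. g) = (\<lambda>P. f \<oplus> \<ominus> g)" using c AA_inv[of "\<lambda>P. g"] by simp
  moreover have "(\<lambda>P. f \<oplus> \<ominus> g) \<in> diag B \<longleftrightarrow> f \<oplus> \<ominus> g \<in> B" by (auto simp: diag_def dest: fun_cong)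
  ultimately show "B #>\<^bsub>add_monoid F\<^esub> f = B #>\<^bsub>add_monoid F\<^esub> g \<longleftrightarrow>
      diag B #>\<^bsub>AA\<^esub> (\<lambda>P. f) = diag B #>\<^bsub>AA\<^esub> (\<lambda>P. g)"
    using add.r_coset_eq_iff[OF B c] AA.r_coset_eq_iff[OF subgroup_diag[OF B], of "\<lambda>P. f" "\<lambda>P. g"] c by simp
qed (auto simp: diag_def)

lemma AS_mono: "(\<And>P. P \<in> S \<Longrightarrow> E P \<le> E' P) \<Longrightarrow> AS S E \<subseteq> AS S E'"
  by (auto simp: AS_def intro: pw_mono)

lemma AS_cong: "(\<And>P. P \<in> S \<Longrightarrow> E P = E' P) \<Longrightarrow> AS S E = AS S E'"
  by (auto simp: AS_def)

text \<open>Projection to the component at \<open>P\<close> identifies the quotient with one graded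
  piece of the filtration there.\<close>

lemma index_AS_step:
  assumes S: "S \<subseteq> Pl" and P: "P \<in> S"
  shows "index_in AA (AS S (E(P := E P + 1))) (AS S E) = Q ^ place_degree F K P"
proof -
  have PP: "P \<in> Pl" using assms by auto
  have "index_in AA (AS S (E(P := E P + 1))) (AS S E) = idx (pw P (- E P - 1)) (pw P (- E P))"
    unfolding index_in_def
  proof (rule card_image_transfer[where f = "\<lambda>\<alpha>. \<alpha> P"])
    fix \<alpha> \<beta> assume ab: "\<alpha> \<in> AS S (E(P := E P + 1))" "\<beta> \<in> AS S (E(P := E P + 1))"
    then have c: "\<alpha> \<in> carrier AA" "\<beta> \<in> carrier AA" by (auto simp: AS_def)
    have "\<alpha> R \<oplus> \<ominus> \<beta> R \<in> pw R (- E R)" if R: "R \<in> S" "R \<noteq> P" for R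
    proof -
      have "\<gamma> R \<in> pw R (- E R)" if "\<gamma> \<in> AS S (E(P := E P + 1))" for \<gamma>
      proof -
        have "\<gamma> R \<in> pw R (- (E(P := E P + 1)) R)" using that R(1) unfolding AS_def by blast
        then show ?thesis using R(2) by simp
      qed
      then show ?thesis using ab R S by (intro pw_add pw_uminus) auto
    qed
    then have "\<alpha> \<otimes>\<^bsub>AA\<^esub> inv\<^bsub>AA\<^esub> \<beta> \<in> AS S E \<longleftrightarrow> \<alpha> P \<oplus> \<ominus> \<beta> P \<in> pw P (- E P)"
      using c P AA_inv[OF c(2)] by (auto simp: AS_def)
    then show "AS S E #>\<^bsub>AA\<^esub> \<alpha> = AS S E #>\<^bsub>AA\<^esub> \<beta> \<longleftrightarrow>
        pw P (- E P) #>\<^bsub>add_monoid F\<^esub> \<alpha> P = pw P (- E P) #>\<^bsub>add_monoid F\<^esub> \<beta> P"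
      using AA.r_coset_eq_iff[OF subgroup_AS[OF S] c] add.r_coset_eq_iff[OF pw_subgroup[OF PP], of "\<alpha> P" "\<beta> P"] c
      by simp
  next
    fix \<alpha> assume "\<alpha> \<in> AS S (E(P := E P + 1))"
    then show "\<alpha> P \<in> pw P (- E P - 1)" using P by (auto simp: AS_def dest: bspec[of S _ P])
  next
    fix z assume z: "z \<in> pw P (- E P - 1)"
    then have "(\<lambda>R. if R = P then z else \<zero>) \<in> AS S (E(P := E P + 1))"
      using pw_closed[OF z] by (auto simp: AS_def)
    then show "\<exists>\<alpha>\<in>AS S (E(P := E P + 1)). pw P (- E P) #>\<^bsub>add_monoid F\<^esub> \<alpha> P = pw P (- E P) #>\<^bsub>add_monoid F\<^esub> z"
      by (rule bexI[rotated]) simp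
  qed
  also have "\<dots> = Q ^ place_degree F K P"
    using idx_pw_Suc[OF PP, of "- E P - 1"] card_residue_field(1)[OF PP] by simp
  finally show ?thesis .
qed

lemma index_AS:
  assumes S: "S \<subseteq> Pl" and T: "finite T" "T \<subseteq> S"
    and E: "\<And>P. P \<in> S \<Longrightarrow> E P \<le> E' P" "\<And>P. P \<in> S - T \<Longrightarrow> E P = E' P"
  shows "index_in AA (AS S E') (AS S E) = Q ^ (\<Sum>P\<in>T. nat (E' P - E P) * place_degree F K P)"
  using E
proof (induction "\<Sum>P\<in>T. nat (E' P - E P)" arbitrary: E')
  case 0
  then have "E P = E' P" if "P \<in> S" for P
    using T that by (cases "P \<in> T") (fastforce)+
  then have "AS S E' = AS S E" by (intro AS_cong) simp
  then show ?case using 0 T AA.index_in_self[OF subgroup_AS[OF S]] by simp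
next
  case (Suc m)
  have "\<exists>P\<in>T. nat (E' P - E P) \<noteq> 0"
  proof (rule ccontr)
    assume "\<not> ?thesis"
    then have "(\<Sum>P\<in>T. nat (E' P - E P)) = 0" by (intro sum.neutral) blast
    then show False using Suc.hyps(2) by linarith
  qed
  then obtain P where P: "P \<in> T" "E' P > E P" by (metis diff_gt_0_iff_gt nat_0_iff not_less)
  define E'' where "E'' = E'(P := E' P - 1)"
  have E'': "E' = E''(P := E'' P + 1)" by (simp add: E''_def)
  have PS: "P \<in> S" using P T by auto
  have TP: "T = insert P (T - {P})" "finite (T - {P})" "P \<notin> T - {P}" using P T by auto
  have rest: "(\<Sum>R\<in>T - {P}. f (E'' R) R) = (\<Sum>R\<in>T - {P}. f (E' R) R)" for f :: "int \<Rightarrow> 'a set \<Rightarrow> nat"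
    by (intro sum.cong) (auto simp: E''_def)
  have sums: "(\<Sum>R\<in>T. f (E'' R) R) = f (E' P - 1) P + (\<Sum>R\<in>T - {P}. f (E' R) R)"
    "(\<Sum>R\<in>T. f (E' R) R) = f (E' P) P + (\<Sum>R\<in>T - {P}. f (E' R) R)" for f :: "int \<Rightarrow> 'a set \<Rightarrow> nat"
    using sum.insert[OF TP(2,3), of "\<lambda>R. f (E'' R) R"] sum.insert[OF TP(2,3), of "\<lambda>R. f (E' R) R"] TP(1) rest
    by (simp_all add: E''_def)
  have n1: "nat (E' P - E P) = Suc (nat (E' P - 1 - E P))" using P by linarith
  have "m = (\<Sum>R\<in>T. nat (E'' R - E R))"
    using Suc.hyps(2) sums(1)[of "\<lambda>e R. nat (e - E R)"] sums(2)[of "\<lambda>e R. nat (e - E R)"] n1 by linarith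
  moreover have le: "\<And>R. R \<in> S \<Longrightarrow> E R \<le> E'' R" "\<And>R. R \<in> S - T \<Longrightarrow> E R = E'' R"
    using Suc.prems P by (auto simp: E''_def)
  ultimately have IH: "index_in AA (AS S E'') (AS S E) = Q ^ (\<Sum>R\<in>T. nat (E'' R - E R) * place_degree F K R)"
    using Suc.hyps(1) by blast
  have "index_in AA (AS S E') (AS S E) = index_in AA (AS S E') (AS S E'') * index_in AA (AS S E'') (AS S E)"
  proof (rule AA.index_in_tower[OF subgroup_AS[OF S] subgroup_AS[OF S] subgroup_AS[OF S]])
    show "AS S E \<subseteq> AS S E''" using le(1) by (rule AS_mono)
    show "AS S E'' \<subseteq> AS S E'" by (rule AS_mono) (simp add: E''_def)
  qed
  also have "index_in AA (AS S E') (AS S E'') = Q ^ place_degree F K P"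
    using index_AS_step[OF S PS, of E''] E'' by simp
  finally have *: "index_in AA (AS S E') (AS S E) =
      Q ^ place_degree F K P * Q ^ (\<Sum>R\<in>T. nat (E'' R - E R) * place_degree F K R)"
    using IH by simp
  have "(\<Sum>R\<in>T. nat (E' R - E R) * place_degree F K R) =
      place_degree F K P + (\<Sum>R\<in>T. nat (E'' R - E R) * place_degree F K R)"
    using sums(1)[of "\<lambda>e R. nat (e - E R) * place_degree F K R"]
      sums(2)[of "\<lambda>e R. nat (e - E R) * place_degree F K R"] n1 by simp
  then show ?case using * by (simp add: power_add)
qed

end

section \<open>Zeros of functions and existence of places\<close>

context finite_function_field begin

text \<open>Weak approximation in the language of subgroups, for a finite set of places. For all
  places at once the analogous sum can be proper in \<open>adele_ring\<close>, and its index there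
  is what the defect measures.\<close>

lemma AS_diag_UNIV:
  assumes "finite S" "S \<subseteq> Pl"
  shows "AS S E <#>\<^bsub>AA\<^esub> diag (carrier F) = carrier AA"
proof
  show "AS S E <#>\<^bsub>AA\<^esub> diag (carrier F) \<subseteq> carrier AA"
    by (auto simp: set_mult_def AS_def diag_def)
  show "carrier AA \<subseteq> AS S E <#>\<^bsub>AA\<^esub> diag (carrier F)"
  proof
    fix \<alpha> assume a: "\<alpha> \<in> carrier AA"
    then obtain f where f: "f \<in> carrier F" "\<And>P. P \<in> S \<Longrightarrow> f \<ominus> \<alpha> P \<in> pw P (- E P)"
      using weak_approximation[OF assms, of \<alpha> "\<lambda>P. - E P"] by auto
    let ?b = "\<lambda>P. \<ominus> (f \<ominus> \<alpha> P)"
    have "?b \<in> AS S E" using f a assms by (auto simp: AS_def intro!: pw_uminus)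
    moreover have "\<alpha> = ?b \<otimes>\<^bsub>AA\<^esub> (\<lambda>P. f)"
    proof
      fix P have "\<alpha> P \<in> carrier F" using a by simp
      then show "\<alpha> P = (?b \<otimes>\<^bsub>AA\<^esub> (\<lambda>P. f)) P" using f(1) by simp algebra
    qed
    ultimately show "\<alpha> \<in> AS S E <#>\<^bsub>AA\<^esub> diag (carrier F)"
      using f(1) unfolding set_mult_def diag_def by blast
  qed
qed

lemma subgroup_carrier: "subgroup (carrier F) (add_monoid F)"
  using add.subgroup_self by simp

text \<open>The modular law with the diagonal as third subgroup: the growth of the local conditions
  splits into the growth of the functions satisfying them and a change of the cokernel.\<close>

lemma index_AS_LS:
  assumes S: "S \<subseteq> Pl" and le: "\<And>P. P \<in> S \<Longrightarrow> E P \<le> E' P"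
  shows "index_in AA (AS S E') (AS S E) =
    index_in AA (AS S E' <#>\<^bsub>AA\<^esub> diag (carrier F)) (AS S E <#>\<^bsub>AA\<^esub> diag (carrier F)) * idx (LS S E') (LS S E)"
  using AA.index_in_modular[OF subgroup_AS[OF S] subgroup_AS[OF S] subgroup_diag[OF subgroup_carrier] AS_mono[OF le]]
    AS_Int_diag index_diag[OF subgroup_LS[OF S] subgroup_LS[OF S]] by simp

text \<open>Let R be the ring of functions integral on \<open>S\<close>. By approximation the index
  of y R in R is \<open>Q\<close> to the sum on the left, and the bound for arbitrary subrings
  applies to R.\<close>

lemma degree_of_zeros_le:
  assumes y: "y \<in> carrier F" "y \<noteq> \<zero>" and g: "growth y d h"
    and S: "finite S" "S \<subseteq> Pl" "\<And>P. P \<in> S \<Longrightarrow> v P y \<ge> 0"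
  shows "(\<Sum>P\<in>S. nat (v P y) * place_degree F K P) \<le> n * d"
proof -
  let ?R = "LS S (\<lambda>P. 0)" and ?E = "\<lambda>P. - v P y"
  have R: "subring ?R F"
  proof (rule subringI)
    show "\<one> \<in> ?R" using S(2) by (auto simp: LS_def pw_iff v_one)
  qed (use S(2) in \<open>auto simp: LS_def intro!: pw_uminus pw_add\<close>, metis add.right_neutral pw_mult subset_iff)
  have eq: "(\<lambda>r. y \<otimes> r) ` ?R = LS S ?E"
  proof (intro equalityI subsetI)
    fix z assume "z \<in> (\<lambda>r. y \<otimes> r) ` ?R"
    then obtain r where r: "z = y \<otimes> r" "r \<in> carrier F" "\<And>P. P \<in> S \<Longrightarrow> r \<in> pw P 0" by (auto simp: LS_def)
    have "z \<in> pw P (v P y)" if P: "P \<in> S" for P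
      using pw_mult[of P y "v P y" r 0] r P y S by (auto simp: pw_iff)
    then show "z \<in> LS S ?E" using r y by (auto simp: LS_def)
  next
    fix z assume "z \<in> LS S ?E"
    then have z: "z \<in> carrier F" "\<And>P. P \<in> S \<Longrightarrow> z \<in> pw P (v P y)" by (auto simp: LS_def)
    have "inv y \<otimes> z \<in> pw P 0" if P: "P \<in> S" for P
      using pw_mult[of P "inv y" "- v P y" z "v P y"] z P y S by (auto simp: pw_iff v_inv)
    then have "inv y \<otimes> z \<in> ?R" using y z by (auto simp: LS_def)
    moreover have "z = y \<otimes> (inv y \<otimes> z)" using y z by (simp add: m_assoc[symmetric])
    ultimately show "z \<in> (\<lambda>r. y \<otimes> r) ` ?R" by blast
  qed
  have yR: "y \<in> ?R" using y S by (auto simp: LS_def pw_iff)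
  \<comment> \<open>By approximation both sums with the diagonal are the whole group, so the
    cokernel factor in \<open>index_AS_LS\<close> is 1.\<close>
  have "index_in AA (carrier AA) (carrier AA) = 1" by (rule AA.index_in_self[OF AA.subgroup_self])
  then have "index_in AA (AS S (\<lambda>P. 0)) (AS S ?E) = idx ?R (LS S ?E)"
    using index_AS_LS[of S ?E "\<lambda>P. 0"] S AS_diag_UNIV[OF S(1,2)] by simp
  also have "\<dots> \<le> Q ^ (n * d)"
    using index_multiple_bound(2)[OF R yR y(2) g] eq by simp
  finally have "Q ^ (\<Sum>P\<in>S. nat (0 - ?E P) * place_degree F K P) \<le> Q ^ (n * d)"
    using index_AS[of S S ?E "\<lambda>P. 0"] S by simp
  then show ?thesis using Q_ge_2 by simp
qed

lemma finite_zeros: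
  assumes y: "y \<in> carrier F" "y \<noteq> \<zero>"
  shows "finite {P \<in> Pl. v P y > 0}"
proof -
  obtain d h where g: "growth y d h" using growth_exists[OF y(1)] .
  have "card S \<le> n * d" if S: "finite S" "S \<subseteq> {P \<in> Pl. v P y > 0}" for S
  proof -
    have "(\<Sum>P\<in>S. 1) \<le> (\<Sum>P\<in>S. nat (v P y) * place_degree F K P)"
    proof (rule sum_mono)
      fix P assume "P \<in> S"
      then have "nat (v P y) \<ge> 1" "place_degree F K P \<ge> 1" using S place_degree_pos[of P] by fastforce+
      then show "1 \<le> nat (v P y) * place_degree F K P" using mult_le_mono[of 1 _ 1] by simp
    qed
    also have "\<dots> \<le> n * d" by (rule degree_of_zeros_le[OF y g S(1)]) (use S in force)+
    finally show ?thesis by simp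
  qed
  then show ?thesis by (metis (no_types, lifting) finite_if_finite_subsets_card_bdd)
qed

lemma finite_support:
  assumes y: "y \<in> carrier F" "y \<noteq> \<zero>"
  shows "finite {P \<in> Pl. v P y \<noteq> 0}"
proof -
  have "{P \<in> Pl. v P y \<noteq> 0} \<subseteq> {P \<in> Pl. v P y > 0} \<union> {P \<in> Pl. v P (inv y) > 0}"
    using y by (auto simp: v_inv)
  moreover have "finite {P \<in> Pl. v P (inv y) > 0}"
    using finite_zeros[of "inv y"] y by simp
  ultimately show ?thesis using finite_zeros[OF y] by (meson finite_UnI finite_subset)
qed

text \<open>By Zorn's lemma there is a maximal subring \<open>A\<close> in which \<open>y\<close> stays a non-unit.  It is a valuation
  ring: if neither \<open>z\<close> nor its inverse is in \<open>A\<close>, then \<open>1\<close> is a polynomial in \<open>z\<close> and also one in the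
  inverse of \<open>z\<close>, both with coefficients in \<open>Y = y A\<close>, and the larger of the two degrees can be lowered.\<close>

primrec yexp :: "'a set \<Rightarrow> 'a \<Rightarrow> nat \<Rightarrow> 'a set" where
  "yexp Y z 0 = Y"
| "yexp Y z (Suc d) = (\<lambda>(a, b). a \<oplus> z \<otimes> b) ` (Y \<times> yexp Y z d)"

context
  fixes A Y assumes A: "subring A F" and Y: "subgroup Y (add_monoid F)"
    and AY: "\<And>r a. r \<in> A \<Longrightarrow> a \<in> Y \<Longrightarrow> r \<otimes> a \<in> Y"
begin

lemma Y_closed: "a \<in> Y \<Longrightarrow> a \<in> carrier F" and A_closed: "r \<in> A \<Longrightarrow> r \<in> carrier F"
  using add_subgroup_closed(1)[OF Y] subringE(1)[OF A] by auto

lemma yexp_SucI: "a \<in> Y \<Longrightarrow> b \<in> yexp Y z d \<Longrightarrow> a \<oplus> z \<otimes> b \<in> yexp Y z (Suc d)"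
  by force

lemma yexp_closed: "z \<in> carrier F \<Longrightarrow> f \<in> yexp Y z d \<Longrightarrow> f \<in> carrier F"
  by (induction d arbitrary: f) (auto simp: Y_closed)

lemma yexp_zero: "z \<in> carrier F \<Longrightarrow> \<zero> \<in> yexp Y z d"
proof (induction d)
  case (Suc d)
  then have "\<zero> \<oplus> z \<otimes> \<zero> \<in> yexp Y z (Suc d)"
    using add_subgroup_closed(2)[OF Y] by (intro yexp_SucI) auto
  then show ?case using Suc by simp
qed (use add_subgroup_closed(2)[OF Y] in simp)

lemma yexp_base: "z \<in> carrier F \<Longrightarrow> a \<in> Y \<Longrightarrow> a \<in> yexp Y z d"
proof (cases d)
  case (Suc e)
  assume "z \<in> carrier F" "a \<in> Y"
  then have "a \<oplus> z \<otimes> \<zero> \<in> yexp Y z (Suc e)" by (intro yexp_SucI yexp_zero)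
  then show ?thesis using Suc \<open>z \<in> carrier F\<close> Y_closed[OF \<open>a \<in> Y\<close>] by simp
qed simp

lemma yexp_add: "z \<in> carrier F \<Longrightarrow> f \<in> yexp Y z d \<Longrightarrow> g \<in> yexp Y z d \<Longrightarrow> f \<oplus> g \<in> yexp Y z d"
proof (induction d arbitrary: f g)
  case (Suc d)
  obtain a b where f: "a \<in> Y" "b \<in> yexp Y z d" "f = a \<oplus> z \<otimes> b" using Suc.prems by auto
  obtain a' b' where g: "a' \<in> Y" "b' \<in> yexp Y z d" "g = a' \<oplus> z \<otimes> b'" using Suc.prems by auto
  have "f \<oplus> g = (a \<oplus> a') \<oplus> z \<otimes> (b \<oplus> b')"
    using f g Y_closed yexp_closed[OF Suc.prems(1)] Suc.prems(1) by (simp add: r_distr a_ac)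
  then show ?case using yexp_SucI f g Suc add_subgroup_closed(3)[OF Y] by simp
qed (use add_subgroup_closed(3)[OF Y] in simp)

lemma yexp_smult: "z \<in> carrier F \<Longrightarrow> r \<in> A \<Longrightarrow> f \<in> yexp Y z d \<Longrightarrow> r \<otimes> f \<in> yexp Y z d"
proof (induction d arbitrary: f)
  case (Suc d)
  obtain a b where f: "a \<in> Y" "b \<in> yexp Y z d" "f = a \<oplus> z \<otimes> b" using Suc.prems by auto
  have "r \<otimes> f = (r \<otimes> a) \<oplus> z \<otimes> (r \<otimes> b)"
    using f Y_closed yexp_closed[OF Suc.prems(1)] Suc.prems(1) A_closed[OF Suc.prems(2)]
    by (simp add: r_distr m_lcomm)
  then show ?case using yexp_SucI f Suc AY by simp
qed (use AY in simp)

lemma yexp_Suc: "z \<in> carrier F \<Longrightarrow> f \<in> yexp Y z d \<Longrightarrow> f \<in> yexp Y z (Suc d)"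
proof (induction d arbitrary: f)
  case 0
  then have "f \<in> Y" by simp
  then show ?case by (rule yexp_base[OF 0(1)])
next
  case (Suc d)
  obtain a b where f: "a \<in> Y" "b \<in> yexp Y z d" "f = a \<oplus> z \<otimes> b" using Suc.prems by auto
  then show ?case using yexp_SucI Suc.IH[OF Suc.prems(1) f(2)] by blast
qed

lemma yexp_mono: "z \<in> carrier F \<Longrightarrow> f \<in> yexp Y z d \<Longrightarrow> d \<le> e \<Longrightarrow> f \<in> yexp Y z e"
  by (induction e) (auto simp: le_Suc_eq simp del: yexp.simps intro: yexp_Suc)

lemma yexp_power: "z \<in> carrier F \<Longrightarrow> a \<in> Y \<Longrightarrow> z [^] (j::nat) \<otimes> a \<in> yexp Y z j"
proof (induction j)
  case (Suc j)
  then have "\<zero> \<oplus> z \<otimes> (z [^] j \<otimes> a) \<in> yexp Y z (Suc j)"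
    using add_subgroup_closed(2)[OF Y] by (intro yexp_SucI) auto
  then show ?case using Suc Y_closed by (simp add: m_ac)
qed (simp add: Y_closed)

lemma yexp_top:
  assumes z: "z \<in> carrier F" and "f \<in> yexp Y z (Suc d)"
  shows "\<exists>g \<in> yexp Y z d. \<exists>a \<in> Y. f = g \<oplus> z [^] Suc d \<otimes> a"
  using assms(2)
proof (induction d arbitrary: f)
  case 0
  then obtain a b where "a \<in> Y" "b \<in> Y" "f = a \<oplus> z \<otimes> b" by auto
  then show ?case using z by (intro bexI[of _ a] bexI[of _ b]) auto
next
  case (Suc d)
  from Suc.prems obtain a b where f: "a \<in> Y" "b \<in> yexp Y z (Suc d)" "f = a \<oplus> z \<otimes> b" by force
  obtain g c where g: "g \<in> yexp Y z d" "c \<in> Y" "b = g \<oplus> z [^] Suc d \<otimes> c" using Suc.IH f by blast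
  have "f = (a \<oplus> z \<otimes> g) \<oplus> z [^] Suc (Suc d) \<otimes> c"
    using f g Y_closed yexp_closed[OF z g(1)] z by (simp add: r_distr m_ac a_ac)
  then show ?case using yexp_SucI f g by blast
qed

text \<open>In the product with \<open>z ^ e\<close>, the terms of \<open>b\<close>, with the extra
  inverse of \<open>z\<close>, acquire exponents between e - 1 - k and e - 1, none of them negative
  because k < e.\<close>

lemma yexp_lower:
  assumes z: "z \<in> carrier F" "z \<noteq> \<zero>" and c: "c \<in> A"
  shows "b \<in> yexp Y (inv z) k \<Longrightarrow> k < e \<Longrightarrow> z [^] e \<otimes> (c \<otimes> (inv z \<otimes> b)) \<in> yexp Y z (e - 1)"
proof (induction k arbitrary: b e)
  case 0
  then obtain e' where e': "e = Suc e'" by (cases e) auto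
  have bY: "b \<in> Y" using 0 by simp
  have "z [^] e \<otimes> (c \<otimes> (inv z \<otimes> b)) = z [^] e' \<otimes> (c \<otimes> b) \<otimes> (z \<otimes> inv z)"
    using e' z Y_closed[OF bY] A_closed[OF c] by (simp add: m_ac del: field_r_inv)
  then show ?case using yexp_power[OF z(1), of "c \<otimes> b" e'] AY[OF c bY] z Y_closed e' by simp
next
  case (Suc k)
  then obtain e' where e': "e = Suc e'" by (cases e) auto
  obtain a b' where b: "a \<in> Y" "b' \<in> yexp Y (inv z) k" "b = a \<oplus> inv z \<otimes> b'" using Suc.prems by auto
  have cl: "a \<in> carrier F" "b' \<in> carrier F" "c \<in> carrier F" "inv z \<in> carrier F"
    using b Y_closed yexp_closed[of "inv z" b'] z A_closed[OF c] by auto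
  have "z [^] e \<otimes> (c \<otimes> (inv z \<otimes> b)) =
      (z \<otimes> inv z) \<otimes> (z [^] e' \<otimes> (c \<otimes> a)) \<oplus> (z \<otimes> inv z) \<otimes> (z [^] e' \<otimes> (c \<otimes> (inv z \<otimes> b')))"
    using e' b cl z by (simp add: r_distr m_ac del: field_r_inv)
  also have "\<dots> = z [^] e' \<otimes> (c \<otimes> a) \<oplus> z [^] e' \<otimes> (c \<otimes> (inv z \<otimes> b'))"
    using cl z by simp
  finally have eq: "z [^] e \<otimes> (c \<otimes> (inv z \<otimes> b)) = z [^] e' \<otimes> (c \<otimes> a) \<oplus> z [^] e' \<otimes> (c \<otimes> (inv z \<otimes> b'))" .
  have "z [^] e' \<otimes> (c \<otimes> (inv z \<otimes> b')) \<in> yexp Y z (e' - 1)" using Suc.IH[OF b(2), of e'] Suc.prems e' by simp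
  then have "z [^] e' \<otimes> (c \<otimes> (inv z \<otimes> b')) \<in> yexp Y z e'" using yexp_mono[OF z(1), of _ "e' - 1" e'] by simp
  moreover have "z [^] e' \<otimes> (c \<otimes> a) \<in> yexp Y z e'" using yexp_power[OF z(1)] AY[OF c b(1)] by simp
  ultimately show ?case using eq e' yexp_add[OF z(1)] by simp
qed

text \<open>Write 1 = g + z ^ (d + 1) a and 1 - b0 = b / z, the second from the relation in the
  inverse of \<open>z\<close>. Multiplying the first by 1 - b0 lowers its top term, and
  \<open>k \<le> d\<close> keeps all exponents nonnegative.\<close>

lemma yexp_descent:
  assumes z: "z \<in> carrier F" "z \<noteq> \<zero>" and YA: "Y \<subseteq> A"
    and 1: "\<one> \<in> yexp Y z (Suc d)" "\<one> \<in> yexp Y (inv z) (Suc k)" and "k \<le> d"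
  shows "\<one> \<in> yexp Y z d"
proof -
  obtain g a where g: "g \<in> yexp Y z d" "a \<in> Y" "\<one> = g \<oplus> z [^] Suc d \<otimes> a" using yexp_top[OF z(1) 1(1)] by blast
  obtain b0 b where b: "b0 \<in> Y" "b \<in> yexp Y (inv z) k" "\<one> = b0 \<oplus> inv z \<otimes> b" using 1(2) by auto
  have cl: "g \<in> carrier F" "a \<in> carrier F" "b0 \<in> carrier F" "b \<in> carrier F" "inv z \<in> carrier F" "z [^] Suc d \<in> carrier F"
    using yexp_closed[OF z(1) g(1)] yexp_closed[of "inv z" b k] g b z Y_closed by auto
  have "\<one> \<ominus> b0 = inv z \<otimes> b" using b(3) cl by (simp add: minus_eq a_ac r_neg1 r_neg2)
  moreover have "\<one> = b0 \<oplus> (\<one> \<ominus> b0)" using cl by algebra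
  moreover have "(\<one> \<ominus> b0) = (\<one> \<ominus> b0) \<otimes> (g \<oplus> z [^] Suc d \<otimes> a)"
    by (subst g(3)[symmetric]) (use cl in simp)
  moreover have "(\<one> \<ominus> b0) \<otimes> (g \<oplus> z [^] Suc d \<otimes> a) = (\<one> \<ominus> b0) \<otimes> g \<oplus> z [^] Suc d \<otimes> (a \<otimes> (\<one> \<ominus> b0))"
    using cl by algebra
  ultimately have eq: "\<one> = b0 \<oplus> ((\<one> \<ominus> b0) \<otimes> g \<oplus> z [^] Suc d \<otimes> (a \<otimes> (inv z \<otimes> b)))" by metis
  have "\<one> \<ominus> b0 \<in> A" using b(1) YA subringE[OF A] by (auto simp: a_minus_def)
  then have "(\<one> \<ominus> b0) \<otimes> g \<in> yexp Y z d" using yexp_smult[OF z(1)] g(1) by blast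
  moreover have "z [^] Suc d \<otimes> (a \<otimes> (inv z \<otimes> b)) \<in> yexp Y z d"
    using yexp_lower[OF z _ b(2), of a "Suc d"] g(2) YA \<open>k \<le> d\<close> by auto
  ultimately have "b0 \<oplus> ((\<one> \<ominus> b0) \<otimes> g \<oplus> z [^] Suc d \<otimes> (a \<otimes> (inv z \<otimes> b))) \<in> yexp Y z d"
    using yexp_add[OF z(1)] yexp_base[OF z(1) b(1)] by blast
  then show ?thesis using eq by simp
qed

lemma yexp_contradiction:
  assumes z: "z \<in> carrier F" "z \<noteq> \<zero>" and YA: "Y \<subseteq> A" and no: "\<one> \<notin> Y"
  shows "\<one> \<in> yexp Y z d \<Longrightarrow> \<one> \<notin> yexp Y (inv z) k"
proof (induction "d + k" arbitrary: d k rule: less_induct)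
  case less
  show ?case
  proof
    assume k: "\<one> \<in> yexp Y (inv z) k"
    obtain d' where d': "d = Suc d'" using less.prems no by (cases d) auto
    obtain k' where k': "k = Suc k'" using k no by (cases k) auto
    show False
    proof (cases "k' \<le> d'")
      case True
      then have "\<one> \<in> yexp Y z d'" using yexp_descent[OF z YA] less.prems k d' k' by blast
      then show False using less.hyps[of d' k] k d' by simp
    next
      case False
      then have "\<one> \<in> yexp Y (inv z) k'"
        using yexp_descent[of "inv z" k' d'] less.prems k d' k' z YA by simp
      then show False using less.hyps[of d k'] less.prems k' by simp
    qed
  qed
qed

end

section \<open>Existence of places\<close>

lemma exists_place_zero:
  assumes A0: "subring A0 F" "K \<subseteq> A0" and y: "y \<in> A0" "y \<noteq> \<zero>" "\<one> \<notin> scale y A0"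
  shows "\<exists>P \<in> Pl. v P y > 0"
proof -
  let ?Z = "{A. subring A F \<and> A0 \<subseteq> A \<and> \<one> \<notin> scale y A}"
  have yc: "y \<in> carrier F" using subringE(1)[OF A0(1)] y by blast
  have "\<exists>M\<in>?Z. \<forall>B\<in>?Z. M \<subseteq> B \<longrightarrow> B = M"
  proof (rule subset_Zorn_nonempty)
    show "?Z \<noteq> {}" using assms by auto
    fix C assume C: "C \<noteq> {}" "subset.chain ?Z C"
    then have CZ: "\<And>A. A \<in> C \<Longrightarrow> subring A F \<and> A0 \<subseteq> A \<and> \<one> \<notin> scale y A" by (auto simp: subset_chain_def)
    have comp: "a \<in> \<Union>C \<Longrightarrow> b \<in> \<Union>C \<Longrightarrow> \<exists>A\<in>C. a \<in> A \<and> b \<in> A" for a b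
      using C(2) unfolding subset_chain_def by blast
    have "subring (\<Union>C) F"
    proof (rule subringI)
      show "\<Union>C \<subseteq> carrier F" using CZ subringE(1) by blast
      show "\<one> \<in> \<Union>C" using C(1) CZ subringE(3) by blast
      show "\<ominus> h \<in> \<Union>C" if h: "h \<in> \<Union>C" for h
      proof -
        obtain A where A: "A \<in> C" "h \<in> A" using h by blast
        then have "\<ominus> h \<in> A" using CZ[OF A(1)] subringE(5)[of A F h] by simp
        then show ?thesis using A(1) by blast
      qed
      fix h1 h2 assume h: "h1 \<in> \<Union>C" "h2 \<in> \<Union>C"
      obtain A where A: "A \<in> C" "h1 \<in> A" "h2 \<in> A" using comp[OF h] by blast
      then have "h1 \<otimes> h2 \<in> A" "h1 \<oplus> h2 \<in> A"
        using CZ[OF A(1)] subringE(6)[of A F h1 h2] subringE(7)[of A F h1 h2] by simp_all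
      then show "h1 \<otimes> h2 \<in> \<Union>C" "h1 \<oplus> h2 \<in> \<Union>C" using A(1) by blast+
    qed
    moreover have "A0 \<subseteq> \<Union>C" using C(1) CZ by blast
    moreover have "\<one> \<notin> scale y (\<Union>C)" using CZ by (auto simp: scale_def)
    ultimately show "\<Union>C \<in> ?Z" by blast
  qed
  then obtain M where MZ: "M \<in> ?Z" and mx: "\<forall>B\<in>?Z. M \<subseteq> B \<longrightarrow> B = M" by (rule bexE)
  from MZ have M: "subring M F" "A0 \<subseteq> M" "\<one> \<notin> scale y M" by simp_all
  have max: "B = M" if "subring B F" "A0 \<subseteq> B" "\<one> \<notin> scale y B" "M \<subseteq> B" for B
    using bspec[OF mx, of B] that by simp
  let ?Y = "scale y M"
  have Mc: "M \<subseteq> carrier F" using subringE(1)[OF M(1)] .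
  have MK: "K \<subseteq> M" using M A0 by blast
  have Y: "subgroup ?Y (add_monoid F)"
    using subgroup_scale[OF subring.axioms(1)[OF M(1)] yc] .
  have MY: "r \<otimes> a \<in> ?Y" if ra: "r \<in> M" "a \<in> ?Y" for r a
  proof -
    obtain b where b: "b \<in> M" "a = y \<otimes> b" using ra(2) unfolding scale_def by (rule imageE)
    then have "r \<otimes> a = y \<otimes> (r \<otimes> b)" using ra(1) Mc yc by (simp add: m_lcomm subset_iff)
    then show ?thesis using ra(1) b(1) subringE(6)[OF M(1)] by (simp add: scale_def)
  qed
  have YM: "?Y \<subseteq> M" using y M(2) subringE(6)[OF M(1)] by (auto simp: scale_def)
  have iy: "inv y \<notin> M"
  proof
    assume "inv y \<in> M"
    then have "y \<otimes> inv y \<in> ?Y" by (auto simp: scale_def)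
    then show False using M(3) yc y(2) by simp
  qed
  have ext: "\<exists>d. \<one> \<in> yexp ?Y z d" if z: "z \<in> carrier F" "z \<notin> M" for z
  proof -
    let ?B = "simple_extension M z"
    have "M \<subseteq> ?B" using simple_extension_incl[OF Mc z(1)] subringE(3)[OF M(1)] subringE(2)[OF M(1)] by blast
    moreover have "z \<in> ?B" using simple_extension_mem[OF M(1) z(1)] .
    \<comment> \<open>M[z] is strictly larger, so by maximality \<open>y\<close> is invertible in
      it. The inverse is a polynomial in \<open>z\<close> over \<open>M\<close>, and multiplying it
      by \<open>y\<close> moves its coefficients into \<open>?Y\<close>.\<close>
    ultimately have "\<one> \<in> scale y ?B"
      using max[OF simple_extension_is_subring[OF M(1) z(1)]] M(2) z(2) by blast
    then obtain f where f: "f \<in> ?B" "\<one> = y \<otimes> f" by (auto simp: scale_def)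
    have "\<exists>d. y \<otimes> f \<in> yexp ?Y z d" using f(1)
    proof (induction f rule: simple_extension.induct)
      case zero
      then show ?case using yexp_zero[OF M(1) Y MY z(1), of 0] yc by (intro exI[of _ 0]) simp
    next
      case (lin k1 k2)
      then obtain d where d: "y \<otimes> k1 \<in> yexp ?Y z d" by blast
      have k1: "k1 \<in> carrier F" using simple_extension_in_carrier[OF Mc z(1)] lin by blast
      have "y \<otimes> (k1 \<otimes> z \<oplus> k2) = y \<otimes> k2 \<oplus> z \<otimes> (y \<otimes> k1)"
      proof -
        have "k2 \<in> carrier F" using lin Mc by blast
        then show ?thesis using k1 yc z(1) by algebra
      qed
      moreover have "y \<otimes> k2 \<in> ?Y" using lin by (auto simp: scale_def)
      ultimately have "y \<otimes> (k1 \<otimes> z \<oplus> k2) \<in> yexp ?Y z (Suc d)"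
        using yexp_SucI[OF M(1) Y MY, of "y \<otimes> k2" "y \<otimes> k1" z d] d by simp
      then show ?case by blast
    qed
    then show ?thesis using f by simp
  qed
  have "valuation_ring F K M"
    unfolding valuation_ring_def
  proof (intro conjI ballI)
    show "subring M F" by (rule M)
    show "K \<subset> M"
    proof -
      \<comment> \<open>The inclusion is strict because \<open>y\<close> cannot lie in the field
        \<open>K\<close>, where it would have an inverse.\<close>
      have "y \<in> K \<Longrightarrow> inv y \<in> M" using y MK by auto
      then show ?thesis using iy MK y M by blast
    qed
    show "M \<subset> carrier F" using Mc iy yc y inv_in_carrier by blast
    fix z assume z: "z \<in> carrier F - {\<zero>}"
    show "z \<in> M \<or> inv z \<in> M"
    proof (rule ccontr)
      assume "\<not> ?thesis"
      then obtain d k where "\<one> \<in> yexp ?Y z d" "\<one> \<in> yexp ?Y (inv z) k" using ext[of z] ext[of "inv z"] z by auto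
      then show False using yexp_contradiction[OF M(1) Y MY _ _ YM M(3)] z by blast
    qed
  qed
  note place = place_of_valuation_ring[OF this]
  have "y \<in> nonunits M" using y M(2) iy by (auto simp: nonunits_def)
  then show ?thesis using v_mem_iff(2)[OF place(1) yc y(2)] place(1) by blast
qed

text \<open>Applied to K[y]: if \<open>y\<close> were invertible there, y l(y) = 1 would be an
  algebraic equation for \<open>y\<close>.\<close>

lemma exists_place_zero_transcendental:
  assumes y: "y \<in> carrier F" "transcendental K y"
  shows "\<exists>P \<in> Pl. v P y > 0"
proof (rule exists_place_zero[of "simple_extension K y"])
  have Ks: "subring K F" using subfieldE(1)[OF subfield_K] .
  show "subring (simple_extension K y) F" using simple_extension_is_subring[OF Ks y(1)] .
  show "K \<subseteq> simple_extension K y" using simple_extension_incl[OF _ y(1), of K] by simp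
  show "y \<in> simple_extension K y" using simple_extension_mem[OF Ks y(1)] .
  have *: False if "l \<in> carrier (K[X])" "\<one> = y \<otimes> eval l y" for l
  proof (cases "l = []")
    case True
    then show False using that y by simp
  next
    case False
    have lK: "set l \<subseteq> K" using that by (auto simp: univ_poly_def polynomial_def)
    then have lc: "set l \<subseteq> carrier F" by auto
    have "l @ [\<ominus> \<one>] \<in> carrier (K[X])" using that(1) lK False by (auto simp: univ_poly_def polynomial_def)
    moreover have "eval (l @ [\<ominus> \<one>]) y = \<zero>"
      using eval_append_aux[of l "\<ominus> \<one>" y] lc y that(2) eval_in_carrier[OF lc y(1)] by (simp add: m_comm[of y] r_neg)
    ultimately show False using eval_transcendental y(2) by (auto simp: over_def)
  qed
  then show "\<one> \<notin> scale y (simple_extension K y)"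
    using simple_extension_as_eval_img[OF _ y(1), of K] by (auto simp: scale_def)
  show "y \<noteq> \<zero>"
    using zero_is_algebraic[OF Ks] y(2) by (auto simp: over_def)
qed

end

section \<open>Riemann's theorem\<close>

locale global_function_field = finite_function_field +
  assumes full_constants: "full_constant_field F K"
begin

text \<open>Here the full constant field enters: the inverse of a function outside \<open>K\<close>
  is transcendental, so it has a zero, which is a pole of the function.\<close>

lemma LS_zero: "LS Pl (\<lambda>P. 0) = K"
proof (intro equalityI subsetI)
  fix z assume "z \<in> LS Pl (\<lambda>P. 0)"
  then have z: "z \<in> carrier F" "\<And>P. P \<in> Pl \<Longrightarrow> z \<in> pw P 0" by (auto simp: LS_def)
  show "z \<in> K"
  proof (rule ccontr)
    assume zK: "z \<notin> K"
    then have nz: "z \<noteq> \<zero>" by auto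
    have "inv z \<notin> K"
    proof
      assume "inv z \<in> K"
      then have "inv (inv z) \<in> K" using z nz K_inv inv_nonzero by blast
      then show False using zK z nz by simp
    qed
    then have "transcendental K (inv z)"
      using full_constants z nz unfolding full_constant_field_def by auto
    then obtain P where P: "P \<in> Pl" "v P (inv z) > 0"
      using exists_place_zero_transcendental[of "inv z"] z nz by auto
    then show False using z(2)[OF P(1)] z(1) nz by (simp add: pw_iff v_inv)
  qed
next
  fix z assume "z \<in> K"
  then show "z \<in> LS Pl (\<lambda>P. 0)"
    by (cases "z = \<zero>") (auto simp: LS_def pw_iff v_const)
qed

section \<open>Divisors, degrees and dimensions\<close>

definition Divs :: "('a set \<Rightarrow> int) set" where
  "Divs = {E. finite {P \<in> Pl. E P \<noteq> 0}}"

definition degr :: "('a set \<Rightarrow> int) \<Rightarrow> int" where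
  "degr E = (\<Sum>P | P \<in> Pl \<and> E P \<noteq> 0. E P * int (place_degree F K P))"

lemma degr_eq:
  assumes "finite T" "T \<subseteq> Pl" "\<And>P. P \<in> Pl \<Longrightarrow> P \<notin> T \<Longrightarrow> E P = 0"
  shows "degr E = (\<Sum>P\<in>T. E P * int (place_degree F K P))"
  unfolding degr_def by (rule sum.mono_neutral_left) (use assms in auto)

lemma Divs_common:
  assumes "E \<in> Divs" "E' \<in> Divs"
  obtains T where "finite T" "T \<subseteq> Pl" "\<And>P. P \<in> Pl \<Longrightarrow> P \<notin> T \<Longrightarrow> E P = 0" "\<And>P. P \<in> Pl \<Longrightarrow> P \<notin> T \<Longrightarrow> E' P = 0"
  by (rule that[of "{P \<in> Pl. E P \<noteq> 0} \<union> {P \<in> Pl. E' P \<noteq> 0}"]) (use assms in \<open>auto simp: Divs_def\<close>)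

lemma Divs_add: "E \<in> Divs \<Longrightarrow> E' \<in> Divs \<Longrightarrow> (\<lambda>P. E P + E' P) \<in> Divs"
  unfolding Divs_def mem_Collect_eq by (erule (1) finite_subset[rotated, OF finite_UnI]) auto

lemma Divs_mult: "E \<in> Divs \<Longrightarrow> (\<lambda>P. c * E P) \<in> Divs"
  unfolding Divs_def mem_Collect_eq by (erule finite_subset[rotated]) auto

lemma Divs_zero: "(\<lambda>P. 0) \<in> Divs" by (simp add: Divs_def)

lemma degr_add: "E \<in> Divs \<Longrightarrow> E' \<in> Divs \<Longrightarrow> degr (\<lambda>P. E P + E' P) = degr E + degr E'"
proof -
  assume "E \<in> Divs" "E' \<in> Divs"
  then obtain T where T: "finite T" "T \<subseteq> Pl" "\<And>P. P \<in> Pl \<Longrightarrow> P \<notin> T \<Longrightarrow> E P = 0" "\<And>P. P \<in> Pl \<Longrightarrow> P \<notin> T \<Longrightarrow> E' P = 0"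
    using Divs_common by metis
  then show ?thesis
    using degr_eq[OF T(1,2), of E] degr_eq[OF T(1,2), of E'] degr_eq[OF T(1,2), of "\<lambda>P. E P + E' P"]
    by (simp add: distrib_right sum.distrib)
qed

lemma degr_mult: "E \<in> Divs \<Longrightarrow> degr (\<lambda>P. c * E P) = c * degr E"
proof -
  assume E: "E \<in> Divs"
  obtain T where T: "finite T" "T \<subseteq> Pl" "\<And>P. P \<in> Pl \<Longrightarrow> P \<notin> T \<Longrightarrow> E P = 0"
    using Divs_common[OF E E] by metis
  then show ?thesis
    using degr_eq[OF T(1,2), of E] degr_eq[OF T(1,2), of "\<lambda>P. c * E P"]
    by (simp add: sum_distrib_left mult.assoc)
qed

lemma Divs_diff: "E \<in> Divs \<Longrightarrow> E' \<in> Divs \<Longrightarrow> (\<lambda>P. E P - E' P) \<in> Divs"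
  using Divs_add[OF _ Divs_mult[of E' "-1"], of E] by simp

lemma degr_diff: "E \<in> Divs \<Longrightarrow> E' \<in> Divs \<Longrightarrow> degr (\<lambda>P. E P - E' P) = degr E - degr E'"
  using degr_add[OF _ Divs_mult[of E' "-1"], of E] degr_mult[of E' "-1"] by simp

lemma degr_nonneg: "(\<And>P. P \<in> Pl \<Longrightarrow> E P \<ge> 0) \<Longrightarrow> degr E \<ge> 0"
  unfolding degr_def by (intro sum_nonneg) auto

lemma degr_mono: "E \<in> Divs \<Longrightarrow> E' \<in> Divs \<Longrightarrow> (\<And>P. P \<in> Pl \<Longrightarrow> E P \<le> E' P) \<Longrightarrow> degr E \<le> degr E'"
  using degr_nonneg[of "\<lambda>P. E' P - E P"] degr_diff[of E' E] by simp

lemma Divs_principal: "f \<in> carrier F \<Longrightarrow> f \<noteq> \<zero> \<Longrightarrow> (\<lambda>P. v P f) \<in> Divs"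
  using finite_support by (simp add: Divs_def)

lemma index_AS_Pl:
  assumes E: "E \<in> Divs" "E' \<in> Divs" "\<And>P. P \<in> Pl \<Longrightarrow> E P \<le> E' P"
  shows "index_in AA (AS Pl E') (AS Pl E) = Q ^ nat (degr E' - degr E)"
proof -
  obtain T where T: "finite T" "T \<subseteq> Pl" "\<And>P. P \<in> Pl \<Longrightarrow> P \<notin> T \<Longrightarrow> E P = 0" "\<And>P. P \<in> Pl \<Longrightarrow> P \<notin> T \<Longrightarrow> E' P = 0"
    using Divs_common[OF E(1,2)] by metis
  have "int (\<Sum>P\<in>T. nat (E' P - E P) * place_degree F K P) = (\<Sum>P\<in>T. (E' P - E P) * int (place_degree F K P))"
    unfolding of_nat_sum by (rule sum.cong) (use E T in auto)
  also have "\<dots> = degr E' - degr E"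
    using degr_eq[OF T(1,2), of E] degr_eq[OF T(1,2), of E'] T(3,4) by (simp add: left_diff_distrib sum_subtractf)
  finally have "nat (degr E' - degr E) = (\<Sum>P\<in>T. nat (E' P - E P) * place_degree F K P)" by linarith
  then show ?thesis using index_AS[OF _ T(1,2) E(3)] T(3,4) by simp
qed

lemma LS_mono: "(\<And>P. P \<in> Pl \<Longrightarrow> E P \<le> E' P) \<Longrightarrow> LS Pl E \<subseteq> LS Pl E'"
  by (auto simp: LS_def intro: pw_mono)

lemma card_LS_idx:
  assumes "\<And>P. P \<in> Pl \<Longrightarrow> E P \<le> E' P"
  shows "card (LS Pl E') = idx (LS Pl E') (LS Pl E) * card (LS Pl E)"
proof -
  have z: "subgroup {\<zero>} (add_monoid F)" using add.triv_subgroup by simp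
  have "\<zero> \<in> LS Pl E" by (simp add: LS_def)
  then show ?thesis
    using add.index_in_tower[OF subgroup_LS subgroup_LS z, of Pl Pl E E'] LS_mono[OF assms]
      add.index_in_one[OF subgroup_LS, of Pl E] add.index_in_one[OF subgroup_LS, of Pl E'] by simp
qed

text \<open>Enlarge the divisor to an effective one. The index of its space over that of 0, which is
  the finite \<open>K\<close>, is a factor of a power of \<open>Q\<close>, hence positive, hence
  finite.\<close>

lemma finite_LS:
  assumes E: "E \<in> Divs"
  shows "finite (LS Pl E)"
proof -
  let ?E = "\<lambda>P. max 0 (E P)"
  have d: "?E \<in> Divs" using E unfolding Divs_def mem_Collect_eq by (rule finite_subset[rotated]) auto
  have "index_in AA (AS Pl ?E) (AS Pl (\<lambda>P. 0)) > 0"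
    using index_AS_Pl[OF Divs_zero d] Q_ge_2 by simp
  then have "idx (LS Pl ?E) (LS Pl (\<lambda>P. 0)) > 0"
    using index_AS_LS[of Pl "\<lambda>P. 0" ?E] by simp
  then have "card (LS Pl ?E) > 0"
    using card_LS_idx[of "\<lambda>P. 0" ?E] LS_zero Q_ge_2 by simp
  then have "finite (LS Pl ?E)" using card_gt_0_iff by blast
  moreover have "LS Pl E \<subseteq> LS Pl ?E" by (rule LS_mono) simp
  ultimately show ?thesis by (rule finite_subset[rotated])
qed

definition ell :: "('a set \<Rightarrow> int) \<Rightarrow> nat" where
  "ell E = dim K (LS Pl E)"

lemma card_LS: "E \<in> Divs \<Longrightarrow> card (LS Pl E) = Q ^ ell E"
proof -
  assume E: "E \<in> Divs"
  have "subalgebra K (LS Pl E) F"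
    by (intro subalgebra.intro subalgebra_axioms.intro subgroup_LS subset_refl)
       (auto simp: LS_def intro: pw_smult)
  then show ?thesis
    using card_eq_power_dim[OF subfield_K finite_K _ finite_LS[OF E]] by (simp add: ell_def)
qed

lemma ell_zero: "ell (\<lambda>P. 0) = 1"
proof -
  have "Q ^ ell (\<lambda>P. 0) = Q ^ 1" using card_LS[OF Divs_zero] LS_zero by simp
  moreover have "1 < Q" using Q_ge_2 by simp
  ultimately show ?thesis using power_inject_exp by blast
qed

text \<open>The quantity maximized in \<open>genus\<close>, without the 1; its maximum is therefore
  g - 1. Quotients of adeles turn out to have \<open>Q\<close> to a difference of defects as their
  size.\<close>

definition defect :: "('a set \<Rightarrow> int) \<Rightarrow> int" where
  "defect E = degr E - int (ell E)"

abbreviation DF :: "('a set \<Rightarrow> 'a) set" where "DF \<equiv> diag (carrier F)"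

text \<open>The local index is \<open>Q\<close> to the difference of degrees, the global one
  \<open>Q\<close> to the difference of dimensions, and their quotient is the index of the sums with
  the diagonal. Being at least 1, it shows that the defect grows with the divisor.\<close>

lemma index_AS_diag:
  assumes E: "E \<in> Divs" "E' \<in> Divs" and le: "\<And>P. P \<in> Pl \<Longrightarrow> E P \<le> E' P"
  shows "defect E \<le> defect E'"
    and "index_in AA (AS Pl E' <#>\<^bsub>AA\<^esub> DF) (AS Pl E <#>\<^bsub>AA\<^esub> DF) = Q ^ nat (defect E' - defect E)"
proof -
  let ?J = "index_in AA (AS Pl E' <#>\<^bsub>AA\<^esub> DF) (AS Pl E <#>\<^bsub>AA\<^esub> DF)"
  let ?I = "idx (LS Pl E') (LS Pl E)"
  have 1: "Q ^ nat (degr E' - degr E) = ?J * ?I"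
    using index_AS_Pl[OF E le] index_AS_LS[OF subset_refl le] by simp
  have "card (LS Pl E') = ?I * card (LS Pl E)" using le by (rule card_LS_idx)
  then have 2: "Q ^ ell E' = ?I * Q ^ ell E" using card_LS[OF E(1)] card_LS[OF E(2)] by simp
  have dle: "degr E \<le> degr E'" using degr_mono[OF E le] .
  have 3: "Q ^ (nat (degr E' - degr E) + ell E) = ?J * Q ^ ell E'"
    using 1 2 by (simp add: power_add mult.assoc)
  have "?J > 0" using 1 Q_ge_2 by (metis mult_is_0 not_gr0 not_numeral_le_zero power_not_zero)
  then have "Q ^ ell E' \<le> Q ^ (nat (degr E' - degr E) + ell E)" using 3 by simp
  then have le': "ell E' \<le> nat (degr E' - degr E) + ell E" using Q_ge_2 power_increasing_iff[of Q] by simp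
  then show "defect E \<le> defect E'" using dle by (simp add: defect_def)
  have "nat (degr E' - degr E) + ell E = nat (defect E' - defect E) + ell E'"
    using le' dle by (simp add: defect_def)
  then have "Q ^ nat (defect E' - defect E) * Q ^ ell E' = ?J * Q ^ ell E'" using 3 by (simp add: power_add)
  then show "?J = Q ^ nat (defect E' - defect E)" using Q_ge_2 by simp
qed

lemma LS_principal:
  assumes f: "f \<in> carrier F" "f \<noteq> \<zero>"
  shows "LS Pl (\<lambda>P. E P - v P f) = scale f (LS Pl E)"
proof (intro equalityI subsetI)
  fix z assume "z \<in> scale f (LS Pl E)"
  then obtain r where r: "z = f \<otimes> r" "r \<in> carrier F" "\<And>P. P \<in> Pl \<Longrightarrow> r \<in> pw P (- E P)"
    by (auto simp: LS_def scale_def)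
  then show "z \<in> LS Pl (\<lambda>P. E P - v P f)"
    using pw_mult[of _ f "v _ f" r "- E _"] f by (auto simp: LS_def pw_iff)
next
  fix z assume "z \<in> LS Pl (\<lambda>P. E P - v P f)"
  then have z: "z \<in> carrier F" "\<And>P. P \<in> Pl \<Longrightarrow> z \<in> pw P (v P f - E P)" by (auto simp: LS_def)
  have "inv f \<otimes> z \<in> pw P (- E P)" if P: "P \<in> Pl" for P
    using pw_mult[OF P, of "inv f" "- v P f" z "v P f - E P"] z P f by (auto simp: pw_iff v_inv)
  then have "inv f \<otimes> z \<in> LS Pl E" using f z by (simp add: LS_def)
  moreover have "z = f \<otimes> (inv f \<otimes> z)" using f z by (simp add: m_assoc[symmetric])
  ultimately show "z \<in> scale f (LS Pl E)" by (auto simp: scale_def)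
qed

lemma ell_principal:
  assumes f: "f \<in> carrier F" "f \<noteq> \<zero>" and E: "E \<in> Divs"
  shows "ell (\<lambda>P. E P - v P f) = ell E"
proof -
  have "inj_on (\<lambda>r. f \<otimes> r) (LS Pl E)"
    using m_lcancel[OF f(2,1)] by (auto simp: inj_on_def LS_def)
  then have "card (LS Pl (\<lambda>P. E P - v P f)) = card (LS Pl E)"
    unfolding LS_principal[OF f] scale_def by (rule card_image)
  then have "Q ^ ell (\<lambda>P. E P - v P f) = Q ^ ell E"
    using card_LS[OF E] card_LS[OF Divs_diff[OF E Divs_principal[OF f]]] by simp
  then show ?thesis using Q_ge_2 power_inject_exp[of Q] by simp
qed

section \<open>The pole divisor of the chosen transcendental element\<close>

definition x_poles :: "'a set \<Rightarrow> int" where "x_poles P = max 0 (- v P x)"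

lemma x_nonzero: "x \<noteq> \<zero>"
proof
  assume "x = \<zero>"
  then show False using x_transcendental zero_is_algebraic[OF subfieldE(1)[OF subfield_K]] by (auto simp: over_def)
qed

lemma x_pw: "P \<in> Pl \<Longrightarrow> x \<in> pw P (- x_poles P)"
  using x_nonzero by (simp add: pw_iff x_poles_def)

lemma polys_pw: "P \<in> Pl \<Longrightarrow> p \<in> polys d \<Longrightarrow> p \<in> pw P (- (int d * x_poles P))"
proof (induction d arbitrary: p)
  case 0
  then show ?case by (cases "p = \<zero>") (auto simp: pw_iff v_const)
next
  case (Suc d)
  obtain a b where p: "a \<in> K" "b \<in> polys d" "p = a \<oplus> x \<otimes> b" using Suc.prems(2) by (rule polys_SucE)
  have "x \<otimes> b \<in> pw P (- x_poles P + - (int d * x_poles P))" using pw_mult x_pw Suc p by blast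
  then have 1: "x \<otimes> b \<in> pw P (- (int (Suc d) * x_poles P))" by (simp add: algebra_simps)
  have "a \<in> pw P 0" using p Suc.prems by (cases "a = \<zero>") (auto simp: pw_iff v_const)
  moreover have "0 \<le> int (Suc d) * x_poles P" unfolding x_poles_def by (intro mult_nonneg_nonneg) auto
  ultimately have "a \<in> pw P (- (int (Suc d) * x_poles P))" using pw_mono[of a P 0] by simp
  then show ?case using pw_add[OF Suc.prems(1)] 1 p by blast
qed

text \<open>At a pole of \<open>x\<close> the leading term dominates. An element of F carries no
  coefficients, so its exact degree is expressed by its lying in no earlier
  \<open>polys e\<close>.\<close>

lemma polys_v_exact:
  assumes P: "P \<in> Pl" "v P x < 0"
  shows "p \<in> polys d \<Longrightarrow> p \<noteq> \<zero> \<Longrightarrow> (\<And>e. e < d \<Longrightarrow> p \<notin> polys e) \<Longrightarrow> v P p = int d * v P x"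
proof (induction d arbitrary: p)
  case 0
  then show ?case using v_const P by simp
next
  case (Suc d)
  obtain a b where p: "a \<in> K" "b \<in> polys d" "p = a \<oplus> x \<otimes> b" using Suc.prems(1) by (rule polys_SucE)
  have bc: "b \<in> carrier F" using p polys_closed by blast
  have bn: "b \<noteq> \<zero>"
  proof
    assume "b = \<zero>"
    then have "p \<in> polys 0" using p by simp
    then show False using Suc.prems(3)[of 0] by simp
  qed
  have "b \<notin> polys e" if "e < d" for e
  proof
    assume "b \<in> polys e"
    then have "p \<in> polys (Suc e)" using p polys_SucI by blast
    then show False using Suc.prems(3)[of "Suc e"] that by simp
  qed
  then have vb: "v P b = int d * v P x" using Suc.IH p bn by blast
  have vxb: "v P (x \<otimes> b) = int (Suc d) * v P x"
    using v_mult[OF P(1) x_closed x_nonzero bc bn] vb by (simp add: algebra_simps)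
  show ?case
  proof (cases "a = \<zero>")
    case True
    then show ?thesis using p vxb bc by simp
  next
    case False
    have "int (Suc d) * v P x < 0" using P(2) by (intro mult_pos_neg) auto
    then have "v P (x \<otimes> b) < v P a" using vxb v_const[OF P(1) p(1) False] by simp
    then show ?thesis
      using v_add_distinct(2)[OF P(1), of "x \<otimes> b" a] p bc bn x_nonzero False vxb a_comm[of a "x \<otimes> b"] by simp
  qed
qed

lemma Divs_x_poles: "x_poles \<in> Divs"
  using finite_support[OF x_closed x_nonzero] unfolding Divs_def mem_Collect_eq
  by (rule finite_subset[rotated]) (auto simp: x_poles_def)

lemma degr_zeros_le:
  assumes y: "y \<in> carrier F" "y \<noteq> \<zero>" and g: "growth y d h"
  shows "degr (\<lambda>P. max 0 (v P y)) \<le> int n * int d"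
proof -
  let ?T = "{P \<in> Pl. v P y > 0}"
  have T: "finite ?T" using finite_zeros[OF y] .
  have "degr (\<lambda>P. max 0 (v P y)) = (\<Sum>P\<in>?T. max 0 (v P y) * int (place_degree F K P))"
    by (rule degr_eq[OF T]) auto
  also have "\<dots> = int (\<Sum>P\<in>?T. nat (v P y) * place_degree F K P)"
    unfolding of_nat_sum by (rule sum.cong) auto
  also have "\<dots> \<le> int (n * d)"
    using degree_of_zeros_le[OF y g T] by (simp only: of_nat_le_iff) force
  finally show ?thesis by simp
qed

lemma degr_x_poles_le: "degr x_poles \<le> int n"
proof -
  have "degr x_poles = degr (\<lambda>P. max 0 (v P (inv x)))"
    unfolding degr_def by (rule sum.cong) (auto simp: x_poles_def v_inv x_nonzero)
  then show ?thesis using degr_zeros_le[of "inv x" 1 x] growth_inv_x x_nonzero by simp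
qed

text \<open>A crude common bound for the poles of the basis: a sum replaces the maximum, as its
  degree only enters as a constant error.\<close>

definition basis_poles :: "'a set \<Rightarrow> int" where
  "basis_poles P = (\<Sum>u \<in> set Us - {\<zero>}. max 0 (- v P u))"

lemma Divs_basis_poles: "basis_poles \<in> Divs"
proof -
  have "{P \<in> Pl. basis_poles P \<noteq> 0} \<subseteq> (\<Union>u \<in> set Us - {\<zero>}. {P \<in> Pl. v P u \<noteq> 0})"
  proof
    fix P assume P: "P \<in> {P \<in> Pl. basis_poles P \<noteq> 0}"
    then obtain u where "u \<in> set Us - {\<zero>}" "max 0 (- v P u) \<noteq> 0"
      unfolding basis_poles_def using sum.not_neutral_contains_not_neutral by blast
    then show "P \<in> (\<Union>u \<in> set Us - {\<zero>}. {P \<in> Pl. v P u \<noteq> 0})" using P by force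
  qed
  moreover have "finite (\<Union>u \<in> set Us - {\<zero>}. {P \<in> Pl. v P u \<noteq> 0})"
    using finite_support Us_closed by blast
  ultimately show ?thesis unfolding Divs_def mem_Collect_eq by (rule finite_subset)
qed

lemma Us_pw: "P \<in> Pl \<Longrightarrow> u \<in> set Us \<Longrightarrow> u \<in> pw P (- basis_poles P)"
proof -
  assume P: "P \<in> Pl" and u: "u \<in> set Us"
  show ?thesis
  proof (cases "u = \<zero>")
    case False
    have "max 0 (- v P u) \<le> basis_poles P"
      unfolding basis_poles_def using u False by (intro member_le_sum) auto
    then show ?thesis using u Us_closed False by (subst pw_iff) auto
  qed simp
qed

lemma mods_pw: "P \<in> Pl \<Longrightarrow> set us \<subseteq> set Us \<Longrightarrow> m \<in> mods d us \<Longrightarrow> m \<in> pw P (- (int d * x_poles P + basis_poles P))"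
proof (induction us arbitrary: m)
  case (Cons u us)
  obtain a m' where m: "a \<in> polys d" "m' \<in> mods d us" "m = a \<otimes> u \<oplus> m'" using Cons.prems(3) by (rule mods_ConsE)
  have "a \<otimes> u \<in> pw P (- (int d * x_poles P) + - basis_poles P)"
    using pw_mult[OF Cons.prems(1) polys_pw[OF Cons.prems(1) m(1)] Us_pw[OF Cons.prems(1)]] Cons.prems by simp
  then show ?case using Cons m pw_add by simp
qed simp

lemma ell_ge: "ell (\<lambda>P. int d * x_poles P + basis_poles P) \<ge> n * Suc d"
proof -
  let ?E = "\<lambda>P. int d * x_poles P + basis_poles P"
  have dE: "?E \<in> Divs" using Divs_add[OF Divs_mult[OF Divs_x_poles] Divs_basis_poles] .
  have "M d \<subseteq> LS Pl ?E" using mods_pw mods_closed[OF Us_closed] by (auto simp: LS_def)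
  then have "card (M d) \<le> Q ^ ell ?E" using card_mono[OF finite_LS[OF dE]] card_LS[OF dE] by simp
  then have "Q ^ (Suc d * n) \<le> Q ^ ell ?E"
    unfolding card_mods[OF Us_independent] power_mult .
  then have "Suc d * n \<le> ell ?E" using Q_ge_2 by (metis less_le_trans one_less_numeral_iff power_increasing_iff semiring_norm(76))
  then show ?thesis by (simp add: mult.commute)
qed

lemma basis_poles_nonneg: "basis_poles P \<ge> 0"
  by (auto simp: basis_poles_def intro: sum_nonneg)

lemma degr_basis_poles_nonneg: "degr basis_poles \<ge> 0"
  using basis_poles_nonneg by (rule degr_nonneg)

text \<open>Dropping \<open>basis_poles\<close> costs at most its degree, because the defect is
  monotone; what remains comes from the number of elements of \<open>M d\<close>.\<close>

lemma ell_x_poles_ge: "int (ell (\<lambda>P. int d * x_poles P)) \<ge> int n * (int d + 1) - degr basis_poles"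
proof -
  have "defect (\<lambda>P. int d * x_poles P) \<le> defect (\<lambda>P. int d * x_poles P + basis_poles P)"
    using basis_poles_nonneg by (intro index_AS_diag(1) Divs_add Divs_mult Divs_x_poles Divs_basis_poles) simp
  then have "int (ell (\<lambda>P. int d * x_poles P)) \<ge> int (ell (\<lambda>P. int d * x_poles P + basis_poles P)) - degr basis_poles"
    using degr_add[OF Divs_mult[OF Divs_x_poles] Divs_basis_poles] by (simp add: defect_def)
  moreover have "int (n * Suc d) \<le> int (ell (\<lambda>P. int d * x_poles P + basis_poles P))" using ell_ge by (simp only: of_nat_le_iff)
  ultimately show ?thesis by (simp add: algebra_simps)
qed

text \<open>Were the degree below \<open>n\<close>, the dimension of the d-fold multiple would be at
  most d (n - 1) + 1, against the lower bound n (d + 1) minus a constant. The other inequality is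
  the index bound.\<close>

lemma degr_x_poles: "degr x_poles = int n"
proof -
  have "\<not> degr x_poles < int n"
  proof
    assume lt: "degr x_poles < int n"
    \<comment> \<open>Just large enough to violate
      \<open>int n + int d \<le> 1 + degr basis_poles\<close>, where the two estimates meet.\<close>
    define d where "d = nat (degr basis_poles + 2)"
    have "defect (\<lambda>P. 0) \<le> defect (\<lambda>P. int d * x_poles P)"
      by (intro index_AS_diag(1) Divs_zero Divs_mult Divs_x_poles) (simp add: x_poles_def)
    then have "int (ell (\<lambda>P. int d * x_poles P)) \<le> int d * degr x_poles + 1"
      using ell_zero degr_mult[OF Divs_x_poles, of "int d"] by (simp add: defect_def degr_def)
    moreover have "int d * degr x_poles \<le> int d * (int n - 1)" using lt by (intro mult_left_mono) auto
    ultimately have "int n * (int d + 1) - degr basis_poles \<le> int d * (int n - 1) + 1" using ell_x_poles_ge[of d] by linarith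
    then have "int n + int d \<le> 1 + degr basis_poles" by (simp add: algebra_simps)
    then show False using degr_basis_poles_nonneg by (simp add: d_def)
  qed
  then show ?thesis using degr_x_poles_le by simp
qed

lemma defect_x_poles_le: "defect (\<lambda>P. int d * x_poles P) \<le> degr basis_poles - int n"
  using ell_x_poles_ge[of d] degr_mult[OF Divs_x_poles, of "int d"] degr_x_poles by (simp add: defect_def algebra_simps)

text \<open>For exact degree e the zeros have degree at most n e, by the growth bound with
  denominator 1, while the poles amount to at least e times those of \<open>x\<close>, that is n e.
  For polynomials one inequality is thus available before the theorem on principal divisors.\<close>

lemma degr_poly_le:
  assumes p: "p \<in> polys d" "p \<noteq> \<zero>"
  shows "degr (\<lambda>P. v P p) \<le> 0"
proof -
  define e where "e = (LEAST e. p \<in> polys e)"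
  have e: "p \<in> polys e" "\<And>k. k < e \<Longrightarrow> p \<notin> polys k"
    unfolding e_def using p(1) by (rule LeastI) (rule not_less_Least)
  have pc: "p \<in> carrier F" using p polys_closed by blast
  have vp: "v P p \<le> max 0 (v P p) - int e * x_poles P" if P: "P \<in> Pl" for P
  proof (cases "v P x < 0")
    case True
    have "v P p = int e * v P x" using polys_v_exact[OF P True e(1) p(2)] e(2) by blast
    then show ?thesis using True by (simp add: x_poles_def)
  next
    case False
    then have "x_poles P = 0" by (simp add: x_poles_def)
    then show ?thesis by simp
  qed
  have d1: "(\<lambda>P. max 0 (v P p)) \<in> Divs"
    using Divs_principal[OF pc p(2)] unfolding Divs_def mem_Collect_eq by (rule finite_subset[rotated]) auto
  have "degr (\<lambda>P. v P p) \<le> degr (\<lambda>P. max 0 (v P p) - int e * x_poles P)"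
    using vp by (intro degr_mono Divs_diff Divs_mult Divs_x_poles d1 Divs_principal pc p(2)) auto
  also have "\<dots> = degr (\<lambda>P. max 0 (v P p)) - int e * int n"
    using degr_diff[OF d1 Divs_mult[OF Divs_x_poles, of "int e"]] degr_mult[OF Divs_x_poles, of "int e"] degr_x_poles by simp
  also have "\<dots> \<le> 0" using degr_zeros_le[OF pc p(2) growth_poly[OF e(1)]] by (simp add: mult.commute)
  finally show ?thesis .
qed

text \<open>Pigeonhole: with the degree of the place as degree bound there are \<open>Q\<close>
  times as many polynomials as residue classes, and two in one class differ by a zero.\<close>

lemma poly_zero_at_place:
  assumes P: "P \<in> Pl" "v P x \<ge> 0"
  shows "\<exists>d. \<exists>p \<in> polys d. p \<noteq> \<zero> \<and> v P p \<ge> 1"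
proof -
  let ?d = "place_degree F K P"
  have B: "x_poles P = 0" using P by (simp add: x_poles_def)
  have sub: "polys ?d \<subseteq> VR P" using polys_pw[OF P(1)] B pw_0[OF P(1)] by auto
  have "\<not> inj_on (\<lambda>p. P #>\<^bsub>add_monoid F\<^esub> p) (polys ?d)"
  proof
    assume inj: "inj_on (\<lambda>p. P #>\<^bsub>add_monoid F\<^esub> p) (polys ?d)"
    have fin: "finite ((\<lambda>p. P #>\<^bsub>add_monoid F\<^esub> p) ` VR P)"
      using card_residue_field(2)[OF P(1)] by (simp add: index_in_def card_gt_0_iff)
    have "card (polys ?d) \<le> card ((\<lambda>p. P #>\<^bsub>add_monoid F\<^esub> p) ` VR P)"
      using card_inj_on_le[OF inj _ fin] sub by blast
    then have "Q ^ Suc ?d \<le> Q ^ ?d"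
      using card_residue_field(1)[OF P(1)] by (simp add: index_in_def card_polys)
    then show False using Q_ge_2 by simp
  qed
  then obtain p p' where p: "p \<in> polys ?d" "p' \<in> polys ?d" "p \<noteq> p'"
    "P #>\<^bsub>add_monoid F\<^esub> p = P #>\<^bsub>add_monoid F\<^esub> p'" by (auto simp: inj_on_def)
  have c: "p \<in> carrier F" "p' \<in> carrier F" using p polys_closed by auto
  have "p \<ominus> p' \<in> pw P 1"
    using add.r_coset_eq_iff[OF pw_subgroup[OF P(1), of 1] c] p(4) pw_1[OF P(1)] by (simp add: a_minus_def)
  moreover have nz: "p \<ominus> p' \<noteq> \<zero>" using p c by simp
  moreover have "p \<ominus> p' \<in> polys ?d" using p polys_add polys_uminus by (simp add: a_minus_def)
  ultimately show ?thesis using c by (intro exI[of _ ?d] bexI[of _ "p \<ominus> p'"]) (simp_all add: pw_iff)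
qed

lemma poly_v_nonneg:
  assumes "P \<in> Pl" "v P x \<ge> 0" "p \<in> polys d" "p \<noteq> \<zero>"
  shows "v P p \<ge> 0"
  using polys_pw[OF assms(1,3)] assms polys_closed[OF assms(3)] by (simp add: pw_iff x_poles_def)

lemma poly_zeros:
  assumes "finite T" "T \<subseteq> {P \<in> Pl. v P x \<ge> 0}"
  shows "\<exists>d. \<exists>p \<in> polys d. p \<noteq> \<zero> \<and> (\<forall>P \<in> T. v P p \<ge> E P)"
  using assms
proof (induction T rule: finite_induct)
  case empty
  then show ?case by (intro exI[of _ 0] bexI[of _ \<one>]) auto
next
  case (insert P T)
  obtain d p where p: "p \<in> polys d" "p \<noteq> \<zero>" "\<And>R. R \<in> T \<Longrightarrow> v R p \<ge> E R" using insert by auto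
  have P: "P \<in> Pl" "v P x \<ge> 0" using insert by auto
  obtain e r where r: "r \<in> polys e" "r \<noteq> \<zero>" "v P r \<ge> 1" using poly_zero_at_place[OF P] by blast
  have c: "p \<in> carrier F" "r \<in> carrier F" using p r polys_closed by auto
  define k where "k = nat (E P)"
  have rk: "r [^] k \<in> polys (e * k)" for k :: nat
  proof (induction k)
    case (Suc k)
    then show ?case using polys_mult[OF Suc r(1)] by (simp add: add.commute)
  qed (auto intro: polys_const)
  have rk': "r [^] k \<in> carrier F" "r [^] k \<noteq> \<zero>" using c r by auto
  have vm: "v R (p \<otimes> r [^] k) = v R p + v R (r [^] k)" if "R \<in> Pl" for R
    using v_mult[OF that c(1) p(2) rk'] .
  show ?case
  proof (intro exI bexI conjI ballI)
    show "p \<otimes> r [^] k \<in> polys (d + e * k)" using polys_mult[OF p(1) rk] .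
    show "p \<otimes> r [^] k \<noteq> \<zero>" using c p rk' by simp
    fix R assume R: "R \<in> insert P T"
    then have RP: "R \<in> Pl" "v R x \<ge> 0" using insert.prems by auto
    show "v R (p \<otimes> r [^] k) \<ge> E R"
    proof (cases "R = P")
      case True
      have "int k * 1 \<le> int k * v P r" using r(3) by (intro mult_left_mono) auto
      moreover have "E P \<le> int k" by (simp add: k_def)
      ultimately have "v P (r [^] k) \<ge> E P" using v_nat_pow[OF P(1) c(2) r(2), of k] by linarith
      then show ?thesis using vm[OF P(1)] poly_v_nonneg[OF P p(1,2)] True by simp
    next
      case False
      then show ?thesis using vm[OF RP(1)] poly_v_nonneg[OF RP rk rk'(2)] p(3)[of R] R by simp
    qed
  qed
qed

text \<open>Riemann's theorem: multiplying by a polynomial in \<open>x\<close> moves the positive part of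
  any divisor to the poles of \<open>x\<close> without decreasing the degree.\<close>

theorem defect_bounded:
  assumes E: "E \<in> Divs"
  shows "defect E \<le> degr basis_poles - int n"
proof -
  let ?T = "{P \<in> Pl. E P \<noteq> 0 \<and> v P x \<ge> 0}"
  have finE: "finite {P \<in> Pl. E P \<noteq> 0}" using E by (simp add: Divs_def)
  have "finite ?T" using finE by (rule finite_subset[rotated]) auto
  then obtain d p where p: "p \<in> polys d" "p \<noteq> \<zero>" "\<And>P. P \<in> ?T \<Longrightarrow> v P p \<ge> E P"
    using poly_zeros[of ?T E] by auto
  have pc: "p \<in> carrier F" using p polys_closed by blast
  \<comment> \<open>At a pole of \<open>x\<close> the polynomial contributes at most
    \<open>d\<close> times the pole order of \<open>x\<close>, and the positive part of
    \<open>E\<close> is covered by the other summand because that order is at least 1.\<close>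
  define k where "k = d + nat (Max (insert 0 (E ` {P \<in> Pl. E P \<noteq> 0})))"
  have k: "E P + int d \<le> int k" if "P \<in> Pl" for P
  proof -
    have "E P \<le> Max (insert 0 (E ` {P \<in> Pl. E P \<noteq> 0}))"
      using finE that by (cases "E P = 0") (auto intro!: Max_ge)
    then show ?thesis by (simp add: k_def)
  qed
  let ?E = "\<lambda>P. E P - v P p"
  have dE: "?E \<in> Divs" using Divs_diff[OF E Divs_principal[OF pc p(2)]] .
  have le: "?E P \<le> int k * x_poles P" if P: "P \<in> Pl" for P
  proof (cases "v P x < 0")
    case True
    then have B: "x_poles P \<ge> 1" by (simp add: x_poles_def)
    have "v P p \<ge> - (int d * x_poles P)" using polys_pw[OF P p(1)] pc p(2) by (simp add: pw_iff)
    moreover have "int (k - d) * 1 \<le> int (k - d) * x_poles P" using B by (intro mult_left_mono) auto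
    moreover have "int (k - d) = int k - int d" by (simp add: k_def)
    ultimately show ?thesis using k[OF P] by (simp add: left_diff_distrib)
  next
    case False
    then have B: "x_poles P = 0" and nn: "v P p \<ge> 0"
      using poly_v_nonneg[OF P _ p(1,2)] by (auto simp: x_poles_def)
    show ?thesis using p(3)[of P] nn B P False by (cases "E P = 0") auto
  qed
  \<comment> \<open>The dimension is unchanged and the degree does not drop, since the divisor of
    \<open>p\<close> has degree at most 0.\<close>
  have "defect E \<le> defect ?E"
    using ell_principal[OF pc p(2) E] degr_diff[OF E Divs_principal[OF pc p(2)]] degr_poly_le[OF p(1,2)]
    by (simp add: defect_def)
  also have "\<dots> \<le> defect (\<lambda>P. int k * x_poles P)" by (rule index_AS_diag(1)[OF dE Divs_mult[OF Divs_x_poles] le])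
  also have "\<dots> \<le> degr basis_poles - int n" by (rule defect_x_poles_le)
  finally show ?thesis .
qed

text \<open>The inverse powers of the principal divisor are equivalent to 0, so of dimension 1. With
  negative degree of \<open>f\<close> their degrees would grow without bound, against the bound on
  the defect.\<close>

lemma degr_principal_nonneg:
  assumes f: "f \<in> carrier F" "f \<noteq> \<zero>"
  shows "degr (\<lambda>P. v P f) \<ge> 0"
proof (rule ccontr)
  assume neg: "\<not> ?thesis"
  define m where "m = nat (degr basis_poles + 2)"
  let ?E = "\<lambda>P. 0 - v P (f [^] m)"
  have fm: "f [^] m \<in> carrier F" "f [^] m \<noteq> \<zero>" using f by auto
  have dE: "?E \<in> Divs" using Divs_diff[OF Divs_zero Divs_principal[OF fm]] .
  have "degr ?E = degr (\<lambda>P. (- int m) * v P f)"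
    unfolding degr_def by (rule sum.cong) (auto simp: v_nat_pow[OF _ f])
  then have "degr ?E = - int m * degr (\<lambda>P. v P f)" using degr_mult[OF Divs_principal[OF f]] by metis
  moreover have "int m * 1 \<le> int m * (- degr (\<lambda>P. v P f))" using neg by (intro mult_left_mono) auto
  moreover have "ell ?E = 1" using ell_principal[OF fm Divs_zero] ell_zero by simp
  ultimately have "int m - 1 \<le> defect ?E" by (simp add: defect_def)
  then show False using defect_bounded[OF dE] degr_basis_poles_nonneg by (simp add: m_def)
qed

theorem degr_principal:
  assumes f: "f \<in> carrier F" "f \<noteq> \<zero>"
  shows "degr (\<lambda>P. v P f) = 0"
proof -
  have "degr (\<lambda>P. v P (inv f)) = degr (\<lambda>P. (-1) * v P f)"
    unfolding degr_def by (rule sum.cong) (auto simp: v_inv f)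
  then have "degr (\<lambda>P. v P (inv f)) = - degr (\<lambda>P. v P f)" using degr_mult[OF Divs_principal[OF f], of "-1"] by simp
  then show ?thesis using degr_principal_nonneg[OF f] degr_principal_nonneg[of "inv f"] f by simp
qed

lemma LS_negative_degree:
  assumes E: "E \<in> Divs" "degr E < 0"
  shows "LS Pl E = {\<zero>}"
proof -
  have "f = \<zero>" if "f \<in> LS Pl E" for f
  proof (rule ccontr)
    assume nz: "f \<noteq> \<zero>"
    have fc: "f \<in> carrier F" and fp: "\<And>P. P \<in> Pl \<Longrightarrow> f \<in> pw P (- E P)" using that by (auto simp: LS_def)
    have "degr (\<lambda>P. - E P) \<le> degr (\<lambda>P. v P f)"
      using fp fc nz Divs_mult[OF E(1), of "-1"] by (intro degr_mono Divs_principal) (auto simp: pw_iff)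
    then show False using degr_principal[OF fc nz] degr_mult[OF E(1), of "-1"] E(2) by simp
  qed
  moreover have "\<zero> \<in> LS Pl E" by (simp add: LS_def)
  ultimately show ?thesis by blast
qed

lemma ell_negative_degree: "E \<in> Divs \<Longrightarrow> degr E < 0 \<Longrightarrow> ell E = 0"
  using card_LS[of E] LS_negative_degree[of E] Q_ge_2 by (cases "ell E") auto

end

section \<open>The theorem of Riemann and Roch in large degree\<close>

context global_function_field begin

section \<open>Maximal defect and the group of adeles\<close>

lemma exists_max_defect: "\<exists>E \<in> Divs. \<forall>E' \<in> Divs. defect E' \<le> defect E"
proof -
  let ?b = "degr basis_poles - int n"
  obtain E where E: "E \<in> Divs" "\<And>E'. E' \<in> Divs \<Longrightarrow> nat (?b - defect E) \<le> nat (?b - defect E')"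
    using ex_has_least_nat[of "\<lambda>E. E \<in> Divs" "\<lambda>P. 0" "\<lambda>E. nat (?b - defect E)"] Divs_zero by blast
  then have "defect E' \<le> defect E" if "E' \<in> Divs" for E'
    using E(2)[OF that] defect_bounded[OF that] defect_bounded[OF E(1)] by linarith
  then show ?thesis using E(1) by blast
qed

definition max_div :: "'a set \<Rightarrow> int" where
  "max_div = (SOME E. E \<in> Divs \<and> (\<forall>E' \<in> Divs. defect E' \<le> defect E))"

lemma max_div: "max_div \<in> Divs" "E \<in> Divs \<Longrightarrow> defect E \<le> defect max_div"
  using someI_ex[of "\<lambda>E. E \<in> Divs \<and> (\<forall>E' \<in> Divs. defect E' \<le> defect E)"] exists_max_defect
  unfolding max_div_def by blast+

text \<open>The usual adeles: families that are integral outside finitely many places. Letting the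
  divisor vary makes the group closed under multiplication by functions.\<close>

definition adele_ring :: "('a set \<Rightarrow> 'a) set" where
  "adele_ring = (\<Union>E \<in> Divs. AS Pl E)"

lemma Divs_max: "E \<in> Divs \<Longrightarrow> E' \<in> Divs \<Longrightarrow> (\<lambda>P. max (E P) (E' P)) \<in> Divs"
proof -
  assume "E \<in> Divs" "E' \<in> Divs"
  then have "finite ({P \<in> Pl. E P \<noteq> 0} \<union> {P \<in> Pl. E' P \<noteq> 0})" by (simp add: Divs_def)
  then show ?thesis unfolding Divs_def mem_Collect_eq by (rule finite_subset[rotated]) (auto simp: max_def)
qed

lemma subgroup_AS_DF: "subgroup (AS Pl E <#>\<^bsub>AA\<^esub> DF) AA"
  using AA.subgroup_set_mult[OF subgroup_AS[OF subset_refl] subgroup_diag[OF subgroup_carrier]] .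

lemma AS_subset_DF: "AS Pl E \<subseteq> AS Pl E <#>\<^bsub>AA\<^esub> DF"
proof
  fix \<alpha> assume "\<alpha> \<in> AS Pl E"
  moreover have "\<alpha> = \<alpha> \<otimes>\<^bsub>AA\<^esub> (\<lambda>P. \<zero>)" using calculation by (auto simp: AS_def)
  moreover have "(\<lambda>P. \<zero>) \<in> DF" by (auto simp: diag_def)
  ultimately show "\<alpha> \<in> AS Pl E <#>\<^bsub>AA\<^esub> DF" unfolding set_mult_def by blast
qed

lemma DF_subset_adele_ring: "DF \<subseteq> adele_ring"
proof
  fix \<alpha> assume "\<alpha> \<in> DF"
  then obtain f where f: "f \<in> carrier F" "\<alpha> = (\<lambda>P. f)" by (auto simp: diag_def)
  show "\<alpha> \<in> adele_ring"
  proof (cases "f = \<zero>")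
    case True
    then have "\<alpha> \<in> AS Pl (\<lambda>P. 0)" using f by (auto simp: AS_def)
    then show ?thesis using Divs_zero by (auto simp: adele_ring_def)
  next
    case False
    then have "\<alpha> \<in> AS Pl (\<lambda>P. 0 - v P f)" using f by (auto simp: AS_def pw_iff)
    then show ?thesis using Divs_diff[OF Divs_zero Divs_principal[OF f(1) False]] unfolding adele_ring_def by blast
  qed
qed

lemma subgroup_adele_ring: "subgroup adele_ring AA"
proof (rule AA.subgroupI)
  show "adele_ring \<subseteq> carrier AA" by (auto simp: adele_ring_def AS_def)
  show "adele_ring \<noteq> {}" using DF_subset_adele_ring by (auto simp: diag_def)
  fix a assume "a \<in> adele_ring"
  then obtain E where E: "E \<in> Divs" "a \<in> AS Pl E" by (auto simp: adele_ring_def)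
  have "inv\<^bsub>AA\<^esub> a \<in> AS Pl E" using subgroup.m_inv_closed[OF subgroup_AS[OF subset_refl] E(2)] .
  then show "inv\<^bsub>AA\<^esub> a \<in> adele_ring" using E(1) unfolding adele_ring_def by blast
  fix b assume "b \<in> adele_ring"
  then obtain E' where E': "E' \<in> Divs" "b \<in> AS Pl E'" by (auto simp: adele_ring_def)
  let ?M = "\<lambda>P. max (E P) (E' P)"
  have "a \<in> AS Pl ?M" "b \<in> AS Pl ?M" using E(2) E'(2) AS_mono[of Pl E ?M] AS_mono[of Pl E' ?M] by auto
  then have "a \<otimes>\<^bsub>AA\<^esub> b \<in> AS Pl ?M" by (rule subgroup.m_closed[OF subgroup_AS[OF subset_refl]])
  then show "a \<otimes>\<^bsub>AA\<^esub> b \<in> adele_ring" using Divs_max[OF E(1) E'(1)] unfolding adele_ring_def by blast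
qed

text \<open>At maximal defect, enlarging the divisor leaves the defect and thus the sum with the
  diagonal unchanged; every adele is bounded by some larger divisor.\<close>

lemma adele_ring_eq:
  assumes E: "E \<in> Divs" "defect E = defect max_div"
  shows "adele_ring = AS Pl E <#>\<^bsub>AA\<^esub> DF"
proof
  show "AS Pl E <#>\<^bsub>AA\<^esub> DF \<subseteq> adele_ring"
  proof
    fix \<alpha> assume "\<alpha> \<in> AS Pl E <#>\<^bsub>AA\<^esub> DF"
    then obtain a d where ad: "a \<in> AS Pl E" "d \<in> DF" "\<alpha> = a \<otimes>\<^bsub>AA\<^esub> d" unfolding set_mult_def by blast
    have "a \<in> adele_ring" "d \<in> adele_ring" using ad E(1) DF_subset_adele_ring unfolding adele_ring_def by blast+
    then show "\<alpha> \<in> adele_ring" unfolding ad(3) by (rule subgroup.m_closed[OF subgroup_adele_ring])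
  qed
  show "adele_ring \<subseteq> AS Pl E <#>\<^bsub>AA\<^esub> DF"
  proof
    fix \<alpha> assume "\<alpha> \<in> adele_ring"
    then obtain E2 where E2: "E2 \<in> Divs" "\<alpha> \<in> AS Pl E2" by (auto simp: adele_ring_def)
    let ?M = "\<lambda>P. max (E P) (E2 P)"
    have M: "?M \<in> Divs" using Divs_max[OF E(1) E2(1)] .
    have "defect E \<le> defect ?M" by (rule index_AS_diag(1)[OF E(1) M]) simp
    then have "defect ?M - defect E = 0" using max_div(2)[OF M] E(2) by simp
    then have "index_in AA (AS Pl ?M <#>\<^bsub>AA\<^esub> DF) (AS Pl E <#>\<^bsub>AA\<^esub> DF) = 1"
      using index_AS_diag(2)[OF E(1) M] by simp
    then have "AS Pl ?M <#>\<^bsub>AA\<^esub> DF \<subseteq> AS Pl E <#>\<^bsub>AA\<^esub> DF"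
      using AA.index_in_eq_1D[OF subgroup_AS_DF subgroup_AS_DF] by blast
    moreover have "\<alpha> \<in> AS Pl ?M" using E2(2) AS_mono[of Pl E2 ?M] by auto
    ultimately show "\<alpha> \<in> AS Pl E <#>\<^bsub>AA\<^esub> DF" using AS_subset_DF by blast
  qed
qed

text \<open>The exponent is the index of speciality of \<open>E\<close>, here obtained as the size
  of a quotient of adeles.\<close>

lemma index_adele_ring:
  assumes E: "E \<in> Divs"
  shows "index_in AA adele_ring (AS Pl E <#>\<^bsub>AA\<^esub> DF) = Q ^ nat (defect max_div - defect E)" "AS Pl E <#>\<^bsub>AA\<^esub> DF \<subseteq> adele_ring"
proof -
  let ?M = "\<lambda>P. max (max_div P) (E P)"
  have M: "?M \<in> Divs" using Divs_max[OF max_div(1) E] .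
  have "defect max_div \<le> defect ?M" by (rule index_AS_diag(1)[OF max_div(1) M]) simp
  then have c: "defect ?M = defect max_div" using max_div(2)[OF M] by simp
  show "index_in AA adele_ring (AS Pl E <#>\<^bsub>AA\<^esub> DF) = Q ^ nat (defect max_div - defect E)"
    using index_AS_diag(2)[OF E M] c adele_ring_eq[OF M c] by simp
  have "AS Pl E \<subseteq> AS Pl ?M" by (rule AS_mono) simp
  then show "AS Pl E <#>\<^bsub>AA\<^esub> DF \<subseteq> adele_ring" unfolding adele_ring_eq[OF M c] set_mult_def by blast
qed

section \<open>Multiplication of adeles by functions\<close>

definition amul :: "'a \<Rightarrow> ('a set \<Rightarrow> 'a) \<Rightarrow> ('a set \<Rightarrow> 'a)" where
  "amul f \<alpha> = (\<lambda>P. f \<otimes> \<alpha> P)"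

lemma amul_closed: "f \<in> carrier F \<Longrightarrow> \<alpha> \<in> carrier AA \<Longrightarrow> amul f \<alpha> \<in> carrier AA"
  by (simp add: amul_def)

lemma amul_add:
  "f \<in> carrier F \<Longrightarrow> \<alpha> \<in> carrier AA \<Longrightarrow> \<beta> \<in> carrier AA \<Longrightarrow> amul f (\<alpha> \<otimes>\<^bsub>AA\<^esub> \<beta>) = amul f \<alpha> \<otimes>\<^bsub>AA\<^esub> amul f \<beta>"
  by (auto simp: amul_def r_distr)

lemma amul_add_left:
  "f \<in> carrier F \<Longrightarrow> g \<in> carrier F \<Longrightarrow> \<alpha> \<in> carrier AA \<Longrightarrow> amul (f \<oplus> g) \<alpha> = amul f \<alpha> \<otimes>\<^bsub>AA\<^esub> amul g \<alpha>"
  by (auto simp: amul_def l_distr)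

lemma amul_inv: "f \<in> carrier F \<Longrightarrow> \<alpha> \<in> carrier AA \<Longrightarrow> amul f (inv\<^bsub>AA\<^esub> \<alpha>) = inv\<^bsub>AA\<^esub> (amul f \<alpha>)"
  using AA_inv[of \<alpha>] AA_inv[of "amul f \<alpha>"] by (auto simp: amul_def r_minus)

lemma amul_inv_left: "f \<in> carrier F \<Longrightarrow> \<alpha> \<in> carrier AA \<Longrightarrow> amul (\<ominus> f) \<alpha> = inv\<^bsub>AA\<^esub> (amul f \<alpha>)"
  using AA_inv[of "amul f \<alpha>"] by (auto simp: amul_def l_minus)

lemma amul_AS:
  assumes f: "f \<in> LS Pl B" and a: "\<alpha> \<in> AS Pl (\<lambda>P. E P - B P)"
  shows "amul f \<alpha> \<in> AS Pl E"
proof -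
  have "f \<otimes> \<alpha> P \<in> pw P (- E P)" if P: "P \<in> Pl" for P
    using pw_mult[OF P, of f "- B P" "\<alpha> P" "- (E P - B P)"] f a P by (auto simp: LS_def AS_def)
  then show ?thesis using f a by (auto simp: AS_def amul_def LS_def)
qed

lemma amul_AS_DF:
  assumes f: "f \<in> LS Pl B" and a: "\<alpha> \<in> AS Pl (\<lambda>P. E P - B P) <#>\<^bsub>AA\<^esub> DF"
  shows "amul f \<alpha> \<in> AS Pl E <#>\<^bsub>AA\<^esub> DF"
proof -
  obtain b d where b: "b \<in> AS Pl (\<lambda>P. E P - B P)" "d \<in> DF" "\<alpha> = b \<otimes>\<^bsub>AA\<^esub> d"
    using a unfolding set_mult_def by blast
  have fc: "f \<in> carrier F" using f by (simp add: LS_def)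
  have "amul f d \<in> DF" using b(2) fc by (auto simp: diag_def amul_def)
  moreover have "amul f \<alpha> = amul f b \<otimes>\<^bsub>AA\<^esub> amul f d"
    unfolding b(3) using b fc by (intro amul_add) (auto simp: AS_def diag_def)
  ultimately show ?thesis using amul_AS[OF f b(1)] unfolding set_mult_def by blast
qed

lemma amul_adele_ring:
  assumes f: "f \<in> carrier F" and a: "\<alpha> \<in> adele_ring"
  shows "amul f \<alpha> \<in> adele_ring"
proof -
  obtain E where E: "E \<in> Divs" "\<alpha> \<in> AS Pl E" using a by (auto simp: adele_ring_def)
  show ?thesis
  proof (cases "f = \<zero>")
    case True
    have "amul f \<alpha> = (\<lambda>P. \<zero>)" using E True by (auto simp: amul_def AS_def)
    then show ?thesis using DF_subset_adele_ring by (auto simp: diag_def)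
  next
    case False
    let ?B = "\<lambda>P. 0 - v P f"
    have B: "?B \<in> Divs" using Divs_diff[OF Divs_zero Divs_principal[OF f False]] .
    have "f \<in> LS Pl ?B" using f False by (simp add: LS_def pw_iff)
    moreover have "\<alpha> \<in> AS Pl (\<lambda>P. (E P + ?B P) - ?B P)" using E by simp
    ultimately have "amul f \<alpha> \<in> AS Pl (\<lambda>P. E P + ?B P)" by (rule amul_AS)
    then show ?thesis using Divs_add[OF E(1) B] unfolding adele_ring_def by blast
  qed
qed

text \<open>Multiplication by a nonzero \<open>f\<close> is onto \<open>adele_ring / (AS E + DF)\<close>, so counting the pairs
  \<open>(f, \<alpha>)\<close> with \<open>f \<alpha> \<in> AS E + DF\<close> in two ways bounds \<open>LS B\<close>; this replaces
  the space of Weil differentials.\<close>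

lemma ell_le_of_index_gt_1:
  assumes E: "E \<in> Divs" and B: "B \<in> Divs" and gt: "defect E < defect max_div"
  shows "int (ell B) \<le> defect max_div - defect (\<lambda>P. E P - B P)"
proof -
  let ?N1 = "AS Pl (\<lambda>P. E P - B P) <#>\<^bsub>AA\<^esub> DF" and ?N2 = "AS Pl E <#>\<^bsub>AA\<^esub> DF"
  let ?L = "LS Pl B"
  have EB: "(\<lambda>P. E P - B P) \<in> Divs" using Divs_diff[OF E B] .
  define a where "a = index_in AA adele_ring ?N1"
  define h where "h = index_in AA adele_ring ?N2"
  have N1: "subgroup ?N1 AA" "?N1 \<subseteq> adele_ring" and N2: "subgroup ?N2 AA" "?N2 \<subseteq> adele_ring"
    using subgroup_AS_DF index_adele_ring(2)[OF EB] index_adele_ring(2)[OF E] by auto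
  have a: "a = Q ^ nat (defect max_div - defect (\<lambda>P. E P - B P))" and h: "h = Q ^ nat (defect max_div - defect E)"
    using index_adele_ring(1)[OF EB] index_adele_ring(1)[OF E] by (simp_all add: a_def h_def)
  have h1: "h > 1" unfolding h using gt Q_ge_2 by (intro one_less_power) auto
  have AFc: "\<And>\<alpha>. \<alpha> \<in> adele_ring \<Longrightarrow> \<alpha> \<in> carrier AA" using subgroup.mem_carrier[OF subgroup_adele_ring] .
  have finL: "finite ?L" using finite_LS[OF B] .
  have Lc: "\<And>f. f \<in> ?L \<Longrightarrow> f \<in> carrier F" by (simp add: LS_def)
  have L0: "\<zero> \<in> ?L" by (simp add: LS_def)
  define l where "l = card ?L"
  obtain T where T: "T \<subseteq> adele_ring" "card T = a" "inj_on (\<lambda>\<alpha>. ?N1 #>\<^bsub>AA\<^esub> \<alpha>) T"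
    "\<forall>\<alpha>\<in>adele_ring. \<exists>t\<in>T. ?N1 #>\<^bsub>AA\<^esub> \<alpha> = ?N1 #>\<^bsub>AA\<^esub> t"
    using AA.index_in_transversal[of adele_ring ?N1] unfolding a_def by blast
  have apos: "a > 0" unfolding a using Q_ge_2 by simp
  then have finT: "finite T" using T(2) card_ge_0_finite by blast

  \<comment> \<open>Multiplication by \<open>f\<close> is invertible on the adeles, so the preimage
    of \<open>?N2\<close> again has index \<open>h\<close>. It contains \<open>?N1\<close>, and
    therefore a / h of the \<open>a\<close> representatives lie in it.\<close>
  have count_f: "h * card {\<alpha> \<in> T. amul f \<alpha> \<in> ?N2} = a" if f: "f \<in> ?L" "f \<noteq> \<zero>" for f
  proof -
    let ?M = "{\<alpha> \<in> adele_ring. amul f \<alpha> \<in> ?N2}"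
    have fc: "f \<in> carrier F" using Lc f by blast
    have M: "subgroup ?M AA"
    proof (rule AA.subgroupI)
      show "?M \<subseteq> carrier AA" using AFc by blast
      have "(\<lambda>P. \<zero>) \<in> ?N1" using subgroup.one_closed[OF N1(1)] by simp
      then show "?M \<noteq> {}" using amul_AS_DF[OF f(1)] N1(2) by blast
      fix \<alpha> assume "\<alpha> \<in> ?M"
      then have a: "\<alpha> \<in> adele_ring" "amul f \<alpha> \<in> ?N2" by simp_all
      show "inv\<^bsub>AA\<^esub> \<alpha> \<in> ?M"
        using subgroup.m_inv_closed[OF subgroup_adele_ring a(1)] subgroup.m_inv_closed[OF N2(1) a(2)]
          amul_inv[OF fc AFc[OF a(1)]] by simp
      fix \<beta> assume "\<beta> \<in> ?M"
      then have b: "\<beta> \<in> adele_ring" "amul f \<beta> \<in> ?N2" by simp_all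
      show "\<alpha> \<otimes>\<^bsub>AA\<^esub> \<beta> \<in> ?M"
        using subgroup.m_closed[OF subgroup_adele_ring a(1) b(1)] subgroup.m_closed[OF N2(1) a(2) b(2)]
          amul_add[OF fc AFc[OF a(1)] AFc[OF b(1)]] by (simp del: AA_simps)
    qed
    have sub: "?N1 \<subseteq> ?M" using amul_AS_DF[OF f(1)] N1(2) by blast
    have "index_in AA adele_ring ?M = h"
      unfolding h_def index_in_def
    proof (rule card_image_transfer[where f = "amul f"])
      fix \<alpha> \<beta> assume ab: "\<alpha> \<in> adele_ring" "\<beta> \<in> adele_ring"
      have c: "\<alpha> \<in> carrier AA" "\<beta> \<in> carrier AA" using ab AFc by blast+
      have "amul f (\<alpha> \<otimes>\<^bsub>AA\<^esub> inv\<^bsub>AA\<^esub> \<beta>) = amul f \<alpha> \<otimes>\<^bsub>AA\<^esub> inv\<^bsub>AA\<^esub> (amul f \<beta>)"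
        using amul_add[OF fc c(1) AA.inv_closed[OF c(2)]] amul_inv[OF fc c(2)] by simp
      moreover have "\<alpha> \<otimes>\<^bsub>AA\<^esub> inv\<^bsub>AA\<^esub> \<beta> \<in> adele_ring"
        using subgroup.m_closed[OF subgroup_adele_ring ab(1) subgroup.m_inv_closed[OF subgroup_adele_ring ab(2)]] .
      ultimately show "?M #>\<^bsub>AA\<^esub> \<alpha> = ?M #>\<^bsub>AA\<^esub> \<beta> \<longleftrightarrow> ?N2 #>\<^bsub>AA\<^esub> amul f \<alpha> = ?N2 #>\<^bsub>AA\<^esub> amul f \<beta>"
        unfolding AA.r_coset_eq_iff[OF M c] AA.r_coset_eq_iff[OF N2(1) amul_closed[OF fc c(1)] amul_closed[OF fc c(2)]]
        by (simp del: AA_simps)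
    next
      fix \<alpha> assume "\<alpha> \<in> adele_ring"
      then show "amul f \<alpha> \<in> adele_ring" by (rule amul_adele_ring[OF fc])
    next
      fix \<beta> assume b: "\<beta> \<in> adele_ring"
      have "amul (inv f) \<beta> \<in> adele_ring" using amul_adele_ring[OF _ b, of "inv f"] fc f by simp
      moreover have "amul f (amul (inv f) \<beta>) = \<beta>"
        using AFc[OF b] fc f by (auto simp: amul_def m_assoc[symmetric])
      ultimately show "\<exists>\<alpha>\<in>adele_ring. ?N2 #>\<^bsub>AA\<^esub> amul f \<alpha> = ?N2 #>\<^bsub>AA\<^esub> \<beta>" by force
    qed
    moreover have "index_in AA ?M ?N1 = card {\<alpha> \<in> T. amul f \<alpha> \<in> ?N2}"
    proof -
      let ?T = "{\<alpha> \<in> T. amul f \<alpha> \<in> ?N2}"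
      have "card ((\<lambda>\<alpha>. \<alpha>) ` ?T) = card ((\<lambda>\<alpha>. ?N1 #>\<^bsub>AA\<^esub> \<alpha>) ` ?M)"
      proof (rule card_image_transfer[where f = "\<lambda>\<alpha>. \<alpha>"])
        fix \<alpha> \<beta> assume "\<alpha> \<in> ?T" "\<beta> \<in> ?T"
        then have "\<alpha> \<in> T" "\<beta> \<in> T" by simp_all
        then show "\<alpha> = \<beta> \<longleftrightarrow> ?N1 #>\<^bsub>AA\<^esub> \<alpha> = ?N1 #>\<^bsub>AA\<^esub> \<beta>" by (rule inj_on_eq_iff[OF T(3), symmetric])
      next
        fix \<alpha> assume "\<alpha> \<in> ?T"
        then show "\<alpha> \<in> ?M" using subsetD[OF T(1), of \<alpha>] by simp
      next
        fix \<alpha> assume al: "\<alpha> \<in> ?M"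
        then obtain t where t: "t \<in> T" "?N1 #>\<^bsub>AA\<^esub> \<alpha> = ?N1 #>\<^bsub>AA\<^esub> t" using T(4) by blast
        have c: "\<alpha> \<in> carrier AA" "t \<in> carrier AA" using al t T(1) AFc by blast+
        have "t \<otimes>\<^bsub>AA\<^esub> inv\<^bsub>AA\<^esub> \<alpha> \<in> ?N1" using AA.r_coset_eq_iff[OF N1(1) c(2,1)] t(2) by simp
        then have "t \<otimes>\<^bsub>AA\<^esub> inv\<^bsub>AA\<^esub> \<alpha> \<in> ?M" using sub by (rule subsetD[rotated])
        then have "t \<otimes>\<^bsub>AA\<^esub> inv\<^bsub>AA\<^esub> \<alpha> \<otimes>\<^bsub>AA\<^esub> \<alpha> \<in> ?M" using al by (rule subgroup.m_closed[OF M])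
        moreover have "t \<otimes>\<^bsub>AA\<^esub> inv\<^bsub>AA\<^esub> \<alpha> \<otimes>\<^bsub>AA\<^esub> \<alpha> = t"
          using AA.m_assoc[OF c(2) AA.inv_closed[OF c(1)] c(1)] AA.l_inv[OF c(1)] AA.r_one[OF c(2)] by metis
        ultimately have "t \<in> ?T" using t(1) by simp
        then show "\<exists>x\<in>?T. ?N1 #>\<^bsub>AA\<^esub> x = ?N1 #>\<^bsub>AA\<^esub> \<alpha>" using t(2) by (intro bexI[of _ t]) simp_all
      qed
      then show ?thesis by (simp add: index_in_def)
    qed
    moreover have "index_in AA adele_ring ?N1 = index_in AA adele_ring ?M * index_in AA ?M ?N1"
      using AA.index_in_tower[OF subgroup_adele_ring M N1(1) sub] by blast
    ultimately show ?thesis by (simp add: a_def)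
  qed

  \<comment> \<open>With \<open>\<alpha>\<close> fixed, multiplication is a homomorphism from
    \<open>?L\<close> into a group of \<open>h\<close> elements, so its kernel has at least l / h
    elements.\<close>
  have count_alpha: "l \<le> h * card {f \<in> ?L. amul f \<alpha> \<in> ?N2}" if al: "\<alpha> \<in> adele_ring" for \<alpha>
  proof -
    let ?L' = "{f \<in> ?L. amul f \<alpha> \<in> ?N2}"
    have ac: "\<alpha> \<in> carrier AA" using AFc al .
    have Lsg: "subgroup ?L (add_monoid F)" using subgroup_LS[OF subset_refl] .
    note Lcl = add_subgroup_closed[OF Lsg]
    have diff: "amul (f \<oplus> \<ominus> g) \<alpha> = amul f \<alpha> \<otimes>\<^bsub>AA\<^esub> inv\<^bsub>AA\<^esub> (amul g \<alpha>)"
      if "f \<in> carrier F" "g \<in> carrier F" for f g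
      using amul_add_left[of f "\<ominus> g" \<alpha>] amul_inv_left[of g \<alpha>] that ac by (simp del: AA_simps)
    have L': "subgroup ?L' (add_monoid F)"
    proof (rule add.subgroupI)
      show "?L' \<subseteq> carrier F" using Lc by blast
      have "amul \<zero> \<alpha> = \<one>\<^bsub>AA\<^esub>" using ac by (auto simp: amul_def)
      then have "\<zero> \<in> ?L'" using L0 subgroup.one_closed[OF N2(1)] by (simp del: AA_simps)
      then show "?L' \<noteq> {}" by blast
      fix f assume "f \<in> ?L'"
      then have f: "f \<in> ?L" "amul f \<alpha> \<in> ?N2" by simp_all
      show "\<ominus> f \<in> ?L'"
        using Lcl(4)[OF f(1)] subgroup.m_inv_closed[OF N2(1) f(2)] amul_inv_left[OF Lc[OF f(1)] ac] by simp
      fix g assume "g \<in> ?L'"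
      then have g: "g \<in> ?L" "amul g \<alpha> \<in> ?N2" by simp_all
      show "f \<oplus> g \<in> ?L'"
        using Lcl(3)[OF f(1) g(1)] subgroup.m_closed[OF N2(1) f(2) g(2)]
          amul_add_left[OF Lc[OF f(1)] Lc[OF g(1)] ac] by (simp del: AA_simps)
    qed
    have z: "subgroup {\<zero>} (add_monoid F)" using add.triv_subgroup by simp
    have "\<zero> \<in> ?L'" using add_subgroup_closed(2)[OF L'] .
    then have "l = idx ?L ?L' * card ?L'"
      using add.index_in_tower[OF Lsg L' z] add.index_in_one[OF Lsg] add.index_in_one[OF L'] unfolding l_def by auto
    moreover have "idx ?L ?L' \<le> h"
    proof -
      have "idx ?L ?L' = card ((\<lambda>f. ?N2 #>\<^bsub>AA\<^esub> amul f \<alpha>) ` ?L)"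
        unfolding index_in_def
      proof (rule card_image_transfer[where f = "\<lambda>f. f"])
        fix f g assume fg: "f \<in> ?L" "g \<in> ?L"
        have "f \<oplus> \<ominus> g \<in> ?L" using Lcl fg by blast
        then have "f \<oplus> \<ominus> g \<in> ?L' \<longleftrightarrow> amul f \<alpha> \<otimes>\<^bsub>AA\<^esub> inv\<^bsub>AA\<^esub> (amul g \<alpha>) \<in> ?N2"
          using diff[OF Lc[OF fg(1)] Lc[OF fg(2)]] by (simp del: AA_simps)
        then show "?L' #>\<^bsub>add_monoid F\<^esub> f = ?L' #>\<^bsub>add_monoid F\<^esub> g \<longleftrightarrow> ?N2 #>\<^bsub>AA\<^esub> amul f \<alpha> = ?N2 #>\<^bsub>AA\<^esub> amul g \<alpha>"
          using add.r_coset_eq_iff[OF L' Lc[OF fg(1)] Lc[OF fg(2)]]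
            AA.r_coset_eq_iff[OF N2(1) amul_closed[OF Lc[OF fg(1)] ac] amul_closed[OF Lc[OF fg(2)] ac]] by simp
      qed auto
      also have "\<dots> \<le> card ((\<lambda>\<beta>. ?N2 #>\<^bsub>AA\<^esub> \<beta>) ` adele_ring)"
      proof (rule card_mono)
        show "finite ((\<lambda>\<beta>. ?N2 #>\<^bsub>AA\<^esub> \<beta>) ` adele_ring)"
          using h1 unfolding h_def index_in_def by (metis card.infinite not_less_zero)
        show "(\<lambda>f. ?N2 #>\<^bsub>AA\<^esub> amul f \<alpha>) ` ?L \<subseteq> (\<lambda>\<beta>. ?N2 #>\<^bsub>AA\<^esub> \<beta>) ` adele_ring"
          using amul_adele_ring[OF Lc al] by blast
      qed
      finally show ?thesis by (simp add: h_def index_in_def)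
    qed
    ultimately show ?thesis by simp
  qed

  \<comment> \<open>The representative of the zero class is annihilated by all of \<open>?L\<close>,
    not just by one part in \<open>h\<close>; this surplus decides the comparison.\<close>
  obtain t0 where t0: "t0 \<in> T" "?N1 #>\<^bsub>AA\<^esub> \<one>\<^bsub>AA\<^esub> = ?N1 #>\<^bsub>AA\<^esub> t0"
    using T(4) subgroup.one_closed[OF subgroup_adele_ring] by blast
  have t0N: "t0 \<in> ?N1"
  proof -
    have c: "t0 \<in> carrier AA" using t0 T(1) AFc by blast
    have "t0 \<otimes>\<^bsub>AA\<^esub> inv\<^bsub>AA\<^esub> \<one>\<^bsub>AA\<^esub> \<in> ?N1" using AA.r_coset_eq_iff[OF N1(1) c AA.one_closed] t0(2) by simp
    then show ?thesis using c by (simp del: AA_simps)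
  qed
  have t0L: "{f \<in> ?L. amul f t0 \<in> ?N2} = ?L" using amul_AS_DF[OF _ t0N] by blast

  have swap: "(\<Sum>\<alpha>\<in>T. card {f \<in> ?L. amul f \<alpha> \<in> ?N2}) = (\<Sum>f\<in>?L. card {\<alpha> \<in> T. amul f \<alpha> \<in> ?N2})"
    using sum_multicount_gen[OF finT finL, of "\<lambda>\<alpha> f. amul f \<alpha> \<in> ?N2" "\<lambda>f. card {\<alpha> \<in> T. amul f \<alpha> \<in> ?N2}"] by simp
  have "h * (\<Sum>\<alpha>\<in>T. card {f \<in> ?L. amul f \<alpha> \<in> ?N2}) = h * l + (\<Sum>\<alpha>\<in>T - {t0}. h * card {f \<in> ?L. amul f \<alpha> \<in> ?N2})"
    using sum.remove[OF finT t0(1), of "\<lambda>\<alpha>. card {f \<in> ?L. amul f \<alpha> \<in> ?N2}"] t0L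
    by (simp add: l_def sum_distrib_left distrib_left)
  also have "\<dots> \<ge> h * l + (\<Sum>\<alpha>\<in>T - {t0}. l)"
    using T(1) count_alpha by (intro add_left_mono sum_mono) blast
  also have "(\<Sum>\<alpha>\<in>T - {t0}. l) = (a - 1) * l" using t0(1) T(2) finT by simp
  finally have lower: "h * l + (a - 1) * l \<le> h * (\<Sum>\<alpha>\<in>T. card {f \<in> ?L. amul f \<alpha> \<in> ?N2})" .
  have zero: "{\<alpha> \<in> T. amul \<zero> \<alpha> \<in> ?N2} = T"
  proof -
    have "amul \<zero> \<alpha> \<in> ?N2" if "\<alpha> \<in> T" for \<alpha>
    proof -
      have "\<alpha> \<in> carrier AA" using that T(1) AFc by blast
      then have "amul \<zero> \<alpha> = \<one>\<^bsub>AA\<^esub>" by (auto simp: amul_def)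
      then show ?thesis using subgroup.one_closed[OF N2(1)] by (simp del: AA_simps)
    qed
    then show ?thesis by blast
  qed
  have "h * (\<Sum>f\<in>?L. card {\<alpha> \<in> T. amul f \<alpha> \<in> ?N2}) = h * a + (\<Sum>f\<in>?L - {\<zero>}. h * card {\<alpha> \<in> T. amul f \<alpha> \<in> ?N2})"
    using sum.remove[OF finL L0, of "\<lambda>f. card {\<alpha> \<in> T. amul f \<alpha> \<in> ?N2}"] zero T(2)
    by (simp add: sum_distrib_left distrib_left)
  also have "(\<Sum>f\<in>?L - {\<zero>}. h * card {\<alpha> \<in> T. amul f \<alpha> \<in> ?N2}) = (\<Sum>f\<in>?L - {\<zero>}. a)"
    using count_f by (intro sum.cong) auto
  also have "\<dots> = (l - 1) * a" using L0 finL by (simp add: l_def)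
  finally have upper: "h * (\<Sum>f\<in>?L. card {\<alpha> \<in> T. amul f \<alpha> \<in> ?N2}) = h * a + (l - 1) * a" .
  have lpos: "l > 0" using L0 finL by (auto simp: l_def card_gt_0_iff)
  have "h * l + (a - 1) * l \<le> h * a + (l - 1) * a" using lower upper swap by simp
  moreover have "(a - 1) * l + l = a * l" using apos by (cases a) auto
  moreover have "(l - 1) * a + a = a * l" using lpos by (cases l) auto
  \<comment> \<open>The products of \<open>a\<close> and \<open>l\<close> cancel between the two
    counts. What is left is (h - 1) l \<le> (h - 1) a, and \<open>h > 1\<close> is the hypothesis
    that \<open>E\<close> has less than maximal defect.\<close>
  ultimately have "h * l + a \<le> h * a + l" by linarith
  then have "(h - 1) * l \<le> (h - 1) * a" using h1 by (simp add: diff_mult_distrib)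
  then have "l \<le> a" using h1 by simp
  then have "Q ^ ell B \<le> Q ^ nat (defect max_div - defect (\<lambda>P. E P - B P))"
    using card_LS[OF B] a by (simp add: l_def)
  moreover have "1 < Q" using Q_ge_2 by simp
  ultimately have "ell B \<le> nat (defect max_div - defect (\<lambda>P. E P - B P))" using power_le_imp_le_exp by blast
  then show ?thesis using max_div(2)[OF EB] by linarith
qed

lemma n_pos: "n > 0"
proof (rule ccontr)
  assume "\<not> n > 0"
  then have "carrier F = {\<zero>}" using Us_span by simp
  then show False using one_closed one_not_zero by blast
qed

text \<open>If the defect of \<open>E\<close> is not maximal, a divisor B with deg (E - B) < 0
  satisfies two estimates of l(B), from the adele count and from maximality of the defect. Together
  they give deg E at most twice the maximal defect.\<close>

theorem ell_large_degree:
  assumes E: "E \<in> Divs" and deg: "degr E \<ge> 2 * defect max_div + 1"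
  shows "int (ell E) = degr E - defect max_div"
proof -
  have "\<not> defect E < defect max_div"
  proof
    assume lt: "defect E < defect max_div"
    \<comment> \<open>The poles of \<open>x\<close> have degree \<open>n\<close> at least 1, so this
      multiple of them exceeds the degree of \<open>E\<close>.\<close>
    define k where "k = max 0 (degr E + 1)"
    let ?B = "\<lambda>P. k * x_poles P"
    have B: "?B \<in> Divs" using Divs_mult[OF Divs_x_poles] .
    have EB: "(\<lambda>P. E P - ?B P) \<in> Divs" using Divs_diff[OF E B] .
    have dB: "degr ?B = k * int n" using degr_mult[OF Divs_x_poles] degr_x_poles by simp
    have "1 \<le> int n" using n_pos by linarith
    then have "k * 1 \<le> k * int n" by (rule mult_left_mono) (simp add: k_def)
    then have "degr (\<lambda>P. E P - ?B P) < 0" using degr_diff[OF E B] dB by (simp add: k_def)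
    then have "defect (\<lambda>P. E P - ?B P) = degr E - degr ?B"
      using ell_negative_degree[OF EB] degr_diff[OF E B] by (simp add: defect_def)
    then have "int (ell ?B) \<le> defect max_div - degr E + degr ?B" using ell_le_of_index_gt_1[OF E B lt] by simp
    moreover have "degr ?B - int (ell ?B) \<le> defect max_div" using max_div(2)[OF B] by (simp add: defect_def)
    ultimately show False using deg by linarith
  qed
  then show ?thesis using max_div(2)[OF E] by (simp add: defect_def)
qed

section \<open>Comparison with the formal divisors and the genus\<close>

lemma divisor_Divs: "A \<in> divisors F K \<Longrightarrow> Poly_Mapping.lookup A \<in> Divs"
  unfolding Divs_def mem_Collect_eq by (rule finite_subset[OF _ finite_keys[of A]]) (auto simp: in_keys_iff)

lemma divisor_degree_degr: "A \<in> divisors F K \<Longrightarrow> divisor_degree F K A = degr (Poly_Mapping.lookup A)"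
  unfolding divisor_degree_def
  by (rule degr_eq[symmetric]) (auto simp: in_keys_iff free_Abelian_group_def)

lemma riemann_roch_LS: "riemann_roch_space F K A = LS Pl (Poly_Mapping.lookup A)"
  by (auto simp: riemann_roch_space_def LS_def pw_def)

text \<open>\<open>divisors\<close> demands a support inside the set of places, so the values
  elsewhere are cut off.\<close>

lemma exists_divisor:
  assumes "E \<in> Divs"
  shows "\<exists>A \<in> divisors F K. \<forall>P \<in> Pl. Poly_Mapping.lookup A P = E P"
proof -
  let ?f = "\<lambda>P. if P \<in> Pl then E P else 0"
  have "finite {P. ?f P \<noteq> 0}"
    using assms unfolding Divs_def mem_Collect_eq by (rule finite_subset[rotated]) auto
  then have l: "Poly_Mapping.lookup (Abs_poly_mapping ?f) = ?f" by (simp add: lookup_Abs_poly_mapping)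
  then have "Abs_poly_mapping ?f \<in> divisors F K"
    by (auto simp: free_Abelian_group_def in_keys_iff split: if_splits)
  then show ?thesis using l by (intro bexI[of _ "Abs_poly_mapping ?f"]) auto
qed

lemma Divs_cong:
  assumes "\<And>P. P \<in> Pl \<Longrightarrow> E P = E' P"
  shows "degr E = degr E'" "LS Pl E = LS Pl E'" "defect E = defect E'"
proof -
  show "degr E = degr E'" unfolding degr_def by (rule sum.cong) (use assms in auto)
  moreover show "LS Pl E = LS Pl E'" using assms by (auto simp: LS_def)
  ultimately show "defect E = defect E'" by (simp add: defect_def ell_def)
qed

text \<open>The maximum exists by Riemann's theorem and is attained at \<open>max_div\<close>, so
  \<open>GREATEST\<close> has a meaning; the 1 is the one that \<open>defect\<close> omits.\<close>

lemma genus_eq: "genus F K = defect max_div + 1"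
  unfolding genus_def
proof (rule Greatest_equality)
  have *: "divisor_degree F K A - int (dim K (riemann_roch_space F K A)) + 1 = defect (Poly_Mapping.lookup A) + 1"
    if "A \<in> divisors F K" for A
    using that by (simp add: divisor_degree_degr riemann_roch_LS defect_def ell_def)
  obtain A where A: "A \<in> divisors F K" "\<And>P. P \<in> Pl \<Longrightarrow> Poly_Mapping.lookup A P = max_div P"
    using exists_divisor[OF max_div(1)] by blast
  then show "\<exists>A\<in>divisors F K. defect max_div + 1 =
      divisor_degree F K A - int (dim K (riemann_roch_space F K A)) + 1"
    using *[OF A(1)] Divs_cong(3)[of "Poly_Mapping.lookup A" max_div] by (intro bexI[of _ A]) auto
  fix \<gamma> assume "\<exists>A\<in>divisors F K. \<gamma> = divisor_degree F K A - int (dim K (riemann_roch_space F K A)) + 1"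
  then show "\<gamma> \<le> defect max_div + 1" using * max_div(2) divisor_Divs by auto
qed

theorem card_riemann_roch:
  assumes A: "A \<in> divisors F K" and deg: "divisor_degree F K A \<ge> 2 * genus F K - 1"
  shows "finite (riemann_roch_space F K A)"
    and "int (ell (Poly_Mapping.lookup A)) = divisor_degree F K A + 1 - genus F K"
    and "card (riemann_roch_space F K A) = Q ^ ell (Poly_Mapping.lookup A)"
  using finite_LS[OF divisor_Divs[OF A]] card_LS[OF divisor_Divs[OF A]] ell_large_degree[OF divisor_Divs[OF A]] deg
  by (simp_all add: divisor_degree_degr[OF A] riemann_roch_LS genus_eq)

end

section \<open>Codes\<close>

text \<open>The counterpart of \<open>card_eq_power_dim\<close> for abstract vector spaces, in which
  \<open>code_dim\<close> is defined. Coordinate functions are taken extensional, so that they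
  correspond one to one to vectors.\<close>

lemma (in vectorspace) card_carrier_eq_power_dim:
  assumes finV: "finite (carrier V)" and finK: "finite (carrier K)"
  shows "card (carrier V) = card (carrier K) ^ dim"
proof -
  have "span (carrier V) = carrier V"
    using in_own_span[of "carrier V"] span_is_subset2[of "carrier V"] by blast
  then have "fin_dim" unfolding fin_dim_def using finV by blast
  then obtain A where A: "finite A" "basis A" using finite_basis_exists by blast
  then have Ac: "A \<subseteq> carrier V" "lin_indpt A" "span A = carrier V" by (auto simp: basis_def)
  have bij: "bij_betw (\<lambda>a. lincomb a A) (A \<rightarrow>\<^sub>E carrier K) (carrier V)"
    unfolding bij_betw_def
  proof
    show "inj_on (\<lambda>a. lincomb a A) (A \<rightarrow>\<^sub>E carrier K)"
    proof (rule inj_onI)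
      fix a b assume ab: "a \<in> A \<rightarrow>\<^sub>E carrier K" "b \<in> A \<rightarrow>\<^sub>E carrier K" "lincomb a A = lincomb b A"
      then have f: "a \<in> A \<rightarrow> carrier K" "b \<in> A \<rightarrow> carrier K" by auto
      have d: "(\<lambda>u. a u \<ominus>\<^bsub>K\<^esub> b u) \<in> A \<rightarrow> carrier K" using f by auto
      have "lincomb b A \<in> carrier V" using f Ac by blast
      then have "lincomb (\<lambda>u. a u \<ominus>\<^bsub>K\<^esub> b u) A = \<zero>\<^bsub>V\<^esub>"
        using lincomb_diff[OF A(1) Ac(1) f] ab(3) by (simp add: M.minus_eq M.r_neg)
      then have z: "a u \<ominus>\<^bsub>K\<^esub> b u = \<zero>\<^bsub>K\<^esub>" if "u \<in> A" for u
        using Ac(2) A(1) d that unfolding lin_dep_def by blast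
      have "a u = b u" if "u \<in> A" for u
        using z[OF that] f that by (meson Pi_mem R.r_right_minus_eq)
      then show "a = b" using ab(1,2) by (auto intro: PiE_ext)
    qed
    have "lincomb a A = lincomb (restrict a A) A" if "a \<in> A \<rightarrow> carrier K" for a
      using that Ac by (intro lincomb_cong) auto
    then have "span A \<subseteq> (\<lambda>a. lincomb a A) ` (A \<rightarrow>\<^sub>E carrier K)"
      unfolding finite_span[OF A(1) Ac(1)] by (auto intro!: image_eqI[of _ _ "restrict _ A"])
    moreover have "(\<lambda>a. lincomb a A) ` (A \<rightarrow>\<^sub>E carrier K) \<subseteq> span A"
      unfolding finite_span[OF A(1) Ac(1)] by auto
    ultimately show "(\<lambda>a. lincomb a A) ` (A \<rightarrow>\<^sub>E carrier K) = carrier V" using Ac(3) by blast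
  qed
  have "card (carrier V) = card (A \<rightarrow>\<^sub>E carrier K)" using bij_betw_same_card[OF bij] by simp
  then show ?thesis using dim_basis[OF A] A(1) by (simp add: card_PiE)
qed

lemma word_space_simps [simp]:
  "u \<oplus>\<^bsub>word_space R m\<^esub> w = map2 (\<oplus>\<^bsub>R\<^esub>) u w" "\<zero>\<^bsub>word_space R m\<^esub> = replicate m \<zero>\<^bsub>R\<^esub>"
  "a \<odot>\<^bsub>word_space R m\<^esub> w = map ((\<otimes>\<^bsub>R\<^esub>) a) w"
  by (simp_all add: word_space_def)

lemma mem_word_space: "w \<in> carrier (word_space R m) \<longleftrightarrow> length w = m \<and> (\<forall>i<m. w ! i \<in> carrier R)"
  by (auto simp: word_space_def subset_iff in_set_conv_nth)

lemma vectorspace_word_space: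
  assumes "field R"
  shows "vectorspace R (word_space R m)"
proof -
  interpret field R by fact
  show ?thesis
  proof (intro vectorspace.intro module.intro module_axioms.intro abelian_groupI)
    fix w assume w: "w \<in> carrier (word_space R m)"
    show "\<exists>u\<in>carrier (word_space R m). u \<oplus>\<^bsub>word_space R m\<^esub> w = \<zero>\<^bsub>word_space R m\<^esub>"
      using w by (intro bexI[of _ "map (a_inv R) w"]) (auto simp: mem_word_space l_neg intro!: nth_equalityI)
  qed (auto simp: mem_word_space a_ac l_distr r_distr m_assoc is_cring field_axioms in_set_conv_nth intro!: nth_equalityI)
qed

lemma linear_codeI:
  assumes "field R" "C \<subseteq> carrier (word_space R m)" "replicate m \<zero>\<^bsub>R\<^esub> \<in> C"
    and "\<And>u w. u \<in> C \<Longrightarrow> w \<in> C \<Longrightarrow> map2 (\<oplus>\<^bsub>R\<^esub>) u w \<in> C"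
    and "\<And>a w. a \<in> carrier R \<Longrightarrow> w \<in> C \<Longrightarrow> map ((\<otimes>\<^bsub>R\<^esub>) a) w \<in> C"
  shows "linear_code R m C"
  unfolding linear_code_def subspace_def submodule_def
  using assms vectorspace_word_space[OF assms(1)] by (auto simp: vectorspace_def)

lemma finite_word_space: "finite (carrier R) \<Longrightarrow> finite (carrier (word_space R m))"
  using finite_lists_length_eq[of "carrier R" m] by (simp add: word_space_def conj_commute)

text \<open>Both code dimensions in the theorem are obtained from this, by counting words and
  comparing exponents.\<close>

lemma card_linear_code:
  assumes "field R" "finite (carrier R)" "linear_code R m C"
  shows "card C = card (carrier R) ^ code_dim R m C"
proof -
  interpret W: vectorspace R "word_space R m" using vectorspace_word_space[OF assms(1)] .
  have sub: "subspace R C (word_space R m)" using assms(3) by (simp add: linear_code_def)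
  interpret C: vectorspace R "word_space R m\<lparr>carrier := C\<rparr>" using W.subspace_is_vs[OF sub] .
  have "C \<subseteq> carrier (word_space R m)" using sub by (simp add: subspace_def submodule_def)
  then have "finite C" using finite_word_space[OF assms(2)] finite_subset by blast
  then show ?thesis using C.card_carrier_eq_power_dim assms(2) by (simp add: code_dim_def)
qed

section \<open>The parity check code\<close>

lemma mem_parity_code:
  "w \<in> parity_code R m \<longleftrightarrow>
    length w = m \<and> (\<forall>i<m. w ! i \<in> carrier R) \<and> (\<Oplus>\<^bsub>R\<^esub>i \<in> {..<m}. w ! i) = \<zero>\<^bsub>R\<^esub>"
  by (auto simp: parity_code_def mem_word_space)

context field begin

lemma linear_parity_code: "linear_code R m (parity_code R m)"
proof (rule linear_codeI)
  show "field R" by (rule field_axioms)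
  show "parity_code R m \<subseteq> carrier (word_space R m)" by (auto simp: parity_code_def)
  have "(\<Oplus>i \<in> {..<m}. replicate m \<zero> ! i) = (\<Oplus>i \<in> {..<m}. \<zero>)" by (rule finsum_cong') auto
  then show "replicate m \<zero> \<in> parity_code R m" by (simp add: mem_parity_code)
next
  fix u w assume uw: "u \<in> parity_code R m" "w \<in> parity_code R m"
  then have c: "\<And>i. i < m \<Longrightarrow> u ! i \<in> carrier R" "\<And>i. i < m \<Longrightarrow> w ! i \<in> carrier R" "length u = m" "length w = m"
    by (auto simp: mem_parity_code)
  have "(\<Oplus>i \<in> {..<m}. map2 (\<oplus>) u w ! i) = (\<Oplus>i \<in> {..<m}. u ! i \<oplus> w ! i)"
    using c by (intro finsum_cong') auto
  also have "\<dots> = (\<Oplus>i \<in> {..<m}. u ! i) \<oplus> (\<Oplus>i \<in> {..<m}. w ! i)" using c by (intro finsum_addf) auto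
  finally show "map2 (\<oplus>) u w \<in> parity_code R m" using uw by (auto simp: mem_parity_code)
next
  fix a w assume a: "a \<in> carrier R" and w: "w \<in> parity_code R m"
  then have c: "\<And>i. i < m \<Longrightarrow> w ! i \<in> carrier R" "length w = m" by (auto simp: mem_parity_code)
  have "(\<Oplus>i \<in> {..<m}. map ((\<otimes>) a) w ! i) = (\<Oplus>i \<in> {..<m}. a \<otimes> w ! i)"
    using c a by (intro finsum_cong') auto
  also have "\<dots> = a \<otimes> (\<Oplus>i \<in> {..<m}. w ! i)" using c a by (intro finsum_rdistr[symmetric]) auto
  finally show "map ((\<otimes>) a) w \<in> parity_code R m" using w a by (auto simp: mem_parity_code)
qed

text \<open>One symbol is minus the sum of the others. Both the locality and the distance 2 rest on
  this.\<close>

lemma parity_code_determined: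
  assumes u: "u \<in> parity_code R m" and w: "w \<in> parity_code R m" and i: "i < m"
    and eq: "\<And>j. j < m \<Longrightarrow> j \<noteq> i \<Longrightarrow> u ! j = w ! j"
  shows "u ! i = w ! i"
proof -
  have s: "{..<m} = insert i ({..<m} - {i})" using i by auto
  have dec: "(\<Oplus>j \<in> {..<m}. x ! j) = x ! i \<oplus> (\<Oplus>j \<in> {..<m} - {i}. x ! j)" if "x \<in> parity_code R m" for x
    using that i by (subst s, subst finsum_insert) (auto simp: mem_parity_code)
  have c: "u ! i \<in> carrier R" "w ! i \<in> carrier R" using u w i by (auto simp: mem_parity_code)
  have rc: "(\<Oplus>j \<in> {..<m} - {i}. w ! j) \<in> carrier R" using w by (intro finsum_closed) (auto simp: mem_parity_code)
  have "(\<Oplus>j \<in> {..<m} - {i}. u ! j) = (\<Oplus>j \<in> {..<m} - {i}. w ! j)"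
    using eq w by (intro finsum_cong') (auto simp: mem_parity_code)
  then have "u ! i \<oplus> (\<Oplus>j \<in> {..<m} - {i}. w ! j) = w ! i \<oplus> (\<Oplus>j \<in> {..<m} - {i}. w ! j)"
    using dec[OF u] dec[OF w] u w by (auto simp: mem_parity_code)
  then show ?thesis using c rc by simp
qed

lemma parity_code_dist_ge_2:
  assumes u: "u \<in> parity_code R m" and w: "w \<in> parity_code R m" and "u \<noteq> w"
  shows "hamming_dist u w \<ge> 2"
proof -
  let ?D = "{i. i < length u \<and> u ! i \<noteq> w ! i}"
  have len: "length u = m" "length w = m" using u w by (auto simp: mem_parity_code)
  obtain i where i: "i < m" "u ! i \<noteq> w ! i" using \<open>u \<noteq> w\<close> len by (auto simp: list_eq_iff_nth_eq)
  then obtain j where j: "j < m" "j \<noteq> i" "u ! j \<noteq> w ! j" using parity_code_determined[OF u w i(1)] by blast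
  have "card {i, j} \<le> card ?D" using i j len by (intro card_mono) auto
  then show ?thesis using j(2) by (simp add: hamming_dist_def)
qed

lemma min_dist_parity_code:
  assumes m: "m \<ge> 2"
  shows "min_dist (parity_code R m) = 2"
  unfolding min_dist_def
proof (rule Min_eqI)
  let ?S = "{hamming_dist u w |u w. u \<in> parity_code R m \<and> w \<in> parity_code R m \<and> u \<noteq> w}"
  have "hamming_dist u w \<le> m" if "u \<in> parity_code R m" for u w
  proof -
    have "hamming_dist u w \<le> card {..<m}"
      unfolding hamming_dist_def using that by (intro card_mono) (auto simp: mem_parity_code)
    then show ?thesis by simp
  qed
  then have "?S \<subseteq> {..m}" by blast
  then show "finite ?S" using finite_subset by blast
  show "\<And>y. y \<in> ?S \<Longrightarrow> 2 \<le> y" using parity_code_dist_ge_2 by blast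
  obtain m' where m': "m = Suc (Suc m')" using m by (metis Suc_le_D numeral_2_eq_2 Suc_le_mono)
  \<comment> \<open>The word 1, -1, 0, ..., 0 attains distance 2 from zero in every characteristic,
    as -1 is never 0.\<close>
  let ?z = "replicate m \<zero>" and ?w = "\<one> # \<ominus> \<one> # replicate m' \<zero>"
  have z: "?z \<in> parity_code R m"
    using linear_parity_code[of m] by (simp add: linear_code_def subspace_def submodule_def)
  have len: "length ?w = m" using m' by simp
  have wc: "?w ! i \<in> carrier R" if "i < m" for i
    using that m' by (auto simp: nth_Cons')
  have "{..<m} = insert 0 (insert 1 {2..<m})" using m by auto
  then have "(\<Oplus>i \<in> {..<m}. ?w ! i) = (\<Oplus>i \<in> insert 0 (insert 1 {2..<m}). ?w ! i)" by (simp only:)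
  also have "\<dots> = ?w ! 0 \<oplus> (\<Oplus>i \<in> insert 1 {2..<m}. ?w ! i)"
    using m' by (intro finsum_insert) (auto simp: nth_Cons')
  also have "(\<Oplus>i \<in> insert 1 {2..<m}. ?w ! i) = ?w ! 1 \<oplus> (\<Oplus>i \<in> {2..<m}. ?w ! i)"
    using m' by (intro finsum_insert) (auto simp: nth_Cons')
  also have "(\<Oplus>i \<in> {2..<m}. ?w ! i) = (\<Oplus>i \<in> {2..<m}. \<zero>)"
    using m' by (intro finsum_cong') (auto simp: nth_Cons')
  finally have "(\<Oplus>i \<in> {..<m}. ?w ! i) = \<zero>" by (simp add: r_neg)
  then have w: "?w \<in> parity_code R m"
    using len wc unfolding mem_parity_code by blast
  have "\<zero> \<noteq> \<ominus> \<one>" by (metis minus_minus minus_zero one_closed one_not_zero)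
  then have "{i. i < length ?z \<and> ?z ! i \<noteq> ?w ! i} = {0, 1}"
    using m' by (auto simp: nth_Cons' split: if_splits)
  then have "hamming_dist ?z ?w = 2" by (simp add: hamming_dist_def)
  moreover have "?z \<noteq> ?w" using m' by simp
  ultimately show "2 \<in> ?S" using z w by force
qed

end

section \<open>Words of concatenated codes\<close>

lemma hamming_dist_append:
  assumes "length a = length b"
  shows "hamming_dist (a @ c) (b @ d) = hamming_dist a b + hamming_dist c d"
proof -
  let ?A = "{i. i < length a \<and> a ! i \<noteq> b ! i}" and ?C = "{i. i < length c \<and> c ! i \<noteq> d ! i}"
  have "{i. i < length (a @ c) \<and> (a @ c) ! i \<noteq> (b @ d) ! i} = ?A \<union> (\<lambda>i. length a + i) ` ?C" (is "?L = ?R")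
  proof (intro equalityI subsetI)
    fix i assume i: "i \<in> ?L"
    show "i \<in> ?R"
    proof (cases "i < length a")
      case True
      then show ?thesis using i assms by (simp add: nth_append)
    next
      case False
      then have "i = length a + (i - length a)" "i - length a \<in> ?C" using i assms by (auto simp: nth_append)
      then show ?thesis by blast
    qed
  qed (use assms in \<open>auto simp: nth_append\<close>)
  moreover have "?A \<inter> (\<lambda>i. length a + i) ` ?C = {}" by auto
  moreover have "card ((\<lambda>i. length a + i) ` ?C) = card ?C" by (rule card_image) simp
  ultimately show ?thesis by (simp add: hamming_dist_def card_Un_disjoint)
qed

text \<open>Distances add up over blocks of equal length, and every position where the outer words
  differ yields a block at distance at least \<open>e\<close>.\<close>

lemma hamming_dist_concat_ge:
  assumes "length c = length d" "set c \<subseteq> K" "set d \<subseteq> K"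
    and len: "\<And>a. a \<in> K \<Longrightarrow> length (\<phi> a) = m"
    and dist: "\<And>a b. a \<in> K \<Longrightarrow> b \<in> K \<Longrightarrow> a \<noteq> b \<Longrightarrow> e \<le> hamming_dist (\<phi> a) (\<phi> b)"
  shows "e * hamming_dist c d \<le> hamming_dist (concat (map \<phi> c)) (concat (map \<phi> d))"
  using assms(1-3)
proof (induction c d rule: list_induct2)
  case Nil
  then show ?case by (simp add: hamming_dist_def)
next
  case (Cons a c b d)
  have 1: "hamming_dist [a] [b] = (if a = b then 0 else 1)"
  proof -
    have "{i. i < length [a] \<and> [a] ! i \<noteq> [b] ! i} = (if a = b then {} else {0})" by auto
    then show ?thesis by (simp add: hamming_dist_def)
  qed
  have "hamming_dist (a # c) (b # d) = (if a = b then 0 else 1) + hamming_dist c d"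
    using hamming_dist_append[of "[a]" "[b]" c d] 1 by simp
  moreover have "hamming_dist (concat (map \<phi> (a # c))) (concat (map \<phi> (b # d))) =
      hamming_dist (\<phi> a) (\<phi> b) + hamming_dist (concat (map \<phi> c)) (concat (map \<phi> d))"
    using hamming_dist_append[of "\<phi> a" "\<phi> b"] len Cons.prems by simp
  moreover have "e * (if a = b then 0 else 1) \<le> hamming_dist (\<phi> a) (\<phi> b)"
    using dist[of a b] Cons.prems by simp
  ultimately show ?case using Cons by (simp add: distrib_left)
qed

lemma nth_concat_blocks:
  assumes "\<And>a. a \<in> set c \<Longrightarrow> length (\<phi> a) = m" "i < length c" "j < m"
  shows "concat (map \<phi> c) ! (i * m + j) = \<phi> (c ! i) ! j"
  using assms
proof (induction c arbitrary: i)
  case (Cons a c)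
  then show ?case by (cases i) (auto simp: nth_append)
qed simp

lemma length_concat_blocks:
  "(\<And>a. a \<in> set c \<Longrightarrow> length (\<phi> a) = m) \<Longrightarrow> length (concat (map \<phi> c)) = m * length c"
  by (induction c) auto

lemma concat_map2:
  assumes "length c = length d" "set c \<subseteq> K" "set d \<subseteq> K"
    and len: "\<And>a. a \<in> K \<Longrightarrow> length (\<phi> a) = m"
    and hom: "\<And>a b. a \<in> K \<Longrightarrow> b \<in> K \<Longrightarrow> \<phi> (f a b) = map2 g (\<phi> a) (\<phi> b)"
  shows "map2 g (concat (map \<phi> c)) (concat (map \<phi> d)) = concat (map \<phi> (map2 f c d))"
  using assms(1-3) by (induction c d rule: list_induct2) (auto simp: len hom)

lemma has_locality_concatenated:
  assumes C: "\<And>c. c \<in> C \<Longrightarrow> length c = s \<and> set c \<subseteq> K"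
    and len: "\<And>a. a \<in> K \<Longrightarrow> length (\<phi> a) = r + 1"
    and det: "\<And>a b i. a \<in> K \<Longrightarrow> b \<in> K \<Longrightarrow> i < r + 1 \<Longrightarrow>
      (\<And>j. j < r + 1 \<Longrightarrow> j \<noteq> i \<Longrightarrow> \<phi> a ! j = \<phi> b ! j) \<Longrightarrow> \<phi> a ! i = \<phi> b ! i"
  shows "has_locality ((r + 1) * s) r (concatenated_code \<phi> C)"
  unfolding has_locality_def
proof (intro allI impI)
  fix i assume i: "i < (r + 1) * s"
  define b where "b = i div (r + 1)"
  define j where "j = i mod (r + 1)"
  have bj: "b < s" "j < r + 1" "i = b * (r + 1) + j"
    using i div_mult_mod_eq[of i "r + 1"] by (auto simp: b_def j_def less_mult_imp_div_less mult.commute)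
  \<comment> \<open>The recovery set consists of the other \<open>r\<close> positions in the block
    that contains \<open>i\<close>.\<close>
  let ?N = "(\<lambda>j'. b * (r + 1) + j') ` ({..<r + 1} - {j})"
  have lt: "b * (r + 1) + j' < (r + 1) * s" if "j' < r + 1" for j'
  proof -
    have "b * (r + 1) + j' < (b + 1) * (r + 1)" using that by simp
    also have "\<dots> \<le> s * (r + 1)" using bj(1) by (intro mult_le_mono1) simp
    finally show ?thesis by (simp add: mult.commute)
  qed
  show "\<exists>N\<subseteq>{..<(r + 1) * s} - {i}. card N \<le> r \<and>
      (\<forall>u\<in>concatenated_code \<phi> C. \<forall>w\<in>concatenated_code \<phi> C. (\<forall>k\<in>N. u ! k = w ! k) \<longrightarrow> u ! i = w ! i)"
  proof (intro exI conjI ballI impI)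
    show "?N \<subseteq> {..<(r + 1) * s} - {i}" using lt bj(3) by auto
    have "card ?N \<le> card ({..<r + 1} - {j})" by (rule card_image_le) simp
    then show "card ?N \<le> r" using bj(2) by simp
    fix u w assume "u \<in> concatenated_code \<phi> C" "w \<in> concatenated_code \<phi> C" and eq: "\<forall>k\<in>?N. u ! k = w ! k"
    then obtain c d where c: "c \<in> C" "u = concat (map \<phi> c)" and d: "d \<in> C" "w = concat (map \<phi> d)"
      by (auto simp: concatenated_code_def)
    have mem: "c ! b \<in> K" "d ! b \<in> K" using C[OF c(1)] C[OF d(1)] bj(1) nth_mem[of b c] nth_mem[of b d] by auto
    have u: "u ! (b * (r + 1) + j') = \<phi> (c ! b) ! j'" if "j' < r + 1" for j'
      unfolding c(2) using C[OF c(1)] len bj(1) that by (intro nth_concat_blocks) auto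
    have w: "w ! (b * (r + 1) + j') = \<phi> (d ! b) ! j'" if "j' < r + 1" for j'
      unfolding d(2) using C[OF d(1)] len bj(1) that by (intro nth_concat_blocks) auto
    have "\<phi> (c ! b) ! j = \<phi> (d ! b) ! j"
    proof (rule det[OF mem bj(2)])
      fix j' assume j': "j' < r + 1" "j' \<noteq> j"
      then have "u ! (b * (r + 1) + j') = w ! (b * (r + 1) + j')" using eq by blast
      then show "\<phi> (c ! b) ! j' = \<phi> (d ! b) ! j'" using u w j'(1) by simp
    qed
    then show "u ! i = w ! i" using u[OF bj(2)] w[OF bj(2)] bj(3) by simp
  qed
qed

section \<open>Algebraic geometry codes and concatenation\<close>

context global_function_field begin

text \<open>At degree 1 the residue field has \<open>Q\<close> elements and \<open>K\<close> embeds
  into it, so every class contains a constant. This is what gives \<open>value_at\<close> a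
  meaning.\<close>

lemma rational_place:
  assumes P: "P \<in> rational_places F K"
  shows "P \<in> Pl" "residue F K P ` K = residue F K P ` VR P"
proof -
  show P': "P \<in> Pl" using P by (simp add: rational_places_def)
  have d: "place_degree F K P = 1" using P by (simp add: rational_places_def)
  have c: "card (residue F K P ` VR P) = Q"
    using card_residue_field(1)[OF P'] d by (simp add: index_in_def residue_eq[OF P'])
  then have fin: "finite (residue F K P ` VR P)" using Q_ge_2 by (intro card_ge_0_finite) simp
  show "residue F K P ` K = residue F K P ` VR P"
  proof (rule card_subset_eq[OF fin])
    show "residue F K P ` K \<subseteq> residue F K P ` VR P" using V_K[OF place_facts(2)[OF P']] by blast
    show "card (residue F K P ` K) = card (residue F K P ` VR P)"
      using c card_image[OF inj_residue_K[OF P']] by simp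
  qed
qed

lemma value_at_unique:
  assumes P: "P \<in> Pl" and f: "f \<in> carrier F" and c: "c \<in> K" "c \<ominus> f \<in> P"
  shows "value_at F K f P = c"
  unfolding value_at_def
proof (rule the_equality)
  show *: "c \<in> K \<and> residue F K P c = residue F K P f"
    using c residue_eq_iff[OF P, of c f] f by simp
  fix d assume "d \<in> K \<and> residue F K P d = residue F K P f"
  then show "d = c" using * inj_onD[OF inj_residue_K[OF P]] by metis
qed

lemma value_at:
  assumes P: "P \<in> rational_places F K" and f: "f \<in> VR P"
  shows "value_at F K f P \<in> K" "value_at F K f P \<ominus> f \<in> P"
proof -
  note P' = rational_place(1)[OF P]
  have fc: "f \<in> carrier F" using f VR_subset_carrier[OF P'] by blast
  have "residue F K P f \<in> residue F K P ` K" using rational_place(2)[OF P] f by blast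
  then obtain c where c: "c \<in> K" "residue F K P f = residue F K P c" by blast
  then have "c \<ominus> f \<in> P" using residue_eq_iff[OF P', of c f] fc by simp
  then show "value_at F K f P \<in> K" "value_at F K f P \<ominus> f \<in> P"
    using value_at_unique[OF P' fc c(1)] c(1) by auto
qed

lemma value_at_add:
  assumes P: "P \<in> rational_places F K" and f: "f \<in> VR P" and g: "g \<in> VR P"
  shows "value_at F K (f \<oplus> g) P = value_at F K f P \<oplus> value_at F K g P"
proof (rule value_at_unique)
  show P': "P \<in> Pl" using rational_place(1)[OF P] .
  have c: "f \<in> carrier F" "g \<in> carrier F" using f g VR_subset_carrier[OF P'] by auto
  then show "f \<oplus> g \<in> carrier F" by simp
  note vf = value_at[OF P f] and vg = value_at[OF P g]
  show "value_at F K f P \<oplus> value_at F K g P \<in> K" using vf vg by simp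
  have "(value_at F K f P \<ominus> f) \<oplus> (value_at F K g P \<ominus> g) \<in> pw P 1"
    using vf vg pw_1[OF P'] by (intro pw_add[OF P']) auto
  moreover have "(value_at F K f P \<ominus> f) \<oplus> (value_at F K g P \<ominus> g) =
      (value_at F K f P \<oplus> value_at F K g P) \<ominus> (f \<oplus> g)"
    using c K_closed[OF vf(1)] K_closed[OF vg(1)] by algebra
  ultimately show "(value_at F K f P \<oplus> value_at F K g P) \<ominus> (f \<oplus> g) \<in> P" using pw_1[OF P'] by simp
qed

lemma value_at_smult:
  assumes P: "P \<in> rational_places F K" and f: "f \<in> VR P" and a: "a \<in> K"
  shows "value_at F K (a \<otimes> f) P = a \<otimes> value_at F K f P"
proof (rule value_at_unique)
  show P': "P \<in> Pl" using rational_place(1)[OF P] .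
  have c: "f \<in> carrier F" using f VR_subset_carrier[OF P'] by auto
  then show "a \<otimes> f \<in> carrier F" using a by simp
  note vf = value_at[OF P f]
  show "a \<otimes> value_at F K f P \<in> K" using vf a by simp
  have "a \<otimes> (value_at F K f P \<ominus> f) \<in> pw P 1"
    using vf pw_1[OF P'] by (intro pw_smult[OF P' a]) auto
  moreover have "a \<otimes> (value_at F K f P \<ominus> f) = a \<otimes> value_at F K f P \<ominus> a \<otimes> f"
    using c K_closed[OF vf(1)] K_closed[OF a] by algebra
  ultimately show "a \<otimes> value_at F K f P \<ominus> a \<otimes> f \<in> P" using pw_1[OF P'] by simp
qed

lemma value_at_eq_zero:
  assumes P: "P \<in> rational_places F K" and f: "f \<in> VR P" and z: "value_at F K f P = \<zero>"
  shows "f \<in> pw P 1"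
proof -
  note P' = rational_place(1)[OF P]
  have c: "f \<in> carrier F" using f VR_subset_carrier[OF P'] by auto
  have "\<ominus> (value_at F K f P \<ominus> f) \<in> pw P 1"
    using value_at(2)[OF P f] pw_1[OF P'] by (intro pw_uminus[OF P']) auto
  moreover have "\<ominus> (value_at F K f P \<ominus> f) = f" using c z by (simp add: minus_eq)
  ultimately show ?thesis by simp
qed

section \<open>Evaluation at the chosen places\<close>

context
  fixes Ps G
  assumes Ps: "distinct Ps" "set Ps \<subseteq> rational_places F K"
    and G: "G \<in> divisors F K" "Poly_Mapping.keys G \<inter> set Ps = {}"
begin

abbreviation "RR_space \<equiv> riemann_roch_space F K G"
abbreviation "ev f \<equiv> map (value_at F K f) Ps"

lemma RR_space_VR: "f \<in> RR_space \<Longrightarrow> P \<in> set Ps \<Longrightarrow> f \<in> VR P"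
proof -
  assume f: "f \<in> RR_space" and P: "P \<in> set Ps"
  have P': "P \<in> Pl" using P Ps rational_place(1) by blast
  have "Poly_Mapping.lookup G P = 0" using G(2) P by (auto simp: in_keys_iff)
  then have "f \<in> pw P 0" using f P' unfolding riemann_roch_LS by (force simp: LS_def)
  then show ?thesis using pw_0[OF P'] by simp
qed

lemma RR_space_closed: "f \<in> RR_space \<Longrightarrow> f \<in> carrier F"
  "\<zero> \<in> RR_space" "f \<in> RR_space \<Longrightarrow> g \<in> RR_space \<Longrightarrow> f \<oplus> g \<in> RR_space" "f \<in> RR_space \<Longrightarrow> g \<in> RR_space \<Longrightarrow> f \<ominus> g \<in> RR_space"
  "a \<in> K \<Longrightarrow> f \<in> RR_space \<Longrightarrow> a \<otimes> f \<in> RR_space"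
  unfolding riemann_roch_LS
  using add_subgroup_closed[OF subgroup_LS[OF subset_refl, of "Poly_Mapping.lookup G"]]
  by (auto simp: LS_def intro: pw_smult)

lemma ev_simps:
  "f \<in> RR_space \<Longrightarrow> set (ev f) \<subseteq> K"
  "f \<in> RR_space \<Longrightarrow> g \<in> RR_space \<Longrightarrow> ev (f \<oplus> g) = map2 (\<oplus>) (ev f) (ev g)"
  "a \<in> K \<Longrightarrow> f \<in> RR_space \<Longrightarrow> ev (a \<otimes> f) = map ((\<otimes>) a) (ev f)"
  "ev \<zero> = replicate (length Ps) \<zero>"
proof -
  show "f \<in> RR_space \<Longrightarrow> set (ev f) \<subseteq> K" using value_at(1) RR_space_VR Ps by auto
  show "f \<in> RR_space \<Longrightarrow> g \<in> RR_space \<Longrightarrow> ev (f \<oplus> g) = map2 (\<oplus>) (ev f) (ev g)"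
    using value_at_add RR_space_VR Ps(2) by (intro nth_equalityI) (auto simp: subset_iff)
  show "a \<in> K \<Longrightarrow> f \<in> RR_space \<Longrightarrow> ev (a \<otimes> f) = map ((\<otimes>) a) (ev f)"
    using value_at_smult RR_space_VR Ps(2) by (intro nth_equalityI) (auto simp: subset_iff)
  have "value_at F K \<zero> P = \<zero>" if "P \<in> set Ps" for P
  proof -
    have P': "P \<in> Pl" using that Ps(2) rational_place(1) by blast
    show ?thesis by (rule value_at_unique[OF P']) (use pw_zero[of P 1] pw_1[OF P'] in \<open>auto simp: minus_eq\<close>)
  qed
  then show "ev \<zero> = replicate (length Ps) \<zero>" by (intro nth_equalityI) auto
qed

text \<open>A function with these zeros lies in the space of \<open>G\<close> minus their sum, since
  \<open>G\<close> has coefficient 0 there; a space of negative degree contains no nonzero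
  function.\<close>

lemma zeros_le_degree:
  assumes f: "f \<in> RR_space" "f \<noteq> \<zero>"
  shows "int (card {P \<in> set Ps. value_at F K f P = \<zero>}) \<le> divisor_degree F K G"
proof -
  let ?Z = "{P \<in> set Ps. value_at F K f P = \<zero>}"
  let ?I = "\<lambda>P. if P \<in> ?Z then 1 else 0 :: int"
  have Z: "?Z \<subseteq> Pl" "finite ?Z" using Ps(2) rational_place(1) by auto
  have I: "?I \<in> Divs" unfolding Divs_def mem_Collect_eq by (rule finite_subset[OF _ Z(2)]) auto
  have "degr ?I = (\<Sum>P\<in>?Z. ?I P * int (place_degree F K P))" by (rule degr_eq[OF Z(2,1)]) auto
  also have "\<dots> = (\<Sum>P\<in>?Z. 1)" using Ps(2) by (intro sum.cong) (auto simp: rational_places_def)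
  finally have dI: "degr ?I = int (card ?Z)" by simp
  have GI: "(\<lambda>P. Poly_Mapping.lookup G P - ?I P) \<in> Divs" using Divs_diff[OF divisor_Divs[OF G(1)] I] .
  have fz: "f \<in> pw P (- (Poly_Mapping.lookup G P - ?I P))" if P: "P \<in> Pl" for P
  proof (cases "P \<in> ?Z")
    case True
    then have "Poly_Mapping.lookup G P = 0" using G(2) by (auto simp: in_keys_iff)
    moreover have "f \<in> pw P 1" using True value_at_eq_zero RR_space_VR[OF f(1)] Ps(2) by blast
    ultimately show ?thesis using True by simp
  next
    case False
    then show ?thesis using f(1) P unfolding riemann_roch_LS by (auto simp: LS_def)
  qed
  have "f \<in> LS Pl (\<lambda>P. Poly_Mapping.lookup G P - ?I P)"
    unfolding LS_def by (rule CollectI, intro conjI ballI, rule RR_space_closed(1)[OF f(1)], rule fz)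
  then have "\<not> degr (\<lambda>P. Poly_Mapping.lookup G P - ?I P) < 0"
    using LS_negative_degree[OF GI] f(2) by blast
  then show ?thesis using degr_diff[OF divisor_Divs[OF G(1)] I] dI divisor_degree_degr[OF G(1)] by simp
qed

text \<open>Agreeing coordinates are zeros of the difference, and the places are distinct, so there
  are at most deg G of them.\<close>

lemma ev_dist:
  assumes f: "f \<in> RR_space" and g: "g \<in> RR_space" and "f \<noteq> g"
  shows "int (length Ps) - divisor_degree F K G \<le> int (hamming_dist (ev f) (ev g))"
proof -
  let ?h = "f \<ominus> g"
  have h: "?h \<in> RR_space" "?h \<noteq> \<zero>" using RR_space_closed f g \<open>f \<noteq> g\<close> by auto
  let ?E = "{i. i < length Ps \<and> value_at F K f (Ps ! i) = value_at F K g (Ps ! i)}"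
  let ?D = "{i. i < length (ev f) \<and> ev f ! i \<noteq> ev g ! i}"
  \<comment> \<open>Rewrites the difference as a sum, the form to which \<open>value_at_add\<close>
    applies.\<close>
  have fh: "f = ?h \<oplus> g" using RR_space_closed(1) f g by (simp add: minus_eq a_assoc l_neg)
  have "value_at F K ?h P = \<zero>" if P: "P \<in> set Ps" and e: "value_at F K f P = value_at F K g P" for P
  proof -
    have R: "P \<in> rational_places F K" using P Ps(2) by blast
    have "value_at F K f P = value_at F K ?h P \<oplus> value_at F K g P"
      using value_at_add[OF R RR_space_VR[OF h(1) P] RR_space_VR[OF g P]] fh by simp
    then show ?thesis
      using e K_closed[OF value_at(1)[OF R RR_space_VR[OF g P]]] K_closed[OF value_at(1)[OF R RR_space_VR[OF h(1) P]]] by simp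
  qed
  then have "(\<lambda>i. Ps ! i) ` ?E \<subseteq> {P \<in> set Ps. value_at F K ?h P = \<zero>}" by auto
  moreover have "inj_on (\<lambda>i. Ps ! i) ?E" using Ps(1) by (auto simp: inj_on_def nth_eq_iff_index_eq)
  ultimately have "card ?E \<le> card {P \<in> set Ps. value_at F K ?h P = \<zero>}" by (intro card_inj_on_le) auto
  then have E: "int (card ?E) \<le> divisor_degree F K G" using zeros_le_degree[OF h] by linarith
  have "?E \<union> ?D = {..<length Ps}" "?E \<inter> ?D = {}" by auto
  then have "card ?E + card ?D = length Ps"
    using card_Un_disjoint[of ?E ?D] by simp
  then show ?thesis using E by (simp add: hamming_dist_def)
qed

end
end

section \<open>The concatenated code\<close>

locale encoded_function_field = global_function_field +
  fixes Fq :: "'a set" and r q :: nat and \<phi> :: "'a \<Rightarrow> 'a list"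
  assumes card_K: "card K = q ^ r" and r_pos: "r \<ge> 1"
    and subfield_Fq: "subfield Fq F" and Fq_K: "Fq \<subseteq> K" and card_Fq: "card Fq = q"
    and encoding: "encoding F Fq K (r + 1) (parity_code (F\<lparr>carrier := Fq\<rparr>) (r + 1)) \<phi>"
begin

abbreviation "R_q \<equiv> F\<lparr>carrier := Fq\<rparr>"
abbreviation "Cpar \<equiv> parity_code R_q (r + 1)"

lemma field_R_q: "field R_q" using subfield_iff(2)[OF subfield_Fq] .

lemma finite_Fq: "finite Fq" using Fq_K finite_K finite_subset by blast

lemma bij_phi: "bij_betw \<phi> K Cpar" using encoding by (simp add: encoding_def)

lemma phi_add: "a \<in> K \<Longrightarrow> b \<in> K \<Longrightarrow> \<phi> (a \<oplus> b) = map2 (\<oplus>) (\<phi> a) (\<phi> b)"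
  and phi_smult: "c \<in> Fq \<Longrightarrow> a \<in> K \<Longrightarrow> \<phi> (c \<otimes> a) = map ((\<otimes>) c) (\<phi> a)"
proof -
  have "linear_map R_q (extension_space F K) (word_space R_q (r + 1)\<lparr>carrier := Cpar\<rparr>) \<phi>"
    using encoding by (simp add: encoding_def)
  then interpret L: linear_map R_q "extension_space F K" "word_space R_q (r + 1)\<lparr>carrier := Cpar\<rparr>" \<phi> .
  show "a \<in> K \<Longrightarrow> b \<in> K \<Longrightarrow> \<phi> (a \<oplus> b) = map2 (\<oplus>) (\<phi> a) (\<phi> b)"
    using L.T_add[of a b] by (simp add: extension_space_def word_space_def)
  show "c \<in> Fq \<Longrightarrow> a \<in> K \<Longrightarrow> \<phi> (c \<otimes> a) = map ((\<otimes>) c) (\<phi> a)"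
    using L.T_smult[of c a] by (simp add: extension_space_def word_space_def)
qed

lemma phi_mem: "a \<in> K \<Longrightarrow> \<phi> a \<in> Cpar" using bij_phi by (auto simp: bij_betw_def)

lemma phi_length: "a \<in> K \<Longrightarrow> length (\<phi> a) = r + 1" using phi_mem by (auto simp: mem_parity_code)

lemma phi_dist: "a \<in> K \<Longrightarrow> b \<in> K \<Longrightarrow> a \<noteq> b \<Longrightarrow> 2 \<le> hamming_dist (\<phi> a) (\<phi> b)"
  using field.parity_code_dist_ge_2[OF field_R_q phi_mem phi_mem] bij_phi
  by (auto simp: bij_betw_def dest: inj_onD)

lemma q_ge_2: "q \<ge> 2"
proof -
  have "card {\<zero>, \<one>} \<le> card Fq"
    using subringE(2,3)[OF subfieldE(1)[OF subfield_Fq]] finite_Fq by (intro card_mono) auto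
  then show ?thesis using card_Fq by simp
qed

text \<open>The encoding is a bijection with \<open>K\<close>, so the inner code has
  \<open>q ^ r\<close> words; its dimension follows by counting.\<close>

lemma parity_code_facts: "linear_code R_q (r + 1) Cpar" "code_dim R_q (r + 1) Cpar = r" "min_dist Cpar = 2"
proof -
  show lin: "linear_code R_q (r + 1) Cpar" using field.linear_parity_code[OF field_R_q] .
  have "card Cpar = q ^ r" using bij_betw_same_card[OF bij_phi] card_K by simp
  then have "q ^ code_dim R_q (r + 1) Cpar = q ^ r"
    using card_linear_code[OF field_R_q _ lin] finite_Fq card_Fq by simp
  moreover have "1 < q" using q_ge_2 by simp
  ultimately show "code_dim R_q (r + 1) Cpar = r" using power_inject_exp by blast
  show "min_dist Cpar = 2" using field.min_dist_parity_code[OF field_R_q] r_pos by simp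
qed

context
  fixes Ps G k0
  assumes Ps: "distinct Ps" "set Ps \<subseteq> rational_places F K"
    and G: "G \<in> divisors F K" "Poly_Mapping.keys G \<inter> set Ps = {}"
    and deg: "divisor_degree F K G = k0 + genus F K - 1"
    and k0: "genus F K - 1 < k0" "k0 < int (length Ps) - genus F K + 1"
begin

abbreviation "C_out \<equiv> ag_code F K Ps G"
abbreviation "C_conc \<equiv> concatenated_code \<phi> C_out"
abbreviation "codeword f \<equiv> concat (map \<phi> (ev Ps f))"

lemma C_conc_eq: "C_conc = codeword ` RR_space G"
  by (simp add: concatenated_code_def ag_code_def image_image)

lemma C_out_words: "c \<in> C_out \<Longrightarrow> length c = length Ps \<and> set c \<subseteq> K"
proof -
  assume "c \<in> C_out"
  then obtain f where "f \<in> RR_space G" "c = ev Ps f" by (auto simp: ag_code_def)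
  then show ?thesis using ev_simps(1)[OF Ps G, of f] by simp
qed

lemma codeword_length: "f \<in> RR_space G \<Longrightarrow> length (codeword f) = (r + 1) * length Ps"
  using length_concat_blocks[of "ev Ps f" \<phi> "r + 1"] phi_length ev_simps(1)[OF Ps G, of f] by auto

lemma codeword_dist:
  assumes f: "f \<in> RR_space G" and g: "g \<in> RR_space G" and "f \<noteq> g"
  shows "2 * (int (length Ps) - divisor_degree F K G) \<le> int (hamming_dist (codeword f) (codeword g))"
proof -
  have "2 * (int (length Ps) - divisor_degree F K G) \<le> 2 * int (hamming_dist (ev Ps f) (ev Ps g))"
    using ev_dist[OF Ps G assms] by (rule mult_left_mono) simp
  also have "\<dots> = int (2 * hamming_dist (ev Ps f) (ev Ps g))" by simp
  also have "\<dots> \<le> int (hamming_dist (codeword f) (codeword g))"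
    unfolding of_nat_le_iff
    by (rule hamming_dist_concat_ge[of _ _ K])
       (use ev_simps(1)[OF Ps G f] ev_simps(1)[OF Ps G g] phi_length phi_dist in auto)
  finally show ?thesis .
qed

lemma degree_less: "divisor_degree F K G < int (length Ps)"
  using deg k0 by simp

text \<open>The distance bound is positive because the upper bound on \<open>k0\<close> makes deg G
  smaller than the number of places.\<close>

lemma inj_codeword: "inj_on codeword (RR_space G)"
proof (rule inj_onI, rule ccontr)
  fix f g assume fg: "f \<in> RR_space G" "g \<in> RR_space G" "codeword f = codeword g" "f \<noteq> g"
  have "hamming_dist (codeword f) (codeword g) = 0" using fg(3) by (simp add: hamming_dist_def)
  then show False using codeword_dist[OF fg(1,2,4)] degree_less by simp
qed

lemma linear_C_conc: "linear_code R_q ((r + 1) * length Ps) C_conc"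
proof (rule linear_codeI[OF field_R_q])
  show "C_conc \<subseteq> carrier (word_space R_q ((r + 1) * length Ps))"
  proof
    fix w assume "w \<in> C_conc"
    then obtain f where f: "f \<in> RR_space G" "w = codeword f" using C_conc_eq by auto
    have "set (\<phi> a) \<subseteq> Fq" if "a \<in> K" for a
      using phi_mem[OF that] by (auto simp: mem_parity_code in_set_conv_nth)
    then have "set w \<subseteq> Fq" using ev_simps(1)[OF Ps G f(1)] f(2) by auto
    then show "w \<in> carrier (word_space R_q ((r + 1) * length Ps))"
      using codeword_length[OF f(1)] f(2) by (simp add: word_space_def)
  qed
  have add: "map2 (\<oplus>) (codeword f) (codeword g) = codeword (f \<oplus> g)" if "f \<in> RR_space G" "g \<in> RR_space G" for f g
    using concat_map2[of "ev Ps f" "ev Ps g" K \<phi> "r + 1" "(\<oplus>)" "(\<oplus>)"] phi_length phi_add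
      ev_simps(1)[OF Ps G that(1)] ev_simps(1)[OF Ps G that(2)] ev_simps(2)[OF Ps G that] by simp
  have smult: "map ((\<otimes>) c) (codeword f) = codeword (c \<otimes> f)" if c: "c \<in> Fq" and f: "f \<in> RR_space G" for c f
  proof -
    have cK: "c \<in> K" using c Fq_K by blast
    have "map ((\<otimes>) c) (concat (map \<phi> l)) = concat (map \<phi> (map ((\<otimes>) c) l))" if "set l \<subseteq> K" for l
      using that by (induction l) (auto simp: phi_smult c)
    from this[OF ev_simps(1)[OF Ps G f]] show ?thesis by (simp only: ev_simps(3)[OF Ps G cK f])
  qed
  show "map2 (\<oplus>\<^bsub>R_q\<^esub>) u w \<in> C_conc" if "u \<in> C_conc" "w \<in> C_conc" for u w
    using that add RR_space_closed(3)[OF Ps G] unfolding C_conc_eq by auto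
  show sm: "map ((\<otimes>\<^bsub>R_q\<^esub>) a) w \<in> C_conc" if "a \<in> carrier R_q" "w \<in> C_conc" for a w
    using that smult RR_space_closed(5)[OF Ps G] Fq_K unfolding C_conc_eq by auto
  have z: "codeword \<zero> \<in> C_conc" using RR_space_closed(2)[OF Ps G] unfolding C_conc_eq by blast
  \<comment> \<open>The zero word is reached as the multiple by 0 of a codeword, using the closure
    under scalars just shown.\<close>
  have "map ((\<otimes>) \<zero>) (codeword \<zero>) = replicate ((r + 1) * length Ps) \<zero>"
  proof -
    have "set (codeword \<zero>) \<subseteq> carrier F"
      using phi_mem ev_simps(1)[OF Ps G RR_space_closed(2)[OF Ps G]] subfieldE(3)[OF subfield_Fq]
      by (fastforce simp: mem_parity_code in_set_conv_nth)
    then have "map ((\<otimes>) \<zero>) (codeword \<zero>) = map (\<lambda>_. \<zero>) (codeword \<zero>)" by (intro map_cong) auto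
    then show ?thesis using codeword_length[OF RR_space_closed(2)[OF Ps G]] by (simp add: map_replicate_const)
  qed
  then show "replicate ((r + 1) * length Ps) \<zero>\<^bsub>R_q\<^esub> \<in> C_conc"
    using sm[OF _ z, of \<zero>] subringE(2)[OF subfieldE(1)[OF subfield_Fq]] by simp
qed

lemma locality_C_conc: "has_locality ((r + 1) * length Ps) r C_conc"
proof (rule has_locality_concatenated[of C_out _ K])
  show "\<And>c. c \<in> C_out \<Longrightarrow> length c = length Ps \<and> set c \<subseteq> K" by (rule C_out_words)
  show "\<And>a. a \<in> K \<Longrightarrow> length (\<phi> a) = r + 1" by (rule phi_length)
  show "\<phi> a ! i = \<phi> b ! i" if "a \<in> K" "b \<in> K" "i < r + 1"
    "\<And>j. j < r + 1 \<Longrightarrow> j \<noteq> i \<Longrightarrow> \<phi> a ! j = \<phi> b ! j" for a b i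
    by (rule field.parity_code_determined[OF field_R_q phi_mem[OF that(1)] phi_mem[OF that(2)] that(3,4)])
qed

text \<open>The lower bound on \<open>k0\<close> says that \<open>k0\<close> is at least g, so deg G
  = k0 + g - 1 reaches 2 g - 1 and the exact dimension formula applies.\<close>

lemma card_RR_space: "card (RR_space G) = Q ^ nat k0" "k0 \<ge> 0"
proof -
  have "divisor_degree F K G \<ge> 2 * genus F K - 1" using deg k0 by simp
  note rr = card_riemann_roch[OF G(1) this]
  then have e: "int (ell (Poly_Mapping.lookup G)) = k0" using deg by simp
  then show "k0 \<ge> 0" by linarith
  have "ell (Poly_Mapping.lookup G) = nat k0" using e by linarith
  then show "card (RR_space G) = Q ^ nat k0" using rr(3) by simp
qed

lemma dim_C_conc: "int (code_dim R_q ((r + 1) * length Ps) C_conc) = int r * k0"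
proof -
  have "card C_conc = (q ^ r) ^ nat k0" using card_image[OF inj_codeword] card_RR_space card_K unfolding C_conc_eq by simp
  then have "q ^ code_dim R_q ((r + 1) * length Ps) C_conc = q ^ (r * nat k0)"
    using card_linear_code[OF field_R_q _ linear_C_conc] finite_Fq card_Fq by (simp add: power_mult)
  moreover have "1 < q" using q_ge_2 by simp
  ultimately have "code_dim R_q ((r + 1) * length Ps) C_conc = r * nat k0" using power_inject_exp by blast
  then show ?thesis using card_RR_space(2) by simp
qed

text \<open>Without places the only word is the empty one, whereas injectivity yields at least
  \<open>Q\<close> codewords. It licenses the division by the length in the rate.\<close>

lemma length_Ps_pos: "k0 \<ge> 1 \<Longrightarrow> length Ps > 0"
proof (rule ccontr)
  assume "k0 \<ge> 1" "\<not> length Ps > 0"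
  then have "codeword ` RR_space G \<subseteq> {[]}" by auto
  from card_mono[OF _ this] have "card (codeword ` RR_space G) \<le> 1" by simp
  then have "Q ^ nat k0 \<le> 1" using card_image[OF inj_codeword] card_RR_space(1) by simp
  moreover have "Q ^ 1 \<le> Q ^ nat k0" using Q_ge_2 \<open>k0 \<ge> 1\<close> by (intro power_increasing) auto
  ultimately show False using Q_ge_2 by simp
qed

lemma min_dist_C_conc:
  assumes "k0 \<ge> 1"
  shows "2 * (int (length Ps) - divisor_degree F K G) \<le> int (min_dist C_conc)"
proof -
  let ?S = "{hamming_dist v w | v w. v \<in> C_conc \<and> w \<in> C_conc \<and> v \<noteq> w}"
  have "card (RR_space G) > 0" using card_RR_space(1) Q_ge_2 by simp
  then have "finite (RR_space G)" by (rule card_ge_0_finite)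
  then have fin: "finite C_conc" unfolding C_conc_eq by simp
  have "?S \<subseteq> (\<lambda>(v, w). hamming_dist v w) ` (C_conc \<times> C_conc)" by auto
  then have finS: "finite ?S" using fin finite_subset by blast
  \<comment> \<open>Two distinct codewords are needed for the minimum to range over a nonempty set;
    they exist because the dimension is at least 1.\<close>
  have "Q ^ 1 \<le> Q ^ nat k0" using Q_ge_2 assms by (intro power_increasing) auto
  then have "card C_conc \<ge> 2" using card_image[OF inj_codeword] card_RR_space(1) Q_ge_2 unfolding C_conc_eq by simp
  then have "\<not> card C_conc \<le> Suc 0" by simp
  then have "\<exists>v\<in>C_conc. \<exists>w\<in>C_conc. v \<noteq> w" unfolding card_le_Suc0_iff_eq[OF fin] by blast
  then have "?S \<noteq> {}" by blast
  then have "min_dist C_conc \<in> ?S" unfolding min_dist_def using Min_in[OF finS] by blast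
  then obtain f g where "f \<in> RR_space G" "g \<in> RR_space G" "codeword f \<noteq> codeword g" "min_dist C_conc = hamming_dist (codeword f) (codeword g)"
    unfolding C_conc_eq by auto
  then show ?thesis using codeword_dist[of f g] by auto
qed

end
end

section \<open>From the hypotheses to the theorem\<close>

lemma function_field_locale:
  assumes "function_field F K" "full_constant_field F K" "finite K"
  obtains x Us where "global_function_field F K x Us"
proof -
  have F: "field F" "subfield K F" using assms by (auto simp: function_field_def)
  interpret field F by (rule F)
  obtain x where x: "x \<in> carrier F" "transcendental K x"
    "finite_dimension (generate_field F (insert x K)) (carrier F)"
    using assms(1) by (auto simp: function_field_def)
  have "insert x K \<subseteq> carrier F" using x(1) subfieldE(3)[OF F(2)] by blast
  then have sf: "subfield (generate_field F (insert x K)) F" by (rule generate_field_is_subfield)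
  obtain d where "dimension d (generate_field F (insert x K)) (carrier F)"
    using x(3) by (rule finite_dimensionE')
  then obtain Us where Us: "independent (generate_field F (insert x K)) Us"
    "Span (generate_field F (insert x K)) Us = carrier F"
    using exists_base[OF sf] by blast
  have "global_function_field F K x Us"
    by (intro global_function_field.intro finite_function_field.intro finite_constants.intro
        finite_constants_axioms.intro finite_function_field_axioms.intro global_function_field_axioms.intro
        F x(1,2) Us assms(2,3))
  then show ?thesis by (rule that)
qed

theorem proposition5p1:
  fixes F :: "('a, 'm) ring_scheme"
    and K Fq :: "'a set"
    and q r s :: nat
    and g k0 :: int
    and Ps :: "'a set list"
    and G :: "'a set \<Rightarrow>\<^sub>0 int"
    and \<phi> :: "'a \<Rightarrow> 'a list"
  assumes "function_field F K" and "full_constant_field F K"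
    and "finite K" and "card K = q ^ r" and "r \<ge> 1"
    and "subfield Fq F" and "Fq \<subseteq> K" and "card Fq = q"
    and "genus F K = g"
    and "length Ps = s" and "distinct Ps" and "set Ps \<subseteq> rational_places F K"
    and "g - 1 < k0" and "k0 < int s - g + 1"
    and "G \<in> divisors F K" and "divisor_degree F K G = k0 + g - 1"
    and "Poly_Mapping.keys G \<inter> set Ps = {}"
    and "encoding F Fq K (r + 1) (parity_code (F\<lparr>carrier := Fq\<rparr>) (r + 1)) \<phi>"
  shows
    "let R = F\<lparr>carrier := Fq\<rparr>;
         Cpar = parity_code R (r + 1);
         C = concatenated_code \<phi> (ag_code F K Ps G);
         n = (r + 1) * s;
         k = code_dim R n C;
         d = min_dist C;
         \<delta> = real d / real n
     in linear_code R (r + 1) Cpar \<and> code_dim R (r + 1) Cpar = r \<and> min_dist Cpar = 2 \<and>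
        linear_code R n C \<and> has_locality n r C \<and> int k = int r * k0 \<and>
        (k0 \<ge> 1 \<longrightarrow>
           real d \<ge> 2 * (real s - real k / real r - real_of_int g + 1) \<and>
           real k / real n \<ge>
             real r / (real r + 1) - real r / 2 * \<delta> - real r * (real_of_int g - 1) / real n)"
proof -
  obtain x Us where "global_function_field F K x Us"
    using function_field_locale[OF assms(1-3)] .
  then interpret encoded_function_field F K x Us Fq r q \<phi>
    by (intro encoded_function_field.intro encoded_function_field_axioms.intro assms(4-8,18))
  define C where "C = concatenated_code \<phi> (ag_code F K Ps G)"
  define n where "n = (r + 1) * s"
  define k where "k = code_dim R_q n C"
  define d where "d = min_dist C"
  note ctx = assms(11,12,15,17) assms(16)[folded assms(9)] assms(13)[folded assms(9)] assms(14)[folded assms(9,10)]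
  have lin: "linear_code R_q n C" and loc: "has_locality n r C" and dim: "int k = int r * k0"
    using linear_C_conc[OF ctx] locality_C_conc[OF ctx] dim_C_conc[OF ctx] by (simp_all add: C_def n_def k_def assms(10))
  have bounds: "real d \<ge> 2 * (real s - real k / real r - real_of_int g + 1) \<and>
      real k / real n \<ge> real r / (real r + 1) - real r / 2 * (real d / real n) - real r * (real_of_int g - 1) / real n"
    if k1: "k0 \<ge> 1"
  proof
    have rp: "real r > 0" using assms(5) by simp
    have "real k = real r * real_of_int k0" using dim by (metis of_int_mult of_int_of_nat_eq)
    then have kr: "real k / real r = real_of_int k0" using rp by simp
    have "2 * (int s - (k0 + g - 1)) \<le> int d"
      using min_dist_C_conc[OF ctx k1] assms(10,16) by (simp add: d_def C_def)
    then have "real_of_int (2 * (int s - (k0 + g - 1))) \<le> real_of_int (int d)" by (simp only: of_int_le_iff)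
    then show b: "real d \<ge> 2 * (real s - real k / real r - real_of_int g + 1)"
      unfolding kr by simp
    have "s > 0" using length_Ps_pos[OF ctx k1] assms(10) by simp
    then have "n > 0" by (simp add: n_def)
    then have np: "real n > 0" by simp
    have rn: "real n = (real r + 1) * real s" by (simp add: n_def algebra_simps)
    \<comment> \<open>The distance bound solved for k / r and multiplied by r; division by n = (r +
      1) s then gives the rate.\<close>
    have "real r * (real s - real d / 2 - (real_of_int g - 1)) \<le> real r * (real k / real r)"
      using b rp by (intro mult_left_mono) auto
    then have "real r * real s - real r / 2 * real d - real r * (real_of_int g - 1) \<le> real k"
      using rp by (simp add: algebra_simps)
    then have "(real r * real s - real r / 2 * real d - real r * (real_of_int g - 1)) / real n \<le> real k / real n"
      using np by (intro divide_right_mono) auto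
    moreover have "real r * real s / real n = real r / (real r + 1)"
      using \<open>s > 0\<close> unfolding rn by simp
    ultimately show "real k / real n \<ge> real r / (real r + 1) - real r / 2 * (real d / real n) - real r * (real_of_int g - 1) / real n"
      by (simp add: diff_divide_distrib)
  qed
  show ?thesis
    unfolding Let_def C_def[symmetric] n_def[symmetric] k_def[symmetric] d_def[symmetric]
    using parity_code_facts lin loc dim bounds by blast
qed

end
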